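(* Let $\mathbb{M}$ be a monster model of a complete $C$-minimal expansion of ACVF whose language contains a constant symbol $t$ with $v(t)>0$, and suppose $\mathbb{M}$ is definably complete. Let $f:\mathbb{M}^\times\to\mathbb{M}^\times$ be a definable group endomorphism. Then: (1) there is a definable endomorphism $g$ of $(\Gamma,+)$ such that $v(f(x))=g(v(x))$ for all $x\in\mathbb{M}^\times$; (2) if $k^\times$ has no exotic automorphisms or $\Gamma$ has no exotic automorphisms, then $g(x)=q\cdot x$ for some $q\in\mathbb Q$; (3) if $g(x)=q\cdot x$ for some $q\in\mathbb Q$, then $q=n/p^m$ for integers $n,m$, where $p$ is the characteristic exponent of $\mathbb{M}$, and $f(x)=x^{n/p^m}$ for all $x$.
   Context: ACVF is the theory of algebraically closed non-trivially valued fields; $C$-minimal means every definable subset of the home sort is a finite boolean combination of balls and points. "Definable" means with parameters. $v$ is the valuation, $\Gamma$ the value group, $k$ the residue field. $\mathbb{M}$ is definably complete if every definable chain of balls whose radii approach $+\infty$ has non-empty intersection. "$k^\times$ has no exotic automorphisms": every definable automorphism of the multiplicative group $k^\times$ is definable in the pure ring language on $k$. "$\Gamma$ has no exotic automorphisms": the only definable automorphisms of $(\Gamma,+,\le)$ are multiplication by positive rationals. The characteristic exponent is $1$ in characteristic $0$ and $p$ in characteristic $p>0$; $x^{n/p^m}$ denotes the image of $x^n$ under the inverse of the $m$-th power of Frobenius (a bijection, since $\mathbb{M}$ is perfect). *)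

theory Defs
  imports "HOL-Computational_Algebra.Computational_Algebra"
begin

unbundle cardinal_syntax

section \<open>First-order logic\<close>

text \<open>
  A language consists of two partial maps giving the arities of its function symbols and of its
  relation symbols; a symbol mapped to \<^const>\<open>None\<close> does not belong to the language.
\<close>

type_synonym ('f, 'r) lang = "('f \<rightharpoonup> nat) \<times> ('r \<rightharpoonup> nat)"

datatype 'f tm = Var nat | App 'f "'f tm list"

datatype ('f, 'r) fm =
    Eq "'f tm" "'f tm"
  | Rel 'r "'f tm list"
  | Neg "('f, 'r) fm"
  | Conj "('f, 'r) fm" "('f, 'r) fm"
  | Exists nat "('f, 'r) fm"

fun tm_vars :: "'f tm \<Rightarrow> nat set" where
  "tm_vars (Var i) = {i}"
| "tm_vars (App s ts) = (\<Union>u\<in>set ts. tm_vars u)"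

fun fm_vars :: "('f, 'r) fm \<Rightarrow> nat set" where
  "fm_vars (Eq u w) = tm_vars u \<union> tm_vars w"
| "fm_vars (Rel s ts) = (\<Union>u\<in>set ts. tm_vars u)"
| "fm_vars (Neg \<phi>) = fm_vars \<phi>"
| "fm_vars (Conj \<phi> \<psi>) = fm_vars \<phi> \<union> fm_vars \<psi>"
| "fm_vars (Exists i \<phi>) = fm_vars \<phi> - {i}"

fun lang_tm :: "('f, 'r) lang \<Rightarrow> 'f tm \<Rightarrow> bool" where
  "lang_tm L (Var i) \<longleftrightarrow> True"
| "lang_tm L (App s ts) \<longleftrightarrow> fst L s = Some (length ts) \<and> (\<forall>u\<in>set ts. lang_tm L u)"

fun lang_fm :: "('f, 'r) lang \<Rightarrow> ('f, 'r) fm \<Rightarrow> bool" where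
  "lang_fm L (Eq u w) \<longleftrightarrow> lang_tm L u \<and> lang_tm L w"
| "lang_fm L (Rel s ts) \<longleftrightarrow> snd L s = Some (length ts) \<and> (\<forall>u\<in>set ts. lang_tm L u)"
| "lang_fm L (Neg \<phi>) \<longleftrightarrow> lang_fm L \<phi>"
| "lang_fm L (Conj \<phi> \<psi>) \<longleftrightarrow> lang_fm L \<phi> \<and> lang_fm L \<psi>"
| "lang_fm L (Exists i \<phi>) \<longleftrightarrow> lang_fm L \<phi>"

definition sentences :: "('f, 'r) lang \<Rightarrow> ('f, 'r) fm set" where
  "sentences L = {\<phi>. lang_fm L \<phi> \<and> fm_vars \<phi> = {}}"

record ('f, 'r, 'a) fo_struct =
  univ :: "'a set"
  fn :: "'f \<Rightarrow> 'a list \<Rightarrow> 'a"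
  rl :: "'r \<Rightarrow> 'a list \<Rightarrow> bool"

definition is_struct :: "('f, 'r) lang \<Rightarrow> ('f, 'r, 'a) fo_struct \<Rightarrow> bool" where
  "is_struct L N \<longleftrightarrow> univ N \<noteq> {} \<and>
     (\<forall>s xs. fst L s = Some (length xs) \<longrightarrow> set xs \<subseteq> univ N \<longrightarrow> fn N s xs \<in> univ N)"

fun tm_val :: "('f, 'r, 'a) fo_struct \<Rightarrow> (nat \<Rightarrow> 'a) \<Rightarrow> 'f tm \<Rightarrow> 'a" where
  "tm_val N e (Var i) = e i"
| "tm_val N e (App s ts) = fn N s (map (tm_val N e) ts)"

fun sat :: "('f, 'r, 'a) fo_struct \<Rightarrow> (nat \<Rightarrow> 'a) \<Rightarrow> ('f, 'r) fm \<Rightarrow> bool" where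
  "sat N e (Eq u w) \<longleftrightarrow> tm_val N e u = tm_val N e w"
| "sat N e (Rel s ts) \<longleftrightarrow> rl N s (map (tm_val N e) ts)"
| "sat N e (Neg \<phi>) \<longleftrightarrow> \<not> sat N e \<phi>"
| "sat N e (Conj \<phi> \<psi>) \<longleftrightarrow> sat N e \<phi> \<and> sat N e \<psi>"
| "sat N e (Exists i \<phi>) \<longleftrightarrow> (\<exists>a\<in>univ N. sat N (e(i := a)) \<phi>)"

definition is_model :: "('f, 'r) lang \<Rightarrow> ('f, 'r) fm set \<Rightarrow> ('f, 'r, 'a) fo_struct \<Rightarrow> bool" where
  "is_model L T N \<longleftrightarrow> is_struct L N \<and>
     (\<forall>\<phi>\<in>T. \<forall>e. range e \<subseteq> univ N \<longrightarrow> sat N e \<phi>)"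

text \<open>
  Theories are identified with their deductive closures, so a complete theory contains each
  sentence or its negation. Consistency is not included: it always comes from a given model.
\<close>

definition complete_theory :: "('f, 'r) lang \<Rightarrow> ('f, 'r) fm set \<Rightarrow> bool" where
  "complete_theory L T \<longleftrightarrow> T \<subseteq> sentences L \<and> (\<forall>\<phi>\<in>sentences L. \<phi> \<in> T \<or> Neg \<phi> \<in> T)"

text \<open>
  Definability is with parameters. Sets of \<open>n\<close>-tuples are sets of lists of length \<open>n\<close>; the
  variables below \<open>n\<close> are the coordinates, and the assignment \<open>e\<close> supplies the parameters for
  all other variables.
\<close>

definition definable :: "('f, 'r) lang \<Rightarrow> ('f, 'r, 'a) fo_struct \<Rightarrow> nat \<Rightarrow> 'a list set \<Rightarrow> bool" where
  "definable L N n S \<longleftrightarrow> (\<exists>\<phi> e. lang_fm L \<phi> \<and> range e \<subseteq> univ N \<and>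
     S = {xs. length xs = n \<and> set xs \<subseteq> univ N \<and> sat N (\<lambda>i. if i < n then xs ! i else e i) \<phi>})"

section \<open>Monster models\<close>

text \<open>
  A 1-type over \<open>A\<close> is given by pairs of a formula in the variable 0 and an assignment of elements
  of \<open>A\<close> to its other free variables. The condition on \<open>p\<close> is finite satisfiability.
\<close>

definition saturated :: "('f, 'r) lang \<Rightarrow> ('f, 'r, 'a) fo_struct \<Rightarrow> 'a rel \<Rightarrow> bool" where
  "saturated L N \<kappa> \<longleftrightarrow> (\<forall>A\<subseteq>univ N. |A| <o \<kappa> \<longrightarrow>
     (\<forall>p :: (('f, 'r) fm \<times> (nat \<Rightarrow> 'a)) set.
        (\<forall>(\<phi>, e)\<in>p. lang_fm L \<phi> \<and> e ` (fm_vars \<phi> - {0}) \<subseteq> A) \<longrightarrow>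
        (\<forall>q\<subseteq>p. finite q \<longrightarrow> (\<exists>a\<in>univ N. \<forall>(\<phi>, e)\<in>q. sat N (e(0 := a)) \<phi>)) \<longrightarrow>
        (\<exists>a\<in>univ N. \<forall>(\<phi>, e)\<in>p. sat N (e(0 := a)) \<phi>)))"

definition partial_elementary ::
    "('f, 'r) lang \<Rightarrow> ('f, 'r, 'a) fo_struct \<Rightarrow> 'a set \<Rightarrow> ('a \<Rightarrow> 'a) \<Rightarrow> bool" where
  "partial_elementary L N A h \<longleftrightarrow> h ` A \<subseteq> univ N \<and>
     (\<forall>\<phi> e. lang_fm L \<phi> \<longrightarrow> e ` fm_vars \<phi> \<subseteq> A \<longrightarrow> sat N e \<phi> = sat N (h \<circ> e) \<phi>)"

definition automorphism :: "('f, 'r) lang \<Rightarrow> ('f, 'r, 'a) fo_struct \<Rightarrow> ('a \<Rightarrow> 'a) \<Rightarrow> bool" where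
  "automorphism L N \<sigma> \<longleftrightarrow> bij_betw \<sigma> (univ N) (univ N) \<and>
     (\<forall>s xs. fst L s = Some (length xs) \<longrightarrow> set xs \<subseteq> univ N \<longrightarrow>
        \<sigma> (fn N s xs) = fn N s (map \<sigma> xs)) \<and>
     (\<forall>s xs. snd L s = Some (length xs) \<longrightarrow> set xs \<subseteq> univ N \<longrightarrow>
        rl N s (map \<sigma> xs) = rl N s xs)"

definition strongly_homogeneous ::
    "('f, 'r) lang \<Rightarrow> ('f, 'r, 'a) fo_struct \<Rightarrow> 'a rel \<Rightarrow> bool" where
  "strongly_homogeneous L N \<kappa> \<longleftrightarrow> (\<forall>A\<subseteq>univ N. |A| <o \<kappa> \<longrightarrow>
     (\<forall>h. partial_elementary L N A h \<longrightarrow>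
        (\<exists>\<sigma>. automorphism L N \<sigma> \<and> (\<forall>a\<in>A. \<sigma> a = h a))))"

text \<open>
  The cardinal \<open>\<kappa>\<close> is required to exceed the number of formulas of the language, that is, the
  maximum of the size of the language and \<open>\<aleph>\<^sub>0\<close>. An infinite \<open>\<kappa>\<close>-saturated structure has
  at least \<open>\<kappa>\<close> elements, so nothing is lost by taking \<open>\<kappa>\<close> on the type of the universe.
\<close>

definition monster_model ::
    "('f, 'r) lang \<Rightarrow> ('f, 'r) fm set \<Rightarrow> ('f, 'r, 'a) fo_struct \<Rightarrow> bool" where
  "monster_model L T N \<longleftrightarrow> is_model L T N \<and>
     (\<exists>\<kappa> :: 'a rel. Card_order \<kappa> \<and> |{\<phi>. lang_fm L \<phi>}| <o \<kappa> \<and>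
        saturated L N \<kappa> \<and> strongly_homogeneous L N \<kappa>)"

section \<open>Languages of rings and of valued fields\<close>

datatype ring_fun = RZero | ROne | RPlus | RMinus | RTimes

fun ring_arity :: "ring_fun \<Rightarrow> nat" where
  "ring_arity RZero = 0"
| "ring_arity ROne = 0"
| "ring_arity RPlus = 2"
| "ring_arity RMinus = 2"
| "ring_arity RTimes = 2"

definition ring_lang :: "(ring_fun, unit) lang" where
  "ring_lang = (\<lambda>s. Some (ring_arity s), \<lambda>_. None)"

fun ring_interp :: "ring_fun \<Rightarrow> 'b::field list \<Rightarrow> 'b" where
  "ring_interp RZero xs = 0"
| "ring_interp ROne xs = 1"
| "ring_interp RPlus xs = xs ! 0 + xs ! 1"
| "ring_interp RMinus xs = xs ! 0 - xs ! 1"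
| "ring_interp RTimes xs = xs ! 0 * xs ! 1"

definition ring_struct :: "(ring_fun, unit, 'b::field) fo_struct" where
  "ring_struct = \<lparr>univ = UNIV, fn = ring_interp, rl = \<lambda>_ _. False\<rparr>"

text \<open>
  Valued fields are treated in the one-sorted language of the home sort, with a binary relation
  \<open>VDiv\<close> for \<open>v(x) \<le> v(y)\<close>; the value group and the residue field are imaginary sorts.
  \<open>TConst\<close> is the constant \<open>t\<close>, and the symbols \<open>NewF\<close>, \<open>NewR\<close> are those added by
  the expansion.
\<close>

datatype 'f vf_fun = Ring ring_fun | TConst | NewF 'f

datatype 'r vf_rel = VDiv | NewR 'r

definition vf_lang :: "('f, 'r) lang \<Rightarrow> ('f vf_fun, 'r vf_rel) lang" where
  "vf_lang E =
     (\<lambda>s. case s of Ring r \<Rightarrow> Some (ring_arity r) | TConst \<Rightarrow> Some 0 | NewF s' \<Rightarrow> fst E s',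
      \<lambda>s. case s of VDiv \<Rightarrow> Some 2 | NewR s' \<Rightarrow> snd E s')"

type_synonym ('f, 'r, 'a) vf_struct = "('f vf_fun, 'r vf_rel, 'a) fo_struct"

section \<open>Balls, C-minimality, definable completeness\<close>

text \<open>Balls with centre \<open>c\<close> and radius \<open>v(d)\<close>, where \<open>d\<close> is non-zero.\<close>

definition closed_ball :: "('f, 'r, 'a) vf_struct \<Rightarrow> 'a \<Rightarrow> 'a \<Rightarrow> 'a set" where
  "closed_ball N c d = {x \<in> univ N. rl N VDiv [d, fn N (Ring RMinus) [x, c]]}"

definition open_ball :: "('f, 'r, 'a) vf_struct \<Rightarrow> 'a \<Rightarrow> 'a \<Rightarrow> 'a set" where
  "open_ball N c d = {x \<in> univ N. \<not> rl N VDiv [fn N (Ring RMinus) [x, c], d]}"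

definition ball_of_radius :: "('f, 'r, 'a) vf_struct \<Rightarrow> 'a \<Rightarrow> 'a set \<Rightarrow> bool" where
  "ball_of_radius N d B \<longleftrightarrow> (\<exists>c\<in>univ N. B = closed_ball N c d \<or> B = open_ball N c d)"

definition nonzero :: "('f, 'r, 'a) vf_struct \<Rightarrow> 'a set" where
  "nonzero N = univ N - {fn N (Ring RZero) []}"

definition balls :: "('f, 'r, 'a) vf_struct \<Rightarrow> 'a set set" where
  "balls N = {B. \<exists>d\<in>nonzero N. ball_of_radius N d B}"

definition points :: "('f, 'r, 'a) vf_struct \<Rightarrow> 'a set set" where
  "points N = (\<lambda>c. {c}) ` univ N"

inductive_set boolean_combinations :: "'a set \<Rightarrow> 'a set set \<Rightarrow> 'a set set"
  for U :: "'a set" and G :: "'a set set" where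
  empty: "{} \<in> boolean_combinations U G"
| base: "X \<in> G \<Longrightarrow> X \<in> boolean_combinations U G"
| compl: "X \<in> boolean_combinations U G \<Longrightarrow> U - X \<in> boolean_combinations U G"
| union: "X \<in> boolean_combinations U G \<Longrightarrow> Y \<in> boolean_combinations U G \<Longrightarrow>
    X \<union> Y \<in> boolean_combinations U G"

definition C_minimal ::
    "('f vf_fun, 'r vf_rel) lang \<Rightarrow> ('f, 'r, 'a) vf_struct \<Rightarrow> bool" where
  "C_minimal L N \<longleftrightarrow> (\<forall>X\<subseteq>univ N. definable L N 1 ((\<lambda>x. [x]) ` X) \<longrightarrow>
     X \<in> boolean_combinations (univ N) (balls N \<union> points N))"

text \<open>
  C-minimality of a theory is C-minimality of all its models. The models range over the structures
  with universe contained in the type \<open>'a\<close>. If \<open>'a\<close> has at least as many elements as the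
  language has formulas, as is the case for the universe of a monster model, then by
  Loewenheim-Skolem (applied to a model and the parameters of a set violating C-minimality) this is
  no restriction.
\<close>

definition C_minimal_theory ::
    "'a itself \<Rightarrow> ('f vf_fun, 'r vf_rel) lang \<Rightarrow> ('f vf_fun, 'r vf_rel) fm set \<Rightarrow> bool" where
  "C_minimal_theory _ L T \<longleftrightarrow>
     (\<forall>N :: ('f, 'r, 'a) vf_struct. is_model L T N \<longrightarrow> C_minimal L N)"

text \<open>A definable family: the fibres of a definable set over a definable set of parameters.\<close>

definition definable_family ::
    "('f, 'r) lang \<Rightarrow> ('f, 'r, 'a) fo_struct \<Rightarrow> 'a set set \<Rightarrow> bool" where
  "definable_family L N C \<longleftrightarrow> (\<exists>n S I. definable L N (Suc n) S \<and> definable L N n I \<and>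
     C = {{x. x # ys \<in> S} | ys. ys \<in> I})"

definition definably_complete ::
    "('f vf_fun, 'r vf_rel) lang \<Rightarrow> ('f, 'r, 'a) vf_struct \<Rightarrow> bool" where
  "definably_complete L N \<longleftrightarrow> (\<forall>C. definable_family L N C \<longrightarrow> C \<subseteq> balls N \<longrightarrow>
     (\<forall>B\<in>C. \<forall>B'\<in>C. B \<subseteq> B' \<or> B' \<subseteq> B) \<longrightarrow>
     (\<forall>e\<in>nonzero N. \<exists>B\<in>C. \<exists>d\<in>nonzero N. rl N VDiv [e, d] \<and> ball_of_radius N d B) \<longrightarrow>
     \<Inter>C \<noteq> {})"

section \<open>Expansions of algebraically closed valued fields\<close>

text \<open>
  Only the values of \<open>v\<close> at non-zero elements matter; \<open>v(0) = \<infinity>\<close> is built into the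
  definitions below. The value group is the whole type \<open>'g\<close>, the residue field the whole
  type \<open>'k\<close>.
\<close>

definition valuation :: "('a::field \<Rightarrow> 'g::linordered_ab_group_add) \<Rightarrow> bool" where
  "valuation v \<longleftrightarrow>
     (\<forall>x y. x \<noteq> 0 \<longrightarrow> y \<noteq> 0 \<longrightarrow> v (x * y) = v x + v y) \<and>
     (\<forall>x y. x \<noteq> 0 \<longrightarrow> y \<noteq> 0 \<longrightarrow> x + y \<noteq> 0 \<longrightarrow> min (v x) (v y) \<le> v (x + y)) \<and>
     v ` (UNIV - {0}) = UNIV"

definition nontrivial_valuation :: "('a::field \<Rightarrow> 'g::linordered_ab_group_add) \<Rightarrow> bool" where
  "nontrivial_valuation v \<longleftrightarrow> valuation v \<and> (\<exists>x. x \<noteq> 0 \<and> v x \<noteq> 0)"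

definition valuation_ring :: "('a::field \<Rightarrow> 'g::linordered_ab_group_add) \<Rightarrow> 'a set" where
  "valuation_ring v = {x. x = 0 \<or> 0 \<le> v x}"

definition residue_map ::
    "('a::field \<Rightarrow> 'g::linordered_ab_group_add) \<Rightarrow> ('a \<Rightarrow> 'k::field) \<Rightarrow> bool" where
  "residue_map v res \<longleftrightarrow> res 1 = 1 \<and>
     (\<forall>x\<in>valuation_ring v. \<forall>y\<in>valuation_ring v.
        res (x + y) = res x + res y \<and> res (x * y) = res x * res y) \<and>
     (\<forall>x\<in>valuation_ring v. res x = 0 \<longleftrightarrow> x = 0 \<or> 0 < v x) \<and>
     res ` valuation_ring v = UNIV"

text \<open>
  The structure \<open>M\<close> has the field \<open>'a\<close> as universe and expands the valued field given by \<open>v\<close>.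
  For a complete theory \<open>T\<close> with model \<open>M\<close>, this says exactly that \<open>T\<close> extends ACVF.
\<close>

definition expands_ACVF ::
    "('f, 'r, 'a::alg_closed_field) vf_struct \<Rightarrow> ('a \<Rightarrow> 'g::linordered_ab_group_add) \<Rightarrow> bool" where
  "expands_ACVF M v \<longleftrightarrow> nontrivial_valuation v \<and> univ M = UNIV \<and>
     (\<forall>s xs. length xs = ring_arity s \<longrightarrow> fn M (Ring s) xs = ring_interp s xs) \<and>
     (\<forall>x y. rl M VDiv [x, y] \<longleftrightarrow> y = 0 \<or> x \<noteq> 0 \<and> v x \<le> v y)"

text \<open>Definability in the imaginary sorts \<open>\<Gamma>\<close> and \<open>k\<close>.\<close>

definition definable_VG ::
    "('f, 'r) lang \<Rightarrow> ('f, 'r, 'a::field) fo_struct \<Rightarrow> ('a \<Rightarrow> 'g::linordered_ab_group_add) \<Rightarrow>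
     nat \<Rightarrow> 'g list set \<Rightarrow> bool" where
  "definable_VG L M v n S \<longleftrightarrow> definable L M n {xs. 0 \<notin> set xs \<and> map v xs \<in> S}"

definition definable_RF ::
    "('f, 'r) lang \<Rightarrow> ('f, 'r, 'a::field) fo_struct \<Rightarrow> ('a \<Rightarrow> 'g::linordered_ab_group_add) \<Rightarrow>
     ('a \<Rightarrow> 'k::field) \<Rightarrow> nat \<Rightarrow> 'k list set \<Rightarrow> bool" where
  "definable_RF L M v res n S \<longleftrightarrow>
     definable L M n {xs. set xs \<subseteq> valuation_ring v \<and> map res xs \<in> S}"

definition graph_on :: "'b set \<Rightarrow> ('b \<Rightarrow> 'b) \<Rightarrow> 'b list set" where
  "graph_on A h = (\<lambda>x. [x, h x]) ` A"

section \<open>Endomorphisms and automorphisms\<close>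

definition definable_mult_endo ::
    "('f, 'r) lang \<Rightarrow> ('f, 'r, 'a::field) fo_struct \<Rightarrow> ('a \<Rightarrow> 'a) \<Rightarrow> bool" where
  "definable_mult_endo L M f \<longleftrightarrow>
     (\<forall>x. x \<noteq> 0 \<longrightarrow> f x \<noteq> 0) \<and>
     (\<forall>x y. x \<noteq> 0 \<longrightarrow> y \<noteq> 0 \<longrightarrow> f (x * y) = f x * f y) \<and>
     definable L M 2 (graph_on (UNIV - {0}) f)"

definition definable_VG_endo ::
    "('f, 'r) lang \<Rightarrow> ('f, 'r, 'a::field) fo_struct \<Rightarrow> ('a \<Rightarrow> 'g::linordered_ab_group_add) \<Rightarrow>
     ('g \<Rightarrow> 'g) \<Rightarrow> bool" where
  "definable_VG_endo L M v g \<longleftrightarrow>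
     (\<forall>\<alpha> \<beta>. g (\<alpha> + \<beta>) = g \<alpha> + g \<beta>) \<and> definable_VG L M v 2 (graph_on UNIV g)"

definition int_scale :: "int \<Rightarrow> 'g::ab_group_add \<Rightarrow> 'g" where
  "int_scale n \<gamma> = (if 0 \<le> n then (((+) \<gamma>) ^^ nat n) 0 else - (((+) \<gamma>) ^^ nat (- n)) 0)"

text \<open>
  The function \<open>g\<close> is multiplication by \<open>q = a / b\<close> (in lowest terms, with \<open>b > 0\<close>): as the
  group is divisible and torsion-free, \<open>q \<cdot> \<gamma>\<close> is the unique \<open>\<delta>\<close> with \<open>b \<cdot> \<delta> = a \<cdot> \<gamma>\<close>.
\<close>

definition is_rat_mult :: "rat \<Rightarrow> ('g::ab_group_add \<Rightarrow> 'g) \<Rightarrow> bool" where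
  "is_rat_mult q g \<longleftrightarrow>
     (\<forall>\<gamma>. int_scale (snd (quotient_of q)) (g \<gamma>) = int_scale (fst (quotient_of q)) \<gamma>)"

definition RF_no_exotic_automorphisms ::
    "('f, 'r) lang \<Rightarrow> ('f, 'r, 'a::field) fo_struct \<Rightarrow> ('a \<Rightarrow> 'g::linordered_ab_group_add) \<Rightarrow>
     ('a \<Rightarrow> 'k::field) \<Rightarrow> bool" where
  "RF_no_exotic_automorphisms L M v res \<longleftrightarrow> (\<forall>h :: 'k \<Rightarrow> 'k.
     bij_betw h (UNIV - {0}) (UNIV - {0}) \<longrightarrow>
     (\<forall>x y. x \<noteq> 0 \<longrightarrow> y \<noteq> 0 \<longrightarrow> h (x * y) = h x * h y) \<longrightarrow>
     definable_RF L M v res 2 (graph_on (UNIV - {0}) h) \<longrightarrow>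
     definable ring_lang ring_struct 2 (graph_on (UNIV - {0}) h))"

definition VG_no_exotic_automorphisms ::
    "('f, 'r) lang \<Rightarrow> ('f, 'r, 'a::field) fo_struct \<Rightarrow> ('a \<Rightarrow> 'g::linordered_ab_group_add) \<Rightarrow> bool" where
  "VG_no_exotic_automorphisms L M v \<longleftrightarrow> (\<forall>h :: 'g \<Rightarrow> 'g.
     bij h \<longrightarrow> strict_mono h \<longrightarrow> definable_VG_endo L M v h \<longrightarrow>
     (\<exists>q>0. is_rat_mult q h))"

definition char_exponent :: "'a::field itself \<Rightarrow> nat" where
  "char_exponent _ = (if CHAR('a) = 0 then 1 else CHAR('a))"

text \<open>The \<open>m\<close>-th power of the Frobenius, for an integer \<open>m\<close>; it is a bijection on a perfect field.\<close>

definition frobenius_power :: "int \<Rightarrow> 'a::field \<Rightarrow> 'a" where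
  "frobenius_power m =
     (if 0 \<le> m then (\<lambda>x. x ^ (char_exponent TYPE('a) ^ nat m))
      else inv (\<lambda>x. x ^ (char_exponent TYPE('a) ^ nat (- m))))"

text \<open>\<open>x\<close> to the power \<open>n / p\<^sup>m\<close>.\<close>

definition frac_power :: "'a::field \<Rightarrow> int \<Rightarrow> int \<Rightarrow> 'a" where
  "frac_power x n m = inv (frobenius_power m) (x powi n)"

end

theory Submission
  imports Defs
begin

text \<open>
  By C-minimality a definable set decides all but finitely many shells \<open>{x. v x = \<gamma>}\<close> up to finitely
  many cuts of \<open>\<Gamma>\<close>, and all but finitely many residue classes of the valuation ring. Hence definable
  subgroups of \<open>\<Gamma>\<close> are trivial or everything, and a definable subgroup of the multiplicative group
  either contains all units or consists of units with finitely many residues. This gives (1), and it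
  shows that an endomorphism which is residually trivial on the units has trivial \<open>g\<close>.

  For (2), \<open>g\<close> is zero or strictly monotone and bijective, which settles the case of \<open>\<Gamma>\<close>. In the case of
  \<open>k\<close>, a residually non-trivial \<open>f\<close> induces, up to powers, an automorphism \<open>h\<close> of \<open>k\<^sup>\<times>\<close>. If \<open>h\<close> is definable
  in the field \<open>k\<close>, its graph lies on a plane curve, and independence of characters yields
  \<open>x\<^sup>i (h x)\<^sup>j = x\<^sup>i' (h x)\<^sup>j'\<close>; then a product of powers of \<open>x\<close> and \<open>f x\<close> is residually trivial on units.

  For (3), it suffices that an endomorphism \<open>F\<close> into the units is trivial. Its residue is trivial, so it
  kills the torsion prime to the residue characteristic and hence all units. If \<open>F\<close> were not trivial,
  its image would be infinite, hence contain a ball around 1, and the preimages of small balls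
  around 1 would be definable subgroups strictly above the units, that is, everything.
\<close>

section \<open>Definable predicates\<close>

text \<open>Two facts are played against each other throughout. The groups of units and of non-zero
  elements are divisible, so a homomorphism from them with finite image is trivial. A definable
  subgroup that meets infinitely many residue classes of units contains all units. So the images and
  kernels that occur are negligible or as large as possible. Since \<Gamma> and k are imaginary
  sorts, statements about them are proved with predicates on the home sort that respect
  \<open>v\<close> or \<open>res\<close>.

  The obstacle in (2) is that an endomorphism need not send 1-units to 1-units, so the residue of
  its value need not be a function of the residue of its argument. The pure field structure is used
  only to produce one algebraic relation, and quantifier elimination is there to supply it.

  In (3), if q = a / b in lowest terms, then f(x)^b / x^a takes only unit values and is therefore
  trivial. Evaluating f(x)^b = x^a at roots of unity of order prime to p shows that b is a power of
  p.\<close>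

fun rename_tm :: "(nat \<Rightarrow> nat) \<Rightarrow> 'f tm \<Rightarrow> 'f tm" where
  "rename_tm \<rho> (Var i) = Var (\<rho> i)"
| "rename_tm \<rho> (App s ts) = App s (map (rename_tm \<rho>) ts)"

fun rename_fm :: "(nat \<Rightarrow> nat) \<Rightarrow> ('f, 'r) fm \<Rightarrow> ('f, 'r) fm" where
  "rename_fm \<rho> (Eq u w) = Eq (rename_tm \<rho> u) (rename_tm \<rho> w)"
| "rename_fm \<rho> (Rel s ts) = Rel s (map (rename_tm \<rho>) ts)"
| "rename_fm \<rho> (Neg \<phi>) = Neg (rename_fm \<rho> \<phi>)"
| "rename_fm \<rho> (Conj \<phi> \<psi>) = Conj (rename_fm \<rho> \<phi>) (rename_fm \<rho> \<psi>)"
| "rename_fm \<rho> (Exists i \<phi>) = Exists (\<rho> i) (rename_fm \<rho> \<phi>)"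

lemma lang_tm_rename: "lang_tm L (rename_tm \<rho> u) \<longleftrightarrow> lang_tm L u"
  by (induction u) auto

lemma tm_val_rename: "tm_val N e (rename_tm \<rho> u) = tm_val N (e \<circ> \<rho>) u"
proof (induction u)
  case (App s ts)
  have "map (tm_val N e \<circ> rename_tm \<rho>) ts = map (tm_val N (e \<circ> \<rho>)) ts"
    by (intro map_cong refl) (simp only: o_apply[of "tm_val N e"] App)
  then show ?case by (simp only: tm_val.simps rename_tm.simps map_map)
qed simp

lemma map_tm_val_rename: "map (tm_val N e) (map (rename_tm \<rho>) ts) = map (tm_val N (e \<circ> \<rho>)) ts"
  by (simp add: tm_val_rename)

lemma lang_fm_rename: "lang_fm L (rename_fm \<rho> \<phi>) \<longleftrightarrow> lang_fm L \<phi>"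
  by (induction \<phi>) (auto simp: lang_tm_rename)

lemma sat_rename:
  assumes "inj \<rho>"
  shows "sat N e (rename_fm \<rho> \<phi>) \<longleftrightarrow> sat N (e \<circ> \<rho>) \<phi>"
proof (induction \<phi> arbitrary: e)
  case (Exists i \<phi>)
  have "e(\<rho> i := a) \<circ> \<rho> = (e \<circ> \<rho>)(i := a)" for a
    using assms by (auto simp: fun_eq_iff inj_eq)
  then show ?case using Exists by (simp only: rename_fm.simps sat.simps)
qed (simp_all add: tm_val_rename map_tm_val_rename del: map_map)

section \<open>Closure properties of definable predicates and definable functions\<close>

locale full_structure =
  fixes L :: "('f, 'r) lang" and M :: "('f, 'r, 'a) fo_struct"
  assumes univ_M [simp]: "univ M = UNIV"
begin

text \<open>Even variables carry the arguments, odd variables the parameters.\<close>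

definition merge :: "(nat \<Rightarrow> 'a) \<Rightarrow> (nat \<Rightarrow> 'a) \<Rightarrow> nat \<Rightarrow> 'a" where
  "merge e c i = (if even i then e (i div 2) else c i)"

text \<open>Predicates on whole assignments replace sets of tuples: substitution becomes composition
  with a map of indices, and no arity has to be tracked.\<close>

definition pdef :: "((nat \<Rightarrow> 'a) \<Rightarrow> bool) \<Rightarrow> bool" where
  "pdef Q \<longleftrightarrow> (\<exists>\<phi> c. lang_fm L \<phi> \<and> (\<forall>e. Q e \<longleftrightarrow> sat M (merge e c) \<phi>))"

lemma pdef_not: "pdef Q \<Longrightarrow> pdef (\<lambda>e. \<not> Q e)"
  unfolding pdef_def by (metis lang_fm.simps(3) sat.simps(3))

lemma pdef_conj:
  assumes "pdef Q" "pdef R"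
  shows "pdef (\<lambda>e. Q e \<and> R e)"
proof -
  obtain \<phi> c where \<phi>: "lang_fm L \<phi>" "\<And>e. Q e \<longleftrightarrow> sat M (merge e c) \<phi>"
    using assms(1) unfolding pdef_def by blast
  obtain \<psi> d where \<psi>: "lang_fm L \<psi>" "\<And>e. R e \<longleftrightarrow> sat M (merge e d) \<psi>"
    using assms(2) unfolding pdef_def by blast
  \<comment> \<open>The two formulas come with different parameters. Their odd variables are moved
    to the classes 1 and 3 modulo 4, so that one assignment \<open>b\<close> can hold both.\<close>
  define \<rho> where "\<rho> i = (if even i then i else 4 * (i div 2) + 1)" for i :: nat
  define \<sigma> where "\<sigma> i = (if even i then i else 4 * (i div 2) + 3)" for i :: nat
  define b where "b i = (if i mod 4 = 1 then c (2 * (i div 4) + 1) else d (2 * (i div 4) + 1))"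
    for i :: nat
  have 4: "(4 * j + 3) mod 4 = 3" "(4 * j + 3) div 4 = j" "(4 * j + 1) mod 4 = 1"
    "(4 * j + 1) div 4 = j" for j :: nat
    by presburger+
  have inj: "inj \<rho>" "inj \<sigma>"
    unfolding \<rho>_def \<sigma>_def by (rule injI; auto split: if_splits elim!: oddE evenE; presburger)+
  have "(merge e b \<circ> \<rho>) i = merge e c i" "(merge e b \<circ> \<sigma>) i = merge e d i" for e i
    using 4 by (auto simp: merge_def b_def \<rho>_def \<sigma>_def elim!: oddE)
  then have \<rho>: "merge e b \<circ> \<rho> = merge e c" and \<sigma>: "merge e b \<circ> \<sigma> = merge e d" for e
    by blast+
  let ?\<chi> = "Conj (rename_fm \<rho> \<phi>) (rename_fm \<sigma> \<psi>)"
  have "lang_fm L ?\<chi>" using \<phi>(1) \<psi>(1) by (simp add: lang_fm_rename)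
  moreover have "Q e \<and> R e \<longleftrightarrow> sat M (merge e b) ?\<chi>" for e
    by (simp add: sat_rename inj \<rho> \<sigma> \<phi> \<psi>)
  ultimately show ?thesis unfolding pdef_def by blast
qed

lemma pdef_disj: "pdef Q \<Longrightarrow> pdef R \<Longrightarrow> pdef (\<lambda>e. Q e \<or> R e)"
  using pdef_not[OF pdef_conj, OF pdef_not pdef_not] by (simp only: de_Morgan_conj not_not)

lemma pdef_ex:
  assumes "pdef (\<lambda>e. Q (e 0) (\<lambda>i. e (Suc i)))"
  shows "pdef (\<lambda>e. \<exists>a. Q a e)"
proof -
  obtain \<phi> c where \<phi>: "lang_fm L \<phi>" "\<And>e. Q (e 0) (\<lambda>i. e (Suc i)) \<longleftrightarrow> sat M (merge e c) \<phi>"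
    using assms unfolding pdef_def by blast
  \<comment> \<open>Coordinate 0 becomes the variable 1, to be bound. The other coordinates move
    down by one place, that is by 2, and the parameters move up by 2 to vacate 1.\<close>
  define \<rho> where "\<rho> i = (if i = 0 then 1 else if even i then i - 2 else i + 2)" for i :: nat
  have inj: "inj \<rho>"
  proof (rule inj_on_inverseI)
    fix i
    show "(if \<rho> i = 1 then 0 else if even (\<rho> i) then \<rho> i + 2 else \<rho> i - 2) = i"
      unfolding \<rho>_def by (cases "i = 0"; cases "even i") (simp_all, presburger+)
  qed
  have "(merge e (\<lambda>i. c (i - 2)))(1 := a) \<circ> \<rho> = merge (case_nat a e) c" for a e
  proof
    fix i
    show "((merge e (\<lambda>i. c (i - 2)))(1 := a) \<circ> \<rho>) i = merge (case_nat a e) c i"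
    proof (cases "i = 0 \<or> odd i")
      case False
      then have "i = 2 * Suc (i div 2 - 1)" by presburger
      then obtain j where j: "i = 2 * Suc j" by blast
      then show ?thesis by (simp add: \<rho>_def merge_def)
    qed (auto simp: \<rho>_def merge_def)
  qed
  then have "(\<exists>a. Q a e) \<longleftrightarrow> sat M (merge e (\<lambda>i. c (i - 2))) (Exists 1 (rename_fm \<rho> \<phi>))" for e
    using \<phi>(2)[of "case_nat _ e"] by (simp add: sat_rename[OF inj])
  moreover have "lang_fm L (Exists 1 (rename_fm \<rho> \<phi>))"
    using \<phi>(1) by (simp add: lang_fm_rename)
  ultimately show ?thesis unfolding pdef_def by blast
qed

text \<open>The induction needs arbitrary \<open>V\<close> and \<open>\<sigma>\<close> because a
  formula may bind any variable: under a quantifier over \<open>j\<close>, the variable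
  \<open>j\<close> joins \<open>V\<close> and is read from position 0, while the others shift by
  one.\<close>

lemma pdef_sat:
  "lang_fm L \<phi> \<Longrightarrow> pdef (\<lambda>e. sat M (\<lambda>i. if i \<in> V then e (\<sigma> i) else c i) \<phi>)"
proof (induction \<phi> arbitrary: V \<sigma>)
  case (Eq u w)
  let ?\<rho> = "\<lambda>i. if i \<in> V then 2 * \<sigma> i else 2 * i + 1"
  have *: "(\<lambda>i. if i \<in> V then e (\<sigma> i) else c i) = merge e (\<lambda>i. c (i div 2)) \<circ> ?\<rho>" for e
    by (auto simp: merge_def fun_eq_iff)
  show ?case unfolding pdef_def using Eq
    by (intro exI[of _ "Eq (rename_tm ?\<rho> u) (rename_tm ?\<rho> w)"] exI[of _ "\<lambda>i. c (i div 2)"])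
      (simp only: lang_tm_rename tm_val_rename * lang_fm.simps sat.simps simp_thms)
next
  case (Rel s ts)
  let ?\<rho> = "\<lambda>i. if i \<in> V then 2 * \<sigma> i else 2 * i + 1"
  have *: "(\<lambda>i. if i \<in> V then e (\<sigma> i) else c i) = merge e (\<lambda>i. c (i div 2)) \<circ> ?\<rho>" for e
    by (auto simp: merge_def fun_eq_iff)
  show ?case unfolding pdef_def using Rel
    by (intro exI[of _ "Rel s (map (rename_tm ?\<rho>) ts)"] exI[of _ "\<lambda>i. c (i div 2)"])
      (simp add: lang_tm_rename map_tm_val_rename * del: map_map)
next
  case (Neg \<phi>)
  then show ?case using pdef_not by simp
next
  case (Conj \<phi> \<psi>)
  then show ?case using pdef_conj by simp
next
  case (Exists j \<phi>)
  let ?\<sigma> = "\<lambda>i. if i = j then 0 else Suc (\<sigma> i)"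
  have "(\<lambda>i. if i \<in> insert j V then e (?\<sigma> i) else c i)
      = (\<lambda>i. if i \<in> V then e (Suc (\<sigma> i)) else c i)(j := e 0)" for e
    by auto
  then have "pdef (\<lambda>e. sat M ((\<lambda>i. if i \<in> V then e (Suc (\<sigma> i)) else c i)(j := e 0)) \<phi>)"
    using Exists.IH[of "insert j V" ?\<sigma>] Exists.prems by simp
  from pdef_ex[of "\<lambda>a e. sat M ((\<lambda>i. if i \<in> V then e (\<sigma> i) else c i)(j := a)) \<phi>", OF this]
  show ?case by simp
qed

lemma pdef_subst:
  assumes "pdef Q"
  shows "pdef (\<lambda>e. Q (\<lambda>i. e (\<sigma> i)))"
proof -
  obtain \<phi> c where \<phi>: "lang_fm L \<phi>" "\<And>e. Q e \<longleftrightarrow> sat M (merge e c) \<phi>"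
    using assms unfolding pdef_def by blast
  have "merge (\<lambda>i. e (\<sigma> i)) c = (\<lambda>i. if i \<in> {i. even i} then e (\<sigma> (i div 2)) else c i)" for e
    by (auto simp: merge_def fun_eq_iff)
  then show ?thesis using pdef_sat[OF \<phi>(1), of "{i. even i}" "\<lambda>i. \<sigma> (i div 2)" c] \<phi>(2) by simp
qed

lemma pdef_definable:
  assumes "pdef Q"
  shows "definable L M n {xs. length xs = n \<and> Q (\<lambda>i. if i < n then xs ! i else a)}"
proof -
  obtain \<phi> c where \<phi>: "lang_fm L \<phi>" "\<And>e. Q e \<longleftrightarrow> sat M (merge e c) \<phi>"
    using assms unfolding pdef_def by blast
  \<comment> \<open>The first \<open>n\<close> coordinates return to the variables below
    \<open>n\<close>. Everything else, including the coordinates fixed to \<open>a\<close>, is moved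
    up by \<open>n\<close> and becomes a parameter.\<close>
  define \<rho> where "\<rho> i = (if even i \<and> i div 2 < n then i div 2 else n + i)" for i
  have inj: "inj \<rho>"
  proof (rule injI)
    fix x y assume "\<rho> x = \<rho> y"
    then show "x = y"
      by (cases "even x \<and> x div 2 < n"; cases "even y \<and> y div 2 < n")
        (auto simp: \<rho>_def simp del: even_two_times_div_two elim!: evenE)
  qed
  let ?e = "\<lambda>xs i. if i < n then xs ! i else if even (i - n) then a else c (i - n)"
  have "?e xs \<circ> \<rho> = merge (\<lambda>i. if i < n then xs ! i else a) c" for xs
    by (auto simp: \<rho>_def merge_def)
  then have "Q (\<lambda>i. if i < n then xs ! i else a) \<longleftrightarrow> sat M (?e xs) (rename_fm \<rho> \<phi>)" for xs
    by (simp add: \<phi>(2) sat_rename[OF inj])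
  then show ?thesis unfolding definable_def
    by (intro exI[of _ "rename_fm \<rho> \<phi>"] exI[of _ "\<lambda>i. if even (i - n) then a else c (i - n)"])
      (simp add: lang_fm_rename \<phi>(1))
qed

lemma definable_pdef:
  assumes "definable L M n S"
  shows "pdef (\<lambda>e. map e [0..<n] \<in> S)"
proof -
  obtain \<phi> c where \<phi>: "lang_fm L \<phi>"
    "S = {xs. length xs = n \<and> set xs \<subseteq> univ M \<and> sat M (\<lambda>i. if i < n then xs ! i else c i) \<phi>}"
    using assms unfolding definable_def by blast
  have "map e [0..<n] \<in> S \<longleftrightarrow> sat M (\<lambda>i. if i \<in> {..<n} then e i else c i) \<phi>" for e
  proof -
    have "(\<lambda>i. if i < n then map e [0..<n] ! i else c i) = (\<lambda>i. if i \<in> {..<n} then e i else c i)"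
      by auto
    then show ?thesis by (simp add: \<phi>(2))
  qed
  then show ?thesis using pdef_sat[OF \<phi>(1), of "{..<n}" "\<lambda>i. i" c] by simp
qed

text \<open>The graph with the value in position 0 and the arguments shifted by one. Definable
  functions can thus be substituted into predicates exactly like terms of the language.\<close>

definition tdef :: "((nat \<Rightarrow> 'a) \<Rightarrow> 'a) \<Rightarrow> bool" where
  "tdef t \<longleftrightarrow> pdef (\<lambda>e. e 0 = t (\<lambda>i. e (Suc i)))"

lemma pdef_eq_var: "pdef (\<lambda>e. e i = e j)"
  using pdef_sat[of "Eq (Var i) (Var j)" UNIV id] by simp

lemma tdef_var [intro]: "tdef (\<lambda>e. e i)"
  unfolding tdef_def by (rule pdef_eq_var)

lemma tdef_const [intro]: "tdef (\<lambda>e. a)"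
  unfolding tdef_def using pdef_sat[of "Eq (Var 0) (Var 1)" "{0}" id "\<lambda>_. a"] by simp

lemma pdef_term1:
  assumes "pdef (\<lambda>e. Q (e 0))" "tdef t"
  shows "pdef (\<lambda>e. Q (t e))"
proof -
  have "pdef (\<lambda>e. \<exists>a. a = t e \<and> Q a)"
    by (rule pdef_ex, rule pdef_conj, fact assms(2)[unfolded tdef_def])
      (use pdef_subst[OF assms(1), of "\<lambda>_. 0"] in simp)
  then show ?thesis by simp
qed

lemma tdef_lift: "tdef t \<Longrightarrow> tdef (\<lambda>e. t (\<lambda>i. e (Suc i)))"
  unfolding tdef_def
  using pdef_subst[of "\<lambda>e. e 0 = t (\<lambda>i. e (Suc i))" "case_nat 0 (\<lambda>i. Suc (Suc i))"] by simp

lemma pdef_term2: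
  assumes "pdef (\<lambda>e. Q (e 0) (e 1))" "tdef s" "tdef t"
  shows "pdef (\<lambda>e. Q (s e) (t e))"
proof -
  have 1: "pdef (\<lambda>e. e 0 = t (\<lambda>i. e (Suc (Suc i))))"
    using tdef_lift[OF assms(3)] pdef_subst[of "\<lambda>e. e 0 = t (\<lambda>i. e (Suc i))" "case_nat 0 (\<lambda>i. Suc (Suc i))"]
      assms(3) unfolding tdef_def by simp
  have 2: "pdef (\<lambda>e. e 1 = s (\<lambda>i. e (Suc (Suc i))))"
    using pdef_subst[of "\<lambda>e. e 0 = s (\<lambda>i. e (Suc i))" "\<lambda>i. Suc i"]
      assms(2) unfolding tdef_def by simp
  have 3: "pdef (\<lambda>e. Q (e 1) (e 0))"
    using pdef_subst[OF assms(1), of "\<lambda>i. if i = 0 then 1 else 0"] by simp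
  have "pdef (\<lambda>e. \<exists>a. \<exists>b. b = t e \<and> a = s e \<and> Q a b)"
    using 1 2 3 by (intro pdef_ex pdef_conj) simp_all
  then show ?thesis by simp
qed

lemma pdef_eq: "tdef s \<Longrightarrow> tdef t \<Longrightarrow> pdef (\<lambda>e. s e = t e)"
  by (rule pdef_term2[of "\<lambda>a b. a = b"]) (rule pdef_eq_var)

lemma tdef_fun1:
  assumes "tdef (\<lambda>e. F (e 0))" "tdef t"
  shows "tdef (\<lambda>e. F (t e))"
  unfolding tdef_def
proof (rule pdef_term2[of "\<lambda>a b. a = F b"])
  show "pdef (\<lambda>e. e 0 = F (e 1))" using assms(1) unfolding tdef_def by simp
qed (use assms(2) tdef_lift in auto)

lemma tdef_fun2:
  assumes "tdef (\<lambda>e. F (e 0) (e 1))" "tdef s" "tdef t"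
  shows "tdef (\<lambda>e. F (s e) (t e))"
proof -
  have 1: "pdef (\<lambda>e. e 1 = F (e 0) (e 2))"
    using assms(1) pdef_subst[of "\<lambda>e. e 0 = F (e 1) (e 2)" "\<lambda>i. if i = 0 then 1 else if i = 1 then 0 else 2"]
    unfolding tdef_def by (simp add: numeral_2_eq_2)
  have "pdef (\<lambda>e. \<exists>a. a = s (\<lambda>i. e (Suc i)) \<and> e 0 = F a (t (\<lambda>i. e (Suc i))))"
  proof (rule pdef_ex, rule pdef_conj)
    show "pdef (\<lambda>e. e 0 = s (\<lambda>i. e (Suc (Suc i))))"
      using tdef_lift[OF assms(2)] unfolding tdef_def .
    have "pdef (\<lambda>e. \<exists>b. b = t (\<lambda>i. e (Suc (Suc i))) \<and> e 1 = F (e 0) b)"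
    proof (rule pdef_ex, rule pdef_conj)
      show "pdef (\<lambda>e. e 0 = t (\<lambda>i. e (Suc (Suc (Suc i)))))"
        using tdef_lift[OF tdef_lift[OF assms(3)]] unfolding tdef_def .
      show "pdef (\<lambda>e. e (Suc 1) = F (e (Suc 0)) (e 0))"
        using pdef_subst[OF 1, of "\<lambda>i. if i = 0 then 1 else if i = 1 then 2 else 0"]
        by (simp add: numeral_2_eq_2)
    qed
    then show "pdef (\<lambda>e. e (Suc 0) = F (e 0) (t (\<lambda>i. e (Suc (Suc i)))))" by simp
  qed
  then show ?thesis unfolding tdef_def by simp
qed

lemma tdef_App2:
  assumes "fst L s = Some 2"
  shows "tdef (\<lambda>e. fn M s [e i, e j])"
  unfolding tdef_def
  using pdef_sat[of "Eq (Var 0) (App s [Var (Suc i), Var (Suc j)])" UNIV id] assms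
  by (simp add: numeral_2_eq_2)

lemma pdef_Rel2:
  assumes "snd L s = Some 2"
  shows "pdef (\<lambda>e. rl M s [e i, e j])"
  using pdef_sat[of "Rel s [Var i, Var j]" UNIV id] assms
  by (simp add: numeral_2_eq_2)

end

section \<open>Quantifier elimination for algebraically closed fields\<close>

inductive_set polyfun :: "((nat \<Rightarrow> 'k::field) \<Rightarrow> 'k) set" where
  const: "(\<lambda>e. a) \<in> polyfun"
| var: "(\<lambda>e. e i) \<in> polyfun"
| add: "p \<in> polyfun \<Longrightarrow> q \<in> polyfun \<Longrightarrow> (\<lambda>e. p e + q e) \<in> polyfun"
| mult: "p \<in> polyfun \<Longrightarrow> q \<in> polyfun \<Longrightarrow> (\<lambda>e. p e * q e) \<in> polyfun"

inductive constructible :: "((nat \<Rightarrow> 'k::field) \<Rightarrow> bool) \<Rightarrow> bool" where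
  zero: "p \<in> polyfun \<Longrightarrow> constructible (\<lambda>e. p e = 0)"
| neg: "constructible Q \<Longrightarrow> constructible (\<lambda>e. \<not> Q e)"
| conj: "constructible Q \<Longrightarrow> constructible R \<Longrightarrow> constructible (\<lambda>e. Q e \<and> R e)"

lemma polyfun_diff: "p \<in> polyfun \<Longrightarrow> q \<in> polyfun \<Longrightarrow> (\<lambda>e. p e - q e) \<in> polyfun"
  using polyfun.add[of p "\<lambda>e. (-1) * q e"] polyfun.mult[OF polyfun.const[of "-1"], of q] by simp

lemma polyfun_sum:
  "finite A \<Longrightarrow> (\<And>i. i \<in> A \<Longrightarrow> p i \<in> polyfun) \<Longrightarrow> (\<lambda>e. \<Sum>i\<in>A. p i e) \<in> polyfun"
  by (induction A rule: finite_induct) (auto intro: polyfun.const polyfun.add)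

lemma constructible_cong: "constructible Q \<Longrightarrow> (\<And>e. R e \<longleftrightarrow> Q e) \<Longrightarrow> constructible R"
  by (subgoal_tac "R = Q") auto

lemma constructible_disj:
  assumes "constructible Q" "constructible R"
  shows "constructible (\<lambda>e. Q e \<or> R e)"
  using constructible.neg[OF constructible.conj, OF constructible.neg constructible.neg, OF assms]
  by (simp only: de_Morgan_conj not_not)

lemma constructible_const: "constructible (\<lambda>e. b)"
proof (cases b)
  case True
  then show ?thesis using constructible.zero[OF polyfun.const[of 0]] by simp
next
  case False
  then show ?thesis using constructible.zero[OF polyfun.const[of 1]] by simp
qed

lemma constructible_bex:
  assumes "finite A" "\<And>i. i \<in> A \<Longrightarrow> constructible (Q i)"
  shows "constructible (\<lambda>e. \<exists>i\<in>A. Q i e)"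
  using assms
proof (induction A rule: finite_induct)
  case empty
  then show ?case using constructible_const[of False] by simp
next
  case (insert i A)
  then show ?case using constructible_disj[of "Q i" "\<lambda>e. \<exists>i\<in>A. Q i e"] by simp
qed

lemma constructible_ball:
  assumes "finite A" "\<And>i. i \<in> A \<Longrightarrow> constructible (Q i)"
  shows "constructible (\<lambda>e. \<forall>i\<in>A. Q i e)"
proof -
  have "constructible (\<lambda>e. \<not> (\<exists>i\<in>A. \<not> Q i e))"
    using assms by (intro constructible.neg constructible_bex) auto
  then show ?thesis by simp
qed

text \<open>Each disjunct has several equations but only one inequation, because finitely many
  inequations amount to the non-vanishing of their product.\<close>

definition is_dnf :: "((nat \<Rightarrow> 'k::field) \<Rightarrow> bool) \<Rightarrow> bool" where
  "is_dnf Q \<longleftrightarrow> (\<exists>C. finite C \<and> (\<forall>x\<in>C. set (fst x) \<subseteq> polyfun \<and> snd x \<in> polyfun) \<and>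
    Q = (\<lambda>e. \<exists>x\<in>C. (\<forall>p\<in>set (fst x). p e = 0) \<and> snd x e \<noteq> 0))"

lemma is_dnf_disj:
  assumes "is_dnf Q" "is_dnf R"
  shows "is_dnf (\<lambda>e. Q e \<or> R e)"
proof -
  obtain C where C: "finite C" "\<forall>x\<in>C. set (fst x) \<subseteq> polyfun \<and> snd x \<in> polyfun"
    "Q = (\<lambda>e. \<exists>x\<in>C. (\<forall>p\<in>set (fst x). p e = 0) \<and> snd x e \<noteq> 0)"
    using assms(1) unfolding is_dnf_def by (elim exE conjE) (rule that)
  obtain D where D: "finite D" "\<forall>x\<in>D. set (fst x) \<subseteq> polyfun \<and> snd x \<in> polyfun"
    "R = (\<lambda>e. \<exists>x\<in>D. (\<forall>p\<in>set (fst x). p e = 0) \<and> snd x e \<noteq> 0)"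
    using assms(2) unfolding is_dnf_def by (elim exE conjE) (rule that)
  have "(\<lambda>e. Q e \<or> R e) = (\<lambda>e. \<exists>x\<in>C \<union> D. (\<forall>p\<in>set (fst x). p e = 0) \<and> snd x e \<noteq> 0)"
    unfolding C(3) D(3) bex_Un ..
  then show ?thesis unfolding is_dnf_def using C(1,2) D(1,2) by (intro exI[of _ "C \<union> D"]) (simp add: ball_Un)
qed

lemma is_dnf_conj:
  assumes "is_dnf Q" "is_dnf R"
  shows "is_dnf (\<lambda>e. Q e \<and> R e)"
proof -
  obtain C where C: "finite C" "\<forall>x\<in>C. set (fst x) \<subseteq> polyfun \<and> snd x \<in> polyfun"
    "Q = (\<lambda>e. \<exists>x\<in>C. (\<forall>p\<in>set (fst x). p e = 0) \<and> snd x e \<noteq> 0)"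
    using assms(1) unfolding is_dnf_def by (elim exE conjE) (rule that)
  obtain D where D: "finite D" "\<forall>x\<in>D. set (fst x) \<subseteq> polyfun \<and> snd x \<in> polyfun"
    "R = (\<lambda>e. \<exists>x\<in>D. (\<forall>p\<in>set (fst x). p e = 0) \<and> snd x e \<noteq> 0)"
    using assms(2) unfolding is_dnf_def by (elim exE conjE) (rule that)
  let ?m = "\<lambda>(x, y). (fst x @ fst y, \<lambda>e. snd x e * snd y e)"
  have "(\<lambda>e. Q e \<and> R e)
      = (\<lambda>e. \<exists>x\<in>?m ` (C \<times> D). (\<forall>p\<in>set (fst x). p e = 0) \<and> snd x e \<noteq> 0)"
    (is "_ = (\<lambda>e. \<exists>x\<in>_. ?F x e)")
  proof (rule ext, rule iffI)
    fix e assume "Q e \<and> R e"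
    then obtain x y where "x \<in> C" "y \<in> D" "?F x e" "?F y e" unfolding C(3) D(3) by blast
    then show "\<exists>x\<in>?m ` (C \<times> D). ?F x e"
      by (intro bexI[of _ "?m (x, y)"] imageI) (simp_all add: ball_Un)
  next
    fix e assume "\<exists>x\<in>?m ` (C \<times> D). ?F x e"
    then obtain z where "z \<in> C \<times> D" "?F (?m z) e" by blast
    then have "fst z \<in> C" "snd z \<in> D" "?F (fst z) e" "?F (snd z) e"
      by (auto simp: split_beta ball_Un)
    then show "Q e \<and> R e" unfolding C(3) D(3) by blast
  qed
  moreover have "\<forall>x\<in>?m ` (C \<times> D). set (fst x) \<subseteq> polyfun \<and> snd x \<in> polyfun"
    using C(2) D(2) by (auto intro!: polyfun.mult)
  ultimately show ?thesis unfolding is_dnf_def using C(1) D(1)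
    by (intro exI[of _ "?m ` (C \<times> D)"] conjI finite_imageI finite_cartesian_product)
qed

lemma constructible_dnf:
  assumes "constructible Q"
  shows "is_dnf Q" and "is_dnf (\<lambda>e. \<not> Q e)"
proof -
  have "is_dnf Q \<and> is_dnf (\<lambda>e. \<not> Q e)"
    using assms
  proof induction
    case (zero p)
    have "is_dnf (\<lambda>e. p e = 0)"
      unfolding is_dnf_def using zero
      by (intro exI[of _ "{([p], \<lambda>_. 1)}"]) (simp add: polyfun.const)
    moreover have "is_dnf (\<lambda>e. p e \<noteq> 0)"
      unfolding is_dnf_def using zero
      by (intro exI[of _ "{([], p)}"]) simp
    ultimately show ?case ..
  next
    case (neg Q)
    then show ?case unfolding not_not by (elim conjE) (intro conjI)
  next
    case (conj Q R)
    then show ?case unfolding de_Morgan_conj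
      by (elim conjE) (intro conjI is_dnf_conj is_dnf_disj)
  qed
  then show "is_dnf Q" "is_dnf (\<lambda>e. \<not> Q e)" by (rule conjunct1, rule conjunct2)
qed

text \<open>Polynomials in one variable whose coefficients are polynomial in the parameters
  \<open>e\<close>. The number \<open>n\<close> is a strict bound on the degree, so
  \<open>n = 0\<close> forces the zero polynomial.\<close>

definition poly_family :: "nat \<Rightarrow> ((nat \<Rightarrow> 'k::field) \<Rightarrow> 'k poly) \<Rightarrow> bool" where
  "poly_family n P \<longleftrightarrow> (\<forall>e j. n \<le> j \<longrightarrow> coeff (P e) j = 0) \<and> (\<forall>j. (\<lambda>e. coeff (P e) j) \<in> polyfun)"

lemma poly_family_add:
  "poly_family n P \<Longrightarrow> poly_family m Q \<Longrightarrow> poly_family (max n m) (\<lambda>e. P e + Q e)"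
  unfolding poly_family_def by (auto intro: polyfun.add)

lemma poly_family_diff:
  "poly_family n P \<Longrightarrow> poly_family m Q \<Longrightarrow> poly_family (max n m) (\<lambda>e. P e - Q e)"
  unfolding poly_family_def by (auto intro: polyfun_diff)

lemma poly_family_smult: "poly_family n P \<Longrightarrow> c \<in> polyfun \<Longrightarrow> poly_family n (\<lambda>e. smult (c e) (P e))"
  unfolding poly_family_def by (auto intro: polyfun.mult)

lemma poly_family_monom:
  assumes "c \<in> polyfun"
  shows "poly_family (Suc d) (\<lambda>e. monom (c e) d)"
proof -
  have "(\<lambda>e. coeff (monom (c e) d) j) \<in> polyfun" for j
    using assms by (cases "d = j") (simp_all add: polyfun.const)
  then show ?thesis unfolding poly_family_def by simp
qed

lemma poly_family_mult:
  assumes "poly_family n P" "poly_family m Q"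
  shows "poly_family (n + m) (\<lambda>e. P e * Q e)"
  unfolding poly_family_def
proof (intro conjI allI impI)
  fix e j assume "n + m \<le> j"
  then have "coeff (P e) i * coeff (Q e) (j - i) = 0" for i
    using assms unfolding poly_family_def by (cases "n \<le> i") auto
  then show "coeff (P e * Q e) j = 0" unfolding coeff_mult by (intro sum.neutral) blast
next
  fix j
  show "(\<lambda>e. coeff (P e * Q e) j) \<in> polyfun"
    using assms unfolding coeff_mult poly_family_def
    by (intro polyfun_sum polyfun.mult) auto
qed

lemma poly_family_power:
  assumes "poly_family n P"
  shows "\<exists>m. poly_family m (\<lambda>e. P e ^ k)"
proof (induction k)
  case 0
  have "poly_family 1 (\<lambda>e :: nat \<Rightarrow> 'a. monom 1 0)"
    using poly_family_monom[OF polyfun.const, of 0 1] by simp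
  then show ?case by (auto simp: monom_0 one_pCons)
next
  case (Suc k)
  then show ?case using poly_family_mult[OF assms] by auto
qed

lemma polyfun_as_poly_family:
  assumes "p \<in> polyfun"
  shows "\<exists>n P. poly_family n P \<and> (\<forall>e a. p (e(i := a)) = poly (P e) a)"
  using assms
proof induction
  case (const a)
  then show ?case
    using poly_family_monom[OF polyfun.const, of 0 a]
    by (intro exI[of _ 1] exI[of _ "\<lambda>_. monom a 0"]) (simp add: monom_0)
next
  case (var j)
  show ?case
  proof (cases "j = i")
    case True
    then show ?thesis
      using poly_family_monom[OF polyfun.const, of 1 1]
      by (intro exI[of _ 2] exI[of _ "\<lambda>_. monom 1 1"]) (simp add: poly_monom numeral_2_eq_2)
  next
    case False
    then show ?thesis
      using poly_family_monom[OF polyfun.var, of 0 j]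
      by (intro exI[of _ 1] exI[of _ "\<lambda>e. monom (e j) 0"]) (simp add: monom_0)
  qed
next
  case (add p q)
  then obtain n P m Q where "poly_family n P" "\<forall>e a. p (e(i := a)) = poly (P e) a"
    "poly_family m Q" "\<forall>e a. q (e(i := a)) = poly (Q e) a" by blast
  then show ?case
    by (intro exI[of _ "max n m"] exI[of _ "\<lambda>e. P e + Q e"]) (simp add: poly_family_add del: fun_upd_apply)
next
  case (mult p q)
  then obtain n P m Q where "poly_family n P" "\<forall>e a. p (e(i := a)) = poly (P e) a"
    "poly_family m Q" "\<forall>e a. q (e(i := a)) = poly (Q e) a" by blast
  then show ?case
    by (intro exI[of _ "n + m"] exI[of _ "\<lambda>e. P e * Q e"]) (simp add: poly_family_mult del: fun_upd_apply)
qed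

text \<open>The one-variable Nullstellensatz: split off a linear factor of \<open>p\<close> at a
  root and pay for it with one factor \<open>q\<close>. It turns the existence of a root of
  \<open>p\<close> outside the roots of \<open>q\<close> into a non-divisibility.\<close>

lemma dvd_power_if_roots:
  fixes p q :: "'k::field poly"
  assumes ac: "\<And>p :: 'k poly. degree p > 0 \<Longrightarrow> \<exists>x. poly p x = 0"
    and "p \<noteq> 0" "degree p \<le> n" "\<And>a. poly p a = 0 \<Longrightarrow> poly q a = 0"
  shows "p dvd q ^ n"
  using assms(2-)
proof (induction n arbitrary: p)
  case 0
  then show ?case by (simp add: is_unit_iff_degree)
next
  case (Suc n)
  show ?case
  proof (cases "degree p = 0")
    case True
    then show ?thesis using Suc.prems(1) is_unit_iff_degree dvd_trans one_dvd by blast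
  next
    case False
    then obtain a where a: "poly p a = 0" using ac by blast
    then obtain p' where p': "p = [:- a, 1:] * p'" using poly_eq_0_iff_dvd by (metis dvdE)
    have q: "[:- a, 1:] dvd q" using Suc.prems(3)[OF a] poly_eq_0_iff_dvd by blast
    have "p' \<noteq> 0" using p' Suc.prems(1) by auto
    moreover from this have "degree p' \<le> n"
      using p' Suc.prems(2) by (simp add: degree_mult_eq del: mult_pCons_left)
    moreover have "poly q x = 0" if "poly p' x = 0" for x
      using that Suc.prems(3)[of x] p' by simp
    ultimately have "p' dvd q ^ n" by (rule Suc.IH)
    then show ?thesis using q unfolding p' by (simp add: mult_dvd_mono del: mult_pCons_left)
  qed
qed

lemma poly_family_degree:
  assumes "poly_family (Suc n) P" "coeff (P e) n \<noteq> 0"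
  shows "degree (P e) = n"
proof (rule antisym)
  show "degree (P e) \<le> n" using assms(1) unfolding poly_family_def
    by (intro degree_le) auto
  show "n \<le> degree (P e)" using assms(2) by (rule le_degree)
qed

lemma poly_family_eq_0:
  assumes "poly_family n P"
  shows "constructible (\<lambda>e. P e = 0)"
proof -
  have "P e = 0 \<longleftrightarrow> (\<forall>j\<in>{..<n}. coeff (P e) j = 0)" for e
    using assms unfolding poly_family_def by (auto simp: poly_eq_iff) (metis lessThan_iff not_le)
  then show ?thesis using assms unfolding poly_family_def
    by (auto intro!: constructible_ball constructible.zero)
qed

text \<open>Pseudo-division: cross-multiplying by the leading coefficients cancels the top term
  without dividing, so the coefficients stay polynomial in \<open>e\<close>.\<close>

lemma poly_family_pseudo_step:
  assumes P: "poly_family (Suc n) P" and R: "poly_family (Suc m) R" and "n \<le> m"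
  shows "poly_family m (\<lambda>e. smult (coeff (P e) n) (R e) - monom (coeff (R e) m) (m - n) * P e)"
    (is "poly_family m ?S")
proof -
  have "(\<lambda>e. coeff (P e) n) \<in> polyfun" "(\<lambda>e. coeff (R e) m) \<in> polyfun"
    using P R unfolding poly_family_def by auto
  then have S: "poly_family (max (Suc m) (Suc (m - n) + Suc n)) ?S"
    by (intro poly_family_diff poly_family_smult R poly_family_mult poly_family_monom P)
  have "coeff (?S e) j = 0" if "m \<le> j" for e j
  proof (cases "m = j")
    case True
    then show ?thesis using \<open>n \<le> m\<close> by (simp add: coeff_monom_mult)
  next
    case False
    then have "coeff (R e) j = 0" "coeff (P e) (j - (m - n)) = 0"
      using that \<open>n \<le> m\<close> P R unfolding poly_family_def by auto
    then show ?thesis by (simp add: coeff_monom_mult)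
  qed
  then show ?thesis using S unfolding poly_family_def by blast
qed

text \<open>Where the leading coefficient of \<open>P e\<close> is non-zero, a pseudo-division step
  does not change divisibility by \<open>P e\<close>. Once the bound on \<open>R\<close> drops to
  the degree of \<open>P e\<close>, divisibility means vanishing.\<close>

lemma constructible_dvd:
  assumes P: "poly_family (Suc n) P" and R: "poly_family k R"
  shows "constructible (\<lambda>e. coeff (P e) n \<noteq> 0 \<and> P e dvd R e)"
  using R
proof (induction k arbitrary: R)
  case 0
  then have "R e = 0" for e unfolding poly_family_def by (simp add: poly_eq_iff)
  then show ?case using P unfolding poly_family_def
    by (auto intro!: constructible.neg constructible.zero)
next
  case (Suc m)
  have c: "constructible (\<lambda>e. coeff (P e) n \<noteq> 0)"
    using P unfolding poly_family_def by (auto intro!: constructible.neg constructible.zero)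
  show ?case
  proof (cases "n \<le> m")
    case True
    let ?S = "\<lambda>e. smult (coeff (P e) n) (R e) - monom (coeff (R e) m) (m - n) * P e"
    have "P e dvd R e \<longleftrightarrow> P e dvd ?S e" if "coeff (P e) n \<noteq> 0" for e
      using that by (simp add: dvd_diff_left_iff dvd_smult_iff)
    then show ?thesis
      by (intro constructible_cong[OF Suc.IH[OF poly_family_pseudo_step[OF P Suc.prems True]]]) blast
  next
    case False
    have "P e dvd R e \<longleftrightarrow> R e = 0" if "coeff (P e) n \<noteq> 0" for e
    proof -
      have "degree (R e) \<le> m" using Suc.prems unfolding poly_family_def by (intro degree_le) auto
      then show ?thesis using False poly_family_degree[OF P that] dvd_imp_degree_le[of "P e" "R e"] by auto
    qed
    then show ?thesis
      by (intro constructible_cong[OF constructible.conj[OF c poly_family_eq_0[OF Suc.prems]]]) blast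
  qed
qed

section \<open>Elimination of one quantifier over an algebraically closed field\<close>

context
  assumes ac: "\<And>p :: 'k::field poly. degree p > 0 \<Longrightarrow> \<exists>x. poly p x = 0"
begin

lemma infinite_if_roots: "infinite (UNIV :: 'k set)"
proof
  assume fin: "finite (UNIV :: 'k set)"
  \<comment> \<open>This polynomial vanishes everywhere, so adding 1 gives a polynomial of positive
    degree without roots.\<close>
  let ?p = "(\<Prod>a\<in>(UNIV :: 'k set). [:- a, 1:])"
  have "degree ?p = card (UNIV :: 'k set)" by (subst degree_prod_eq_sum_degree) simp_all
  then have "degree (?p + 1) > 0"
    using fin by (simp add: degree_add_eq_left finite_UNIV_card_ge_0)
  then obtain x where "poly (?p + 1) x = 0" using ac by blast
  moreover have "poly ?p x = 0" using fin by (simp add: poly_prod prod_zero_iff)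
  ultimately show False by simp
qed

text \<open>Euclid's algorithm with case distinctions on leading coefficients. A vanishing one is
  dropped (\<open>drop\<close>); a non-vanishing one reduces another equation by pseudo-division
  (\<open>two\<close>). With one equation left, \<open>dvd_power_if_roots\<close> decides
  solvability; with none, \<open>q\<close> only has to be non-zero. The measure counts
  \<open>Suc n\<close> per equation, so discarding a zero polynomial (\<open>zero\<close>) also
  decreases it.\<close>

lemma constructible_ex_system:
  fixes q :: "(nat \<Rightarrow> 'k) \<Rightarrow> 'k poly"
  assumes "\<And>n P. (n, P) \<in> set PS \<Longrightarrow> poly_family n P" and q: "poly_family m q"
  shows "constructible (\<lambda>e. \<exists>a. (\<forall>(n, P)\<in>set PS. poly (P e) a = 0) \<and> poly (q e) a \<noteq> 0)"
  using assms(1)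
proof (induction "sum_list (map (\<lambda>(n, P). Suc n) PS)" arbitrary: PS rule: less_induct)
  case less
  let ?Q = "\<lambda>PS e. \<exists>a. (\<forall>(n, P)\<in>set PS. poly (P e) a = 0) \<and> poly (q e) a \<noteq> 0"
  have drop: ?case if PS: "set PS = insert (Suc n, P) (set RS)"
      "sum_list (map (\<lambda>(n, P). Suc n) PS) = Suc (Suc n) + sum_list (map (\<lambda>(n, P). Suc n) RS)"
      and rest: "constructible (\<lambda>e. coeff (P e) n \<noteq> 0 \<and> ?Q PS e)"
    for n P RS
  proof -
    let ?P = "\<lambda>e. P e - monom (coeff (P e) n) n"
    have P: "poly_family (Suc n) P" using less.prems PS(1) by auto
    have "(\<lambda>e. coeff (P e) n) \<in> polyfun" using P unfolding poly_family_def by simp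
    then have "poly_family (max (Suc n) (Suc n)) ?P"
      by (intro poly_family_diff poly_family_monom P)
    moreover have "coeff (?P e) j = 0" if "n \<le> j" for e j
      using P that unfolding poly_family_def by (cases "n = j") (simp_all add: not_less_eq_eq[symmetric])
    ultimately have "poly_family n ?P" unfolding poly_family_def by blast
    then have "constructible (?Q ((n, ?P) # RS))"
      using less.prems PS by (intro less.hyps) auto
    moreover have "constructible (\<lambda>e. coeff (P e) n = 0)"
      using P unfolding poly_family_def by (auto intro!: constructible.zero)
    ultimately have "constructible (\<lambda>e. coeff (P e) n = 0 \<and> ?Q ((n, ?P) # RS) e \<or>
        coeff (P e) n \<noteq> 0 \<and> ?Q PS e)"
      by (intro constructible_disj[OF constructible.conj rest])
    moreover have "?Q PS e \<longleftrightarrow> ?Q ((n, ?P) # RS) e" if "coeff (P e) n = 0" for e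
      using that PS(1) by simp
    ultimately show ?thesis by (elim constructible_cong) blast
  qed
  have zero: ?case if PS: "set PS = insert (0, P) (set RS)"
      "sum_list (map (\<lambda>(n, P). Suc n) PS) = Suc 0 + sum_list (map (\<lambda>(n, P). Suc n) RS)" for P RS
  proof -
    have "P e = 0" for e
      using less.prems[of 0 P] PS(1) unfolding poly_family_def by (auto simp: poly_eq_iff)
    moreover have "constructible (?Q RS)"
      using less.prems PS by (intro less.hyps) auto
    ultimately show ?thesis using PS(1) by simp
  qed
  have two: ?case if PS: "set PS = insert (Suc n, P) (insert (Suc k, R) (set RS))"
      "sum_list (map (\<lambda>(n, P). Suc n) PS) = Suc (Suc n) + Suc (Suc k) + sum_list (map (\<lambda>(n, P). Suc n) RS)"
      and "n \<le> k" for n P k R RS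
  proof (rule drop[of n P "(Suc k, R) # RS"])
    let ?S = "\<lambda>e. smult (coeff (P e) n) (R e) - monom (coeff (R e) k) (k - n) * P e"
    have P: "poly_family (Suc n) P" and R: "poly_family (Suc k) R"
      using less.prems PS(1) by auto
    have sys: "constructible (?Q ((Suc n, P) # (k, ?S) # RS))"
      using less.prems PS poly_family_pseudo_step[OF P R \<open>n \<le> k\<close>]
      by (intro less.hyps) auto
    have eq: "?Q PS e \<longleftrightarrow> ?Q ((Suc n, P) # (k, ?S) # RS) e" if "coeff (P e) n \<noteq> 0" for e
      using that PS(1) by auto
    have "constructible (\<lambda>e. coeff (P e) n \<noteq> 0)"
      using P unfolding poly_family_def by (auto intro!: constructible.neg constructible.zero)
    from constructible.conj[OF this sys]
    show "constructible (\<lambda>e. coeff (P e) n \<noteq> 0 \<and> ?Q PS e)"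
      by (rule constructible_cong) (use eq in blast)
  qed (use PS in auto)
  consider "PS = []" | n P where "PS = [(n, P)]" | n P k R RS where "PS = (n, P) # (k, R) # RS"
    by (metis list.exhaust prod.exhaust)
  then show ?case
  proof cases
    case 1
    have "(\<exists>a. poly (q e) a \<noteq> 0) \<longleftrightarrow> q e \<noteq> 0" for e
      using infinite_if_roots poly_roots_finite[of "q e"]
      by (metis (mono_tags, lifting) UNIV_eq_I mem_Collect_eq poly_0)
    then show ?thesis using constructible.neg[OF poly_family_eq_0[OF q]] 1 by simp
  next
    case 2
    show ?thesis
    proof (cases n)
      case 0
      then show ?thesis using zero[of P "[]"] 2 by simp
    next
      case (Suc l)
      then have P: "poly_family (Suc l) P" using less.prems 2 by auto
      obtain k where k: "poly_family k (\<lambda>e. q e ^ Suc l)" using poly_family_power[OF q] by blast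
      have c: "constructible (\<lambda>e. coeff (P e) l \<noteq> 0)"
        using P unfolding poly_family_def by (auto intro!: constructible.neg constructible.zero)
      have "?Q PS e \<longleftrightarrow> \<not> P e dvd q e ^ Suc l" if lead: "coeff (P e) l \<noteq> 0" for e
      proof
        assume "\<not> P e dvd q e ^ Suc l"
        moreover have "P e \<noteq> 0" using lead by auto
        ultimately obtain a where "poly (P e) a = 0" "poly (q e) a \<noteq> 0"
          using dvd_power_if_roots[OF ac, of "P e" "Suc l" "q e"] poly_family_degree[where e = e, OF P lead] by auto
        then show "?Q PS e" using 2 by auto
      next
        assume "?Q PS e"
        then obtain a where a: "poly (P e) a = 0" "poly (q e) a \<noteq> 0" using 2 by auto
        show "\<not> P e dvd q e ^ Suc l"
        proof
          assume "P e dvd q e ^ Suc l"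
          then have "poly (P e) a dvd poly (q e) a ^ Suc l" unfolding poly_power[symmetric]
            by (elim dvdE) (simp del: power_Suc poly_power)
          then show False using a by simp
        qed
      qed
      moreover have "constructible (\<lambda>e. coeff (P e) l \<noteq> 0 \<and> \<not> (coeff (P e) l \<noteq> 0 \<and> P e dvd q e ^ Suc l))"
        by (rule constructible.conj[OF c constructible.neg[OF constructible_dvd[OF P k]]])
      ultimately have "constructible (\<lambda>e. coeff (P e) l \<noteq> 0 \<and> ?Q PS e)"
        by (elim constructible_cong) blast
      then show ?thesis using drop[of l P "[]"] 2 Suc by simp
    qed
  next
    case 3
    consider "n = 0" | "k = 0" | n' k' where "n = Suc n'" "k = Suc k'"
      by (meson not0_implies_Suc)
    then show ?thesis
    proof cases
      case 1
      then show ?thesis using 3 by (intro zero[of P "(k, R) # RS"]) auto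
    next
      case 2
      then show ?thesis using 3 by (intro zero[of R "(n, P) # RS"]) auto
    next
      case n'k': 3
      show ?thesis
      proof (cases "n' \<le> k'")
        case True
        then show ?thesis using 3 n'k' by (intro two[of n' P k' R RS]) auto
      next
        case False
        then show ?thesis using 3 n'k' by (intro two[of k' R n' P RS]) auto
      qed
    qed
  qed
qed

lemma constructible_ex:
  fixes Q :: "(nat \<Rightarrow> 'k) \<Rightarrow> bool"
  assumes "constructible Q"
  shows "constructible (\<lambda>e. \<exists>a. Q (e(i := a)))"
proof -
  obtain C where C: "finite C" "\<forall>x\<in>C. set (fst x) \<subseteq> polyfun \<and> snd x \<in> polyfun"
      "Q = (\<lambda>e. \<exists>x\<in>C. (\<forall>p\<in>set (fst x). p e = 0) \<and> snd x e \<noteq> 0)"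
    using constructible_dnf(1)[OF assms] unfolding is_dnf_def by (elim exE conjE) (rule that)
  have "\<forall>p\<in>polyfun. \<exists>n P. poly_family n P \<and> (\<forall>e (a :: 'k). p (e(i := a)) = poly (P e) a)"
    using polyfun_as_poly_family by blast
  then obtain n P where P: "\<And>p. p \<in> polyfun \<Longrightarrow> poly_family (n p) (P p)"
      "\<And>p e (a :: 'k). p \<in> polyfun \<Longrightarrow> p (e(i := a)) = poly (P p e) a"
    by metis
  have "constructible (\<lambda>e. \<exists>x\<in>C. \<exists>a. (\<forall>(n, P)\<in>set (map (\<lambda>p. (n p, P p)) (fst x)). poly (P e) a = 0) \<and>
      poly (P (snd x) e) a \<noteq> 0)"
    using C(1)
  proof (rule constructible_bex)
    fix x assume "x \<in> C"
    then have "set (fst x) \<subseteq> polyfun" "snd x \<in> polyfun" using C(2) by auto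
    then show "constructible (\<lambda>e. \<exists>a. (\<forall>(n, P)\<in>set (map (\<lambda>p. (n p, P p)) (fst x)). poly (P e) a = 0) \<and>
      poly (P (snd x) e) a \<noteq> 0)"
      using P(1) by (intro constructible_ex_system[where m = "n (snd x)"]) auto
  qed
  moreover have "(\<exists>a. Q (e(i := a))) \<longleftrightarrow>
      (\<exists>x\<in>C. \<exists>a. (\<forall>(n, P)\<in>set (map (\<lambda>p. (n p, P p)) (fst x)). poly (P e) a = 0) \<and>
      poly (P (snd x) e) a \<noteq> 0)" for e
  proof -
    have "(\<forall>p\<in>set (fst x). p (e(i := a)) = 0) \<and> snd x (e(i := a)) \<noteq> 0 \<longleftrightarrow>
        (\<forall>(n, P)\<in>set (map (\<lambda>p. (n p, P p)) (fst x)). poly (P e) a = 0) \<and> poly (P (snd x) e) a \<noteq> 0"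
      if "x \<in> C" for x a
    proof -
      have "set (fst x) \<subseteq> polyfun" "snd x \<in> polyfun" using C(2) that by auto
      then have "p (e(i := a)) = poly (P p e) a" "snd x (e(i := a)) = poly (P (snd x) e) a"
        if "p \<in> set (fst x)" for p
        using that P(2) by blast+
      then show ?thesis using \<open>snd x \<in> polyfun\<close> P(2)[of "snd x"] by (simp del: fun_upd_apply)
    qed
    then show ?thesis unfolding C(3) by blast
  qed
  ultimately show ?thesis by simp
qed

lemma tm_val_polyfun:
  "lang_tm ring_lang u \<Longrightarrow> (\<lambda>e. tm_val (ring_struct :: (_, _, 'k) fo_struct) e u) \<in> polyfun"
proof (induction u)
  case (Var i)
  then show ?case by (simp add: polyfun.var)
next
  case (App s ts)
  then have len: "length ts = ring_arity s" by (simp add: ring_lang_def)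
  have IH: "(\<lambda>e. tm_val (ring_struct :: (_, _, 'k) fo_struct) e (ts ! i)) \<in> polyfun"
    if "i < length ts" for i
    using App that by simp
  show ?case
    using len IH by (cases s)
      (auto simp: ring_struct_def intro!: polyfun.const polyfun.add polyfun.mult polyfun_diff)
qed

lemma sat_constructible:
  "lang_fm ring_lang \<phi> \<Longrightarrow> constructible (\<lambda>e. sat (ring_struct :: (_, _, 'k) fo_struct) e \<phi>)"
proof (induction \<phi>)
  case (Eq u w)
  then have "constructible (\<lambda>e. tm_val (ring_struct :: (_, _, 'k) fo_struct) e u - tm_val ring_struct e w = 0)"
    by (intro constructible.zero polyfun_diff tm_val_polyfun) auto
  then show ?case by simp
next
  case (Rel s ts)
  then show ?case by (simp add: ring_lang_def)
next
  case (Exists i \<phi>)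
  then show ?case using constructible_ex[of _ i] by (simp add: ring_struct_def)
qed (auto intro: constructible.neg constructible.conj)


end

section \<open>Plane curves and independence of characters\<close>

lemma polyfun_bivariate:
  assumes "p \<in> polyfun"
  shows "\<exists>P :: 'k::field poly poly. \<forall>x y.
    p (\<lambda>i. if i = 0 then x else if i = 1 then y else c i) = poly (poly P [:y:]) x"
  using assms
proof induction
  case (const a)
  show ?case by (rule exI[of _ "[:[:a:]:]"]) simp
next
  case (var i)
  consider "i = 0" | "i = 1" | "i \<noteq> 0" "i \<noteq> 1" by blast
  then show ?case
  proof cases
    case 1
    then show ?thesis by (intro exI[of _ "[:[:0, 1:]:]"]) simp
  next
    case 2
    then show ?thesis by (intro exI[of _ "[:0, 1:]"]) simp
  next
    case 3
    then show ?thesis by (intro exI[of _ "[:[:c i:]:]"]) simp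
  qed
next
  case (add p q)
  then show ?case by (metis poly_add)
next
  case (mult p q)
  then show ?case by (metis poly_mult)
qed

text \<open>A constructible subset of the plane holds generically or fails generically, so it or its
  complement lies on a curve. Conjunctions are handled by multiplying the equations. In
  \<open>P\<close> the outer indeterminate is the second coordinate and the inner one the
  first.\<close>

lemma constructible_bivariate:
  fixes Q :: "(nat \<Rightarrow> 'k::field) \<Rightarrow> bool"
  defines "E \<equiv> \<lambda>c x y i. if i = 0 then x else if i = 1 then y else c (i :: nat)"
  assumes "constructible Q"
  shows "\<exists>P :: 'k poly poly. P \<noteq> 0 \<and>
    ((\<forall>x y. Q (E c x y) \<longrightarrow> poly (poly P [:y:]) x = 0) \<or>
     (\<forall>x y. \<not> Q (E c x y) \<longrightarrow> poly (poly P [:y:]) x = 0))"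
  using assms(2)
proof induction
  case (zero p)
  obtain P :: "'k poly poly" where P: "\<And>x y. p (E c x y) = poly (poly P [:y:]) x"
    using polyfun_bivariate[OF zero] unfolding E_def by blast
  show ?case
  proof (cases "P = 0")
    case True
    then show ?thesis using P by (intro exI[of _ 1]) simp
  next
    case False
    then show ?thesis using P by (intro exI[of _ P]) simp
  qed
next
  case (neg Q)
  then show ?case unfolding not_not by (subst disj_commute)
next
  case (conj Q R)
  obtain P :: "'k poly poly" where P: "P \<noteq> 0"
    "(\<forall>x y. Q (E c x y) \<longrightarrow> poly (poly P [:y:]) x = 0) \<or>
     (\<forall>x y. \<not> Q (E c x y) \<longrightarrow> poly (poly P [:y:]) x = 0)"
    using conj.IH(1) by (elim exE conjE) (rule that)
  obtain P' :: "'k poly poly" where P': "P' \<noteq> 0"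
    "(\<forall>x y. R (E c x y) \<longrightarrow> poly (poly P' [:y:]) x = 0) \<or>
     (\<forall>x y. \<not> R (E c x y) \<longrightarrow> poly (poly P' [:y:]) x = 0)"
    using conj.IH(2) by (elim exE conjE) (rule that)
  have "P * P' \<noteq> 0" using P(1) P'(1) by simp
  moreover from P(2) P'(2) have
    "(\<forall>x y. Q (E c x y) \<and> R (E c x y) \<longrightarrow> poly (poly (P * P') [:y:]) x = 0) \<or>
     (\<forall>x y. \<not> (Q (E c x y) \<and> R (E c x y)) \<longrightarrow> poly (poly (P * P') [:y:]) x = 0)"
    unfolding poly_mult mult_eq_0_iff by blast
  ultimately show ?case by blast
qed

text \<open>Artin's argument: translate the relation by \<open>z\<close> and subtract
  \<open>\<chi> u z\<close> times the original. This removes \<open>u\<close> and multiplies the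
  coefficient of \<open>t\<close> by the non-zero number
  \<open>\<chi> t z - \<chi> u z\<close>.\<close>

lemma characters_independent:
  fixes \<chi> :: "'s \<Rightarrow> 'b::semigroup_mult \<Rightarrow> 'k::field"
  assumes "finite S"
    and G: "\<And>x y. x \<in> G \<Longrightarrow> y \<in> G \<Longrightarrow> x * y \<in> G"
    and hom: "\<And>s x y. s \<in> S \<Longrightarrow> x \<in> G \<Longrightarrow> y \<in> G \<Longrightarrow> \<chi> s (x * y) = \<chi> s x * \<chi> s y"
    and nz: "\<And>s. s \<in> S \<Longrightarrow> \<exists>x\<in>G. \<chi> s x \<noteq> 0"
    and dist: "\<And>s t. s \<in> S \<Longrightarrow> t \<in> S \<Longrightarrow> s \<noteq> t \<Longrightarrow> \<exists>x\<in>G. \<chi> s x \<noteq> \<chi> t x"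
    and sum: "\<And>x. x \<in> G \<Longrightarrow> (\<Sum>s\<in>S. c s * \<chi> s x) = 0"
    and "s \<in> S"
  shows "c s = 0"
  using assms(1,3-)
proof (induction S arbitrary: c s rule: finite_induct)
  case empty
  then show ?case by simp
next
  case (insert u S)
  have S: "c t = 0" if "t \<in> S" for t
  proof -
    obtain z where z: "z \<in> G" "\<chi> u z \<noteq> \<chi> t z"
      using insert.prems(3)[of u t] insert.hyps(2) \<open>t \<in> S\<close> by auto
    have "(\<Sum>s\<in>S. (c s * (\<chi> s z - \<chi> u z)) * \<chi> s x) = 0" if "x \<in> G" for x
    proof -
      have "(\<Sum>s\<in>S. (c s * (\<chi> s z - \<chi> u z)) * \<chi> s x)
          = (\<Sum>s\<in>insert u S. (c s * (\<chi> s z - \<chi> u z)) * \<chi> s x)"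
        using insert.hyps by simp
      also have "\<dots> = (\<Sum>s\<in>insert u S. c s * \<chi> s (z * x)) - \<chi> u z * (\<Sum>s\<in>insert u S. c s * \<chi> s x)"
        unfolding sum_distrib_left sum_subtractf[symmetric]
        by (rule sum.cong) (simp_all add: insert.prems(1) z that algebra_simps)
      also have "\<dots> = 0" using insert.prems(4) G z that by simp
      finally show ?thesis .
    qed
    then have "c t * (\<chi> t z - \<chi> u z) = 0"
      using that
      by (intro insert.IH[where c = "\<lambda>s. c s * (\<chi> s z - \<chi> u z)" and s = t] insert.prems(1-3))
        blast+
    then show ?thesis using z by simp
  qed
  show ?case
  proof (cases "s = u")
    case True
    obtain x where x: "x \<in> G" "\<chi> u x \<noteq> 0" using insert.prems(2)[of u] by auto
    have "(\<Sum>s\<in>S. c s * \<chi> s x) = 0" using S by simp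
    then have "c u * \<chi> u x = 0" using insert.prems(4)[OF x(1)] insert.hyps by simp
    then show ?thesis using True x by simp
  qed (use S insert.prems in auto)
qed

lemma poly_as_sum:
  fixes p :: "'k::comm_ring_1 poly"
  assumes "degree p \<le> n"
  shows "poly p x = (\<Sum>i\<le>n. coeff p i * x ^ i)"
  unfolding poly_altdef using assms
  by (intro sum.mono_neutral_left) (auto intro: le_degree)

text \<open>A ring-definable graph lies on a curve, so the characters \<open>x\<^sup>i (h x)\<^sup>j\<close> are linearly
  dependent.\<close>

lemma ring_definable_mult_hom:
  fixes h :: "'k::field \<Rightarrow> 'k"
  assumes ac: "\<And>p :: 'k poly. degree p > 0 \<Longrightarrow> \<exists>x. poly p x = 0"
    and h0: "\<And>x. x \<noteq> 0 \<Longrightarrow> h x \<noteq> 0"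
    and hom: "\<And>x y. x \<noteq> 0 \<Longrightarrow> y \<noteq> 0 \<Longrightarrow> h (x * y) = h x * h y"
    and "definable ring_lang ring_struct 2 (graph_on (UNIV - {0}) h)"
  shows "\<exists>i j i' j'. (i, j) \<noteq> (i', j') \<and> (\<forall>x. x \<noteq> 0 \<longrightarrow> x ^ i * h x ^ j = x ^ i' * h x ^ j')"
proof -
  obtain \<phi> c where \<phi>: "lang_fm ring_lang \<phi>" "graph_on (UNIV - {0}) h = {xs. length xs = 2 \<and>
      set xs \<subseteq> univ (ring_struct :: (_, _, 'k) fo_struct) \<and>
      sat ring_struct (\<lambda>i. if i < 2 then xs ! i else c i) \<phi>}"
    using assms(4) unfolding definable_def by blast
  define E where "E x y i = (if i = 0 then x else if i = 1 then y else c (i :: nat))" for x y i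
  have sat: "sat ring_struct (E x y) \<phi> \<longleftrightarrow> x \<noteq> 0 \<and> y = h x" for x y
  proof -
    have "E x y = (\<lambda>i. if i < 2 then [x, y] ! i else c i)"
      by (auto simp: E_def fun_eq_iff less_2_cases_iff)
    then have "sat ring_struct (E x y) \<phi> \<longleftrightarrow> [x, y] \<in> graph_on (UNIV - {0}) h"
      unfolding \<phi>(2) by (simp add: ring_struct_def)
    then show ?thesis by (auto simp: graph_on_def)
  qed
  obtain P :: "'k poly poly" where P: "P \<noteq> 0"
    "(\<forall>x y. sat ring_struct (E x y) \<phi> \<longrightarrow> poly (poly P [:y:]) x = 0) \<or>
     (\<forall>x y. \<not> sat ring_struct (E x y) \<phi> \<longrightarrow> poly (poly P [:y:]) x = 0)"
    using constructible_bivariate[OF sat_constructible[OF ac \<phi>(1)], of c] unfolding E_def by blast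
  define N where "N = Max (insert (degree P) ((\<lambda>j. degree (coeff P j)) ` {..degree P}))"
  have N: "degree P \<le> N" "degree (coeff P j) \<le> N" for j
  proof -
    show "degree P \<le> N" unfolding N_def by simp
    show "degree (coeff P j) \<le> N"
      unfolding N_def by (cases "j \<le> degree P") (auto simp: coeff_eq_0 simp del: Max_insert intro: Max_ge)
  qed
  have eval: "poly (poly P [:y:]) x = (\<Sum>j\<le>N. poly (coeff P j) x * y ^ j)" for x y
    using poly_as_sum[OF N(1), of "[:y:]"]
    by (simp add: poly_sum flip: poly_const_pow)
  \<comment> \<open>The complement of the graph cannot lie on the curve: over a suitable
    \<open>x\<close> the equation is a non-zero polynomial in the second coordinate, yet all
    elements other than \<open>h x\<close> would be roots.\<close>
  have on_graph: "poly (poly P [:h x:]) x = 0" if "x \<noteq> 0" for x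
  proof (rule ccontr)
    assume "poly (poly P [:h x:]) x \<noteq> 0"
    then have "\<forall>x y. \<not> (x \<noteq> 0 \<and> y = h x) \<longrightarrow> poly (poly P [:y:]) x = 0"
      using P(2)[unfolded sat] that by (elim disjE) simp_all
    then have off: "poly (poly P [:y:]) x = 0" if "y \<noteq> h x" for x y
      using that by simp
    obtain j where j: "coeff P j \<noteq> 0" using P(1) by (auto simp: poly_eq_iff)
    have "infinite (UNIV - ({0} \<union> {x. poly (coeff P j) x = 0}))"
      using infinite_if_roots[OF ac] poly_roots_finite[OF j] by (intro Diff_infinite_finite) auto
    then have "UNIV - ({0} \<union> {x. poly (coeff P j) x = 0}) \<noteq> {}"
      by (rule infinite_imp_nonempty)
    then obtain x where x: "x \<noteq> 0" "poly (coeff P j) x \<noteq> 0" by blast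
    let ?p = "\<Sum>j\<le>N. monom (poly (coeff P j) x) j"
    have p: "poly ?p y = poly (poly P [:y:]) x" for y
      unfolding eval poly_sum by (simp add: poly_monom)
    have "j \<le> N" using N(1) j le_degree le_trans by blast
    then have "coeff ?p j \<noteq> 0" using x by (simp add: coeff_sum)
    then have "finite {y. poly ?p y = 0}" by (intro poly_roots_finite) auto
    moreover have "UNIV - {h x} \<subseteq> {y. poly ?p y = 0}" using off x by (auto simp: p)
    ultimately show False
      using infinite_if_roots[OF ac] finite_subset[of "UNIV - {h x}"] by simp
  qed
  let ?S = "{..N} \<times> {..N}"
  let ?\<chi> = "\<lambda>(i, j) x. x ^ i * h x ^ j"
  let ?c = "\<lambda>(i, j). coeff (coeff P j) i"
  have sum: "(\<Sum>s\<in>?S. ?c s * ?\<chi> s x) = 0" if "x \<in> UNIV - {0}" for x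
  proof -
    have "0 = (\<Sum>j\<le>N. \<Sum>i\<le>N. coeff (coeff P j) i * x ^ i * h x ^ j)"
      using on_graph[of x] that poly_as_sum[OF N(2), of _ x] by (simp add: eval sum_distrib_right)
    also have "\<dots> = (\<Sum>i\<le>N. \<Sum>j\<le>N. coeff (coeff P j) i * x ^ i * h x ^ j)" by (rule sum.swap)
    also have "\<dots> = (\<Sum>s\<in>?S. ?c s * ?\<chi> s x)"
      by (simp add: sum.cartesian_product split_beta mult.assoc)
    finally show ?thesis by simp
  qed
  show ?thesis
  proof (rule ccontr)
    assume "\<not> ?thesis"
    then have no: "\<forall>i j i' j'. (i, j) = (i', j') \<or> (\<exists>x. x \<noteq> 0 \<and> x ^ i * h x ^ j \<noteq> x ^ i' * h x ^ j')"
      by (simp only: not_ex de_Morgan_conj not_not not_all not_imp simp_thms)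
    have "?c s = 0" if "s \<in> ?S" for s
    proof (rule characters_independent[where S = ?S and G = "UNIV - {0}" and \<chi> = ?\<chi>])
      fix s t :: "nat \<times> nat" assume "s \<noteq> t"
      then obtain x where "x \<noteq> 0" "?\<chi> s x \<noteq> ?\<chi> t x"
        using no[rule_format, of "fst s" "snd s" "fst t" "snd t"] by (auto simp: split_beta)
      then show "\<exists>x\<in>UNIV - {0}. ?\<chi> s x \<noteq> ?\<chi> t x" by (intro bexI[of _ x]) auto
    next
      fix s assume "s \<in> ?S"
      show "\<exists>x\<in>UNIV - {0}. ?\<chi> s x \<noteq> 0"
        using h0[of 1] by (intro bexI[of _ 1]) (auto simp: split_beta)
    next
      fix s and x y :: 'k assume "x \<in> UNIV - {0}" "y \<in> UNIV - {0}"
      then show "?\<chi> s (x * y) = ?\<chi> s x * ?\<chi> s y"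
        by (simp add: split_beta hom power_mult_distrib)
    qed (use sum that in auto)
    then have c: "coeff (coeff P j) i = 0" if "i \<le> N" "j \<le> N" for i j
      using that by auto
    have "coeff P j = 0" for j
    proof (cases "j \<le> N")
      case True
      show ?thesis
      proof (rule poly_eqI)
        fix i show "coeff (coeff P j) i = coeff 0 i"
          using c True N(2)[of j] by (cases "i \<le> N") (auto intro: coeff_eq_0)
      qed
    next
      case False
      then show ?thesis using N(1) by (intro coeff_eq_0) simp
    qed
    then show False using P(1) by (simp add: poly_eq_iff)
  qed
qed

section \<open>C-minimal expansions of valued fields\<close>

lemma (in full_structure) pdef_cong: "pdef Q \<Longrightarrow> (\<And>e. R e \<longleftrightarrow> Q e) \<Longrightarrow> pdef R"
  by (subgoal_tac "R = Q") auto

section \<open>Arithmetic of the valuation and of the residue map\<close>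

locale C_minimal_valued_field =
  fixes E :: "('f, 'r) lang"
    and M :: "('f, 'r, 'a::alg_closed_field) vf_struct"
    and v :: "'a \<Rightarrow> 'g::linordered_ab_group_add"
    and res :: "'a \<Rightarrow> 'k::field"
  assumes expands: "expands_ACVF M v"
    and residue: "residue_map v res"
    and C_min: "C_minimal (vf_lang E) M"
begin

sublocale full_structure "vf_lang E" M
  using expands by unfold_locales (simp add: expands_ACVF_def)

lemma fn_ring: "length xs = ring_arity s \<Longrightarrow> fn M (Ring s) xs = ring_interp s xs"
  using expands by (simp add: expands_ACVF_def)

definition vle :: "'a \<Rightarrow> 'a \<Rightarrow> bool" where
  "vle x y \<longleftrightarrow> y = 0 \<or> x \<noteq> 0 \<and> v x \<le> v y"

lemma rl_VDiv: "rl M VDiv [x, y] \<longleftrightarrow> vle x y"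
  using expands by (simp add: expands_ACVF_def vle_def)

lemma val: "valuation v"
  using expands by (simp add: expands_ACVF_def nontrivial_valuation_def)

lemma v_mult: "x \<noteq> 0 \<Longrightarrow> y \<noteq> 0 \<Longrightarrow> v (x * y) = v x + v y"
  using val by (simp add: valuation_def)

lemma v_add: "x \<noteq> 0 \<Longrightarrow> y \<noteq> 0 \<Longrightarrow> x + y \<noteq> 0 \<Longrightarrow> min (v x) (v y) \<le> v (x + y)"
  using val by (simp add: valuation_def)

lemma v_surj: obtains x where "x \<noteq> 0" "v x = \<gamma>"
proof -
  have "\<gamma> \<in> v ` (UNIV - {0})" using val by (simp add: valuation_def)
  then show ?thesis using that by blast
qed

lemma v_one [simp]: "v 1 = 0"
  using v_mult[of 1 1] by simp

lemma v_minus [simp]: "v (- x) = v x"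
proof (cases "x = 0")
  case False
  have "v (-1) + v (-1) = 0" using v_mult[of "-1" "-1"] by simp
  then have "v (-1) = 0" by simp
  then show ?thesis using v_mult[of "-1" x] False by simp
qed simp

lemma v_diff_commute: "v (x - y) = v (y - x)"
  using v_minus[of "x - y"] by simp

lemma v_inverse: "x \<noteq> 0 \<Longrightarrow> v (inverse x) = - v x"
  using v_mult[of x "inverse x"] by (simp add: eq_neg_iff_add_eq_0 add.commute)

lemma v_divide: "x \<noteq> 0 \<Longrightarrow> y \<noteq> 0 \<Longrightarrow> v (x / y) = v x - v y"
  by (simp add: divide_inverse v_mult v_inverse)

lemma v_diff_eq_min:
  assumes "x \<noteq> 0" "y \<noteq> 0" "v x \<noteq> v y"
  shows "x - y \<noteq> 0" "v (x - y) = min (v x) (v y)"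
proof -
  have *: "v (x - y) = v x" if "x \<noteq> 0" "y \<noteq> 0" "v x < v y" for x y
  proof -
    have ne: "x - y \<noteq> 0" using that by auto
    have "v x \<le> v (x - y)" using v_add[of x "- y"] that ne by simp
    moreover have "min (v (x - y)) (v y) \<le> v x" using v_add[of "x - y" y] that ne by simp
    ultimately show ?thesis using that by (auto simp: min_le_iff_disj)
  qed
  show "x - y \<noteq> 0" using assms by auto
  show "v (x - y) = min (v x) (v y)"
    using assms *[of x y] *[of y x] v_diff_commute[of x y] by (cases "v x < v y") (auto simp: min_def)
qed

lemma nontrivial: obtains x where "x \<noteq> 0" "0 < v x"
proof -
  obtain x where x: "x \<noteq> 0" "v x \<noteq> 0"
    using expands by (auto simp: expands_ACVF_def nontrivial_valuation_def)
  show ?thesis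
  proof (cases "0 < v x")
    case False
    then show ?thesis using x that[of "inverse x"] v_inverse[of x] by auto
  qed (use that x in blast)
qed

lemma above: obtains \<gamma> :: 'g where "\<alpha> < \<gamma>" "\<beta> < \<gamma>"
proof -
  obtain x where "x \<noteq> 0" "0 < v x" by (rule nontrivial)
  then have "\<alpha> < max \<alpha> \<beta> + v x" "\<beta> < max \<alpha> \<beta> + v x"
    by (simp_all add: less_max_iff_disj max.strict_coboundedI1 add_strict_increasing2 add_le_less_mono
        add.commute add_less_le_mono add_strict_increasing)
  then show ?thesis using that by blast
qed

lemma infinite_VG: "infinite (UNIV :: 'g set)"
proof
  assume fin: "finite (UNIV :: 'g set)"
  obtain \<gamma> where "Max (UNIV :: 'g set) < \<gamma>" by (rule above[of "Max UNIV" 0])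
  then show False using Max_ge[OF fin, of \<gamma>] by simp
qed

lemma v_power_eq_0: "x \<noteq> 0 \<Longrightarrow> v (x ^ n) = 0 \<Longrightarrow> 0 < n \<Longrightarrow> v x = 0"
proof -
  assume x: "x \<noteq> 0" "v (x ^ n) = 0" "0 < n"
  have pos: "0 < v (y ^ Suc m)" if "y \<noteq> 0" "0 < v y" for y m
    using that by (induction m) (auto simp: v_mult intro: add_pos_pos)
  obtain m where n: "n = Suc m" using x gr0_implies_Suc by blast
  have "v (inverse x ^ n) = 0" using x by (simp add: power_inverse v_inverse)
  then show "v x = 0"
    using pos[of x m] pos[of "inverse x" m] x n by (simp add: v_inverse) (metis less_irrefl linorder_neqE neg_0_less_iff_less)
qed

definition vunit :: "'a \<Rightarrow> bool" where
  "vunit x \<longleftrightarrow> x \<noteq> 0 \<and> v x = 0"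

definition one_unit :: "'a \<Rightarrow> bool" where
  "one_unit x \<longleftrightarrow> x = 1 \<or> 0 < v (x - 1)"

abbreviation "\<O> \<equiv> valuation_ring v"

lemma vunit_nz: "vunit x \<Longrightarrow> x \<noteq> 0"
  by (simp add: vunit_def)

lemma vunit_1 [simp]: "vunit 1"
  by (simp add: vunit_def)

lemma vunit_mult: "vunit x \<Longrightarrow> vunit y \<Longrightarrow> vunit (x * y)"
  by (simp add: vunit_def v_mult)

lemma vunit_inverse: "vunit x \<Longrightarrow> vunit (inverse x)"
  by (simp add: vunit_def v_inverse)

lemma vunit_divide: "vunit x \<Longrightarrow> vunit y \<Longrightarrow> vunit (x / y)"
  by (simp add: divide_inverse vunit_mult vunit_inverse)

lemma vunit_power: "vunit x \<Longrightarrow> vunit (x ^ n)"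
  by (induction n) (auto intro: vunit_mult)

lemma vunit_integral: "vunit x \<Longrightarrow> x \<in> \<O>"
  by (simp add: vunit_def valuation_ring_def)

lemma integral_add: "x \<in> \<O> \<Longrightarrow> y \<in> \<O> \<Longrightarrow> x + y \<in> \<O>"
  using v_add[of x y] order_trans[of 0 "min (v x) (v y)" "v (x + y)"]
  by (cases "x = 0 \<or> y = 0") (auto simp: valuation_ring_def)

lemma integral_mult: "x \<in> \<O> \<Longrightarrow> y \<in> \<O> \<Longrightarrow> x * y \<in> \<O>"
  by (cases "x = 0 \<or> y = 0") (auto simp: valuation_ring_def v_mult)

lemma integral_minus: "x \<in> \<O> \<Longrightarrow> - x \<in> \<O>"
  by (auto simp: valuation_ring_def)

lemma integral_diff: "x \<in> \<O> \<Longrightarrow> y \<in> \<O> \<Longrightarrow> x - y \<in> \<O>"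
  using integral_add[of x "- y"] integral_minus by simp

lemma integral_0_1 [simp]: "0 \<in> \<O>" "1 \<in> \<O>"
  by (simp_all add: valuation_ring_def)

lemma integral_power: "x \<in> \<O> \<Longrightarrow> x ^ n \<in> \<O>"
  by (induction n) (auto intro: integral_mult)

lemma res_add: "x \<in> \<O> \<Longrightarrow> y \<in> \<O> \<Longrightarrow> res (x + y) = res x + res y"
  using residue by (simp add: residue_map_def)

lemma res_mult: "x \<in> \<O> \<Longrightarrow> y \<in> \<O> \<Longrightarrow> res (x * y) = res x * res y"
  using residue by (simp add: residue_map_def)

lemma res_1 [simp]: "res 1 = 1"
  using residue by (simp add: residue_map_def)

lemma res_0 [simp]: "res 0 = 0"
  using residue by (simp add: residue_map_def valuation_ring_def)

lemma res_eq_0: "x \<in> \<O> \<Longrightarrow> res x = 0 \<longleftrightarrow> x = 0 \<or> 0 < v x"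
  using residue by (simp add: residue_map_def)

lemma res_surj: obtains x where "x \<in> \<O>" "res x = a"
proof -
  have "a \<in> res ` \<O>" using residue by (simp add: residue_map_def)
  then show ?thesis using that by blast
qed

lemma res_minus: "x \<in> \<O> \<Longrightarrow> res (- x) = - res x"
  using res_add[of x "- x"] integral_minus[of x] by (simp add: eq_neg_iff_add_eq_0 add.commute)

lemma res_diff: "x \<in> \<O> \<Longrightarrow> y \<in> \<O> \<Longrightarrow> res (x - y) = res x - res y"
  using res_add[of x "- y"] res_minus[of y] integral_minus by simp

lemma res_power: "x \<in> \<O> \<Longrightarrow> res (x ^ n) = res x ^ n"
  by (induction n) (auto simp: res_mult integral_power)

lemma vunit_iff: "vunit x \<longleftrightarrow> x \<in> \<O> \<and> res x \<noteq> 0"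
  using res_eq_0[of x] by (auto simp: vunit_def valuation_ring_def)

lemma res_vunit_mult: "vunit x \<Longrightarrow> vunit y \<Longrightarrow> res (x * y) = res x * res y"
  by (simp add: res_mult vunit_integral)

lemma res_vunit_inverse: "vunit x \<Longrightarrow> res (inverse x) = inverse (res x)"
  using res_vunit_mult[of x "inverse x"] by (simp add: vunit_inverse vunit_nz inverse_unique)

lemma res_vunit_divide: "vunit x \<Longrightarrow> vunit y \<Longrightarrow> res (x / y) = res x / res y"
  by (simp add: divide_inverse res_vunit_mult res_vunit_inverse vunit_inverse)

lemma res_vunit_surj:
  assumes "a \<noteq> 0" obtains x where "vunit x" "res x = a"
  using res_surj[of a] assms vunit_iff by metis

lemma one_unit_iff: "one_unit x \<longleftrightarrow> vunit x \<and> res x = 1"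
proof
  assume x: "one_unit x"
  then have d: "x - 1 \<in> \<O>" "res (x - 1) = 0"
    using res_eq_0[of "x - 1"] by (auto simp: one_unit_def valuation_ring_def less_imp_le)
  then have "x \<in> \<O>" "res x = 1"
    using integral_add[of "x - 1" 1] res_add[of "x - 1" 1] by simp_all
  then show "vunit x \<and> res x = 1" by (simp add: vunit_iff)
next
  assume "vunit x \<and> res x = 1"
  then have "res (x - 1) = 0" "x - 1 \<in> \<O>" by (simp_all add: vunit_iff res_diff integral_diff)
  then show "one_unit x" using res_eq_0[of "x - 1"] by (auto simp: one_unit_def)
qed

text \<open>Lift \<open>p\<close>, made monic, to an integral monic polynomial of the same degree. A
  root \<open>x\<close> of the lift is integral: otherwise multiplying the equation by
  \<open>inverse x ^ degree p\<close> exhibits 0 as an element with residue 1. The residue of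
  \<open>x\<close> is then a root of \<open>p\<close>.\<close>

lemma residue_alg_closed:
  fixes p :: "'k poly"
  assumes "degree p > 0"
  shows "\<exists>x. poly p x = 0"
proof -
  let ?n = "degree p"
  have "\<exists>y. y \<in> \<O> \<and> res y = coeff p i / lead_coeff p" for i
    by (rule res_surj) blast
  then have "\<forall>i. \<exists>y. y \<in> \<O> \<and> res y = coeff p i / lead_coeff p" by blast
  from choice[OF this] obtain b
    where b: "\<And>i. b i \<in> \<O>" "\<And>i. res (b i) = coeff p i / lead_coeff p" by blast
  define q where "q = monom 1 ?n + (\<Sum>i<?n. monom (b i) i)"
  have coeff: "coeff q i = (if i < ?n then b i else if i = ?n then 1 else 0)" for i
    by (auto simp: q_def coeff_sum)
  have "degree q \<ge> ?n" by (rule le_degree) (simp add: coeff)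
  then have "degree q > 0" using assms by simp
  then obtain x where x: "poly q x = 0" using alg_closed_imp_poly_has_root by blast
  have sum: "x ^ ?n + (\<Sum>i<?n. b i * x ^ i) = 0"
    using x by (simp add: q_def poly_sum poly_monom)
  have int_sum: "(\<Sum>i\<in>A. c i) \<in> \<O>" if "finite A" "\<And>i. i \<in> A \<Longrightarrow> c i \<in> \<O>" for A and c :: "nat \<Rightarrow> 'a"
    using that by (induction A rule: finite_induct) (auto intro: integral_add)
  have res_sum: "res (\<Sum>i\<in>A. c i) = (\<Sum>i\<in>A. res (c i))"
    if "finite A" "\<And>i. i \<in> A \<Longrightarrow> c i \<in> \<O>" for A and c :: "nat \<Rightarrow> 'a"
    using that by (induction A rule: finite_induct) (auto simp: res_add int_sum)
  have "x \<in> \<O>"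
  proof (rule ccontr)
    assume "x \<notin> \<O>"
    then have x0: "x \<noteq> 0" "v x < 0" by (auto simp: valuation_ring_def)
    let ?y = "inverse x"
    have y: "?y \<in> \<O>" "res ?y = 0"
      using x0 res_eq_0[of ?y] by (auto simp: valuation_ring_def v_inverse)
    have "1 + (\<Sum>i<?n. b i * ?y ^ (?n - i)) = ?y ^ ?n * (x ^ ?n + (\<Sum>i<?n. b i * x ^ i))"
    proof -
      have summand: "?y ^ ?n * (b i * x ^ i) = b i * ?y ^ (?n - i)" if "i < ?n" for i
      proof -
        have "?y ^ ?n = ?y ^ (?n - i) * ?y ^ i" using that by (simp flip: power_add)
        then show ?thesis using x0(1) by (simp add: power_inverse)
      qed
      have "?y ^ ?n * x ^ ?n = 1" using x0(1) by (simp add: power_inverse)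
      moreover have "(\<Sum>i<?n. b i * ?y ^ (?n - i)) = ?y ^ ?n * (\<Sum>i<?n. b i * x ^ i)"
        unfolding sum_distrib_left by (intro sum.cong) (simp_all only: summand lessThan_iff)
      ultimately show ?thesis by (simp only: distrib_left)
    qed
    then have eq: "1 + (\<Sum>i<?n. b i * ?y ^ (?n - i)) = 0" using sum by simp
    have "res (\<Sum>i<?n. b i * ?y ^ (?n - i)) = (\<Sum>i<?n. res (b i * ?y ^ (?n - i)))"
      using b y by (intro res_sum) (auto intro: integral_mult integral_power)
    also have "\<dots> = 0"
      using b y by (intro sum.neutral) (auto simp: res_mult integral_power res_power)
    finally have "res (1 + (\<Sum>i<?n. b i * ?y ^ (?n - i))) = 1"
      using b y by (subst res_add) (auto intro!: int_sum integral_mult integral_power)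
    then show False using eq by simp
  qed
  then have "res (x ^ ?n + (\<Sum>i<?n. b i * x ^ i)) = res x ^ ?n + (\<Sum>i<?n. res (b i) * res x ^ i)"
    using b by (simp add: res_add res_power integral_power int_sum integral_mult res_sum res_mult)
  then have "res x ^ ?n + (\<Sum>i<?n. res (b i) * res x ^ i) = 0" using sum by simp
  moreover have "poly p (res x) = lead_coeff p * (res x ^ ?n + (\<Sum>i<?n. res (b i) * res x ^ i))"
  proof -
    have lc: "lead_coeff p \<noteq> 0" using assms by auto
    have "poly p (res x) = (\<Sum>i<?n. coeff p i * res x ^ i) + lead_coeff p * res x ^ ?n"
      by (simp add: poly_altdef flip: lessThan_Suc_atMost)
    also have "(\<Sum>i<?n. coeff p i * res x ^ i) = lead_coeff p * (\<Sum>i<?n. res (b i) * res x ^ i)"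
      unfolding sum_distrib_left b using lc by (intro sum.cong) auto
    finally show ?thesis by (simp add: algebra_simps)
  qed
  ultimately show ?thesis by auto
qed

lemma infinite_RF: "infinite (UNIV :: 'k set)"
  using residue_alg_closed by (rule infinite_if_roots)

section \<open>Definability of the field operations, units and 1-units\<close>

lemma tdef_diff: "tdef s \<Longrightarrow> tdef t \<Longrightarrow> tdef (\<lambda>e. s e - t e)"
  by (rule tdef_fun2[where F = "(-)"])
    (use tdef_App2[of "Ring RMinus" 0 1] in \<open>simp_all add: vf_lang_def fn_ring\<close>)

lemma tdef_mult: "tdef s \<Longrightarrow> tdef t \<Longrightarrow> tdef (\<lambda>e. s e * t e)"
  by (rule tdef_fun2[where F = "(*)"])
    (use tdef_App2[of "Ring RTimes" 0 1] in \<open>simp_all add: vf_lang_def fn_ring\<close>)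

lemma tdef_power: "tdef t \<Longrightarrow> tdef (\<lambda>e. t e ^ n)"
  by (induction n) (simp_all add: tdef_mult tdef_const)

lemma tdef_inverse: "tdef t \<Longrightarrow> tdef (\<lambda>e. inverse (t e))"
proof (rule tdef_fun1[where F = inverse])
  have "pdef (\<lambda>e. (e 1 = 0 \<and> e 0 = 0) \<or> e 0 * e 1 = 1)"
    by (intro pdef_disj pdef_conj pdef_eq tdef_mult tdef_var tdef_const)
  then have "pdef (\<lambda>e. e 0 = inverse (e (Suc 0)))"
  proof (rule pdef_cong)
    fix e :: "nat \<Rightarrow> 'a"
    show "e 0 = inverse (e (Suc 0)) \<longleftrightarrow> (e 1 = 0 \<and> e 0 = 0) \<or> e 0 * e 1 = 1"
      using inverse_unique[of "e 1" "e 0"] by (cases "e 1 = 0") (auto simp: mult.commute)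
  qed
  then show "tdef (\<lambda>e. inverse (e 0))" unfolding tdef_def .
qed

lemma tdef_divide: "tdef s \<Longrightarrow> tdef t \<Longrightarrow> tdef (\<lambda>e. s e / t e)"
  unfolding divide_inverse by (intro tdef_mult tdef_inverse)

lemma pdef_vle: "tdef s \<Longrightarrow> tdef t \<Longrightarrow> pdef (\<lambda>e. vle (s e) (t e))"
  by (rule pdef_term2[where Q = vle])
    (use pdef_Rel2[of VDiv 0 1] in \<open>simp_all add: vf_lang_def rl_VDiv\<close>)

lemma pdef_vunit: 
  assumes "tdef t" shows "pdef (\<lambda>e. vunit (t e))"
proof (rule pdef_cong)
  show "pdef (\<lambda>e. vle 1 (t e) \<and> vle (t e) 1)"
    by (intro pdef_conj pdef_vle tdef_const assms)
qed (auto simp: vle_def vunit_def)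

lemma pdef_one_unit: 
  assumes "tdef t" shows "pdef (\<lambda>e. one_unit (t e))"
proof (rule pdef_cong)
  show "pdef (\<lambda>e. \<not> vle (t e - 1) 1)"
    by (intro pdef_not pdef_vle tdef_diff tdef_const assms)
qed (auto simp: vle_def one_unit_def)

lemma pdef_integral: 
  assumes "tdef t" shows "pdef (\<lambda>e. t e \<in> \<O>)"
proof (rule pdef_cong)
  show "pdef (\<lambda>e. vle 1 (t e))" by (intro pdef_vle tdef_const assms)
qed (auto simp: vle_def valuation_ring_def)

lemma pdef_nz: "tdef t \<Longrightarrow> pdef (\<lambda>e. t e \<noteq> 0)"
  by (intro pdef_not pdef_eq tdef_const)

lemmas pdef_intros = pdef_conj pdef_disj pdef_eq pdef_ex pdef_nz pdef_not pdef_vunit pdef_one_unit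
  pdef_integral pdef_vle tdef_var tdef_const tdef_diff tdef_mult tdef_power tdef_inverse tdef_divide

section \<open>Definable subsets of the home sort, seen through values, residues and small
  balls\<close>

lemma C_minimal_set:
  assumes "pdef (\<lambda>e. P (e 0))"
  shows "{x. P x} \<in> boolean_combinations UNIV (balls M \<union> points M)"
proof -
  have "{xs. length xs = 1 \<and> P (if (0::nat) < 1 then xs ! 0 else 0)} = (\<lambda>x. [x]) ` {x. P x}"
    by (auto simp: length_Suc_conv image_iff)
  then have "definable (vf_lang E) M 1 ((\<lambda>x. [x]) ` {x. P x})"
    using pdef_definable[OF assms, of 1 0] by simp
  then show ?thesis using C_min unfolding C_minimal_def by simp
qed

lemma ball_cases:
  assumes "B \<in> balls M"
  obtains c d where "d \<noteq> 0" "\<And>x. x \<in> B \<longleftrightarrow> x = c \<or> v d \<le> v (x - c)"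
  | c d where "d \<noteq> 0" "\<And>x. x \<in> B \<longleftrightarrow> x = c \<or> v d < v (x - c)"
proof -
  from assms obtain c d where d: "d \<noteq> 0" and "B = closed_ball M c d \<or> B = open_ball M c d"
    by (auto simp: balls_def ball_of_radius_def nonzero_def fn_ring)
  then consider "B = closed_ball M c d" | "B = open_ball M c d" by blast
  then show ?thesis
  proof cases
    case 1
    show ?thesis using d
      by (intro that(1)[of d c]) (auto simp: 1 closed_ball_def fn_ring rl_VDiv vle_def)
  next
    case 2
    show ?thesis using d
      by (intro that(2)[of d c]) (auto simp: 2 open_ball_def fn_ring rl_VDiv vle_def)
  qed
qed

lemma points_cases: "B \<in> points M \<Longrightarrow> \<exists>c. B = {c}"
  by (auto simp: points_def)

text \<open>For a ball with centre \<open>c\<close> and radius \<open>v d\<close>, an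
  \<open>x\<close> with \<open>v x \<noteq> v c\<close> satisfies
  \<open>v (x - c) = min (v x) (v c)\<close>. Membership thus depends only on the position of
  \<open>v x\<close> relative to \<open>v c\<close> and \<open>v d\<close>; boolean combinations
  take unions of these critical values.\<close>

lemma shells:
  assumes "pdef (\<lambda>e. P (e 0))"
  shows "\<exists>F. finite F \<and> (\<forall>x y. x \<noteq> 0 \<longrightarrow> y \<noteq> 0 \<longrightarrow> v x \<notin> F \<longrightarrow> v y \<notin> F \<longrightarrow>
    (\<forall>\<gamma>\<in>F. \<gamma> < v x \<longleftrightarrow> \<gamma> < v y) \<longrightarrow> (P x \<longleftrightarrow> P y))"
proof -
  have "\<exists>F. finite F \<and> (\<forall>x y. x \<noteq> 0 \<longrightarrow> y \<noteq> 0 \<longrightarrow> v x \<notin> F \<longrightarrow> v y \<notin> F \<longrightarrow>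
    (\<forall>\<gamma>\<in>F. \<gamma> < v x \<longleftrightarrow> \<gamma> < v y) \<longrightarrow> (x \<in> X \<longleftrightarrow> y \<in> X))"
    if "X \<in> boolean_combinations UNIV (balls M \<union> points M)" for X
    using that
  proof induction
    case empty
    then show ?case by auto
  next
    case (base X)
    consider "X \<in> balls M" | c where "X = {c}" using base points_cases by blast
    then show ?case
    proof cases
      case 1
      then show ?thesis
      proof (cases rule: ball_cases)
        case (1 c d)
        show ?thesis
        proof (intro exI[of _ "{v c, v d}"] conjI allI impI)
          fix x y assume A: "x \<noteq> 0" "y \<noteq> 0" "v x \<notin> {v c, v d}" "v y \<notin> {v c, v d}"
            "\<forall>\<gamma>\<in>{v c, v d}. \<gamma> < v x \<longleftrightarrow> \<gamma> < v y"
          show "x \<in> X \<longleftrightarrow> y \<in> X"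
            using A v_diff_eq_min[of x c] v_diff_eq_min[of y c] unfolding 1
            by (cases "c = 0") (auto simp: le_less)
        qed simp
      next
        case (2 c d)
        show ?thesis
        proof (intro exI[of _ "{v c, v d}"] conjI allI impI)
          fix x y assume A: "x \<noteq> 0" "y \<noteq> 0" "v x \<notin> {v c, v d}" "v y \<notin> {v c, v d}"
            "\<forall>\<gamma>\<in>{v c, v d}. \<gamma> < v x \<longleftrightarrow> \<gamma> < v y"
          show "x \<in> X \<longleftrightarrow> y \<in> X"
            using A v_diff_eq_min[of x c] v_diff_eq_min[of y c] unfolding 2
            by (cases "c = 0") (auto simp: le_less)
        qed simp
      qed
    next
      case 2
      then show ?thesis by (intro exI[of _ "{v c}"]) auto
    qed
  next
    case (compl X)
    then show ?case by auto
  next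
    case (union X Y)
    then obtain F G where "finite F" "finite G"
      and F: "\<forall>x y. x \<noteq> 0 \<longrightarrow> y \<noteq> 0 \<longrightarrow> v x \<notin> F \<longrightarrow> v y \<notin> F \<longrightarrow>
        (\<forall>\<gamma>\<in>F. \<gamma> < v x \<longleftrightarrow> \<gamma> < v y) \<longrightarrow> (x \<in> X \<longleftrightarrow> y \<in> X)"
      and G: "\<forall>x y. x \<noteq> 0 \<longrightarrow> y \<noteq> 0 \<longrightarrow> v x \<notin> G \<longrightarrow> v y \<notin> G \<longrightarrow>
        (\<forall>\<gamma>\<in>G. \<gamma> < v x \<longleftrightarrow> \<gamma> < v y) \<longrightarrow> (x \<in> Y \<longleftrightarrow> y \<in> Y)"
      by (elim exE conjE)
    show ?case
    proof (intro exI[of _ "F \<union> G"] conjI allI impI)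
      fix x y assume "x \<noteq> 0" "y \<noteq> 0" "v x \<notin> F \<union> G" "v y \<notin> F \<union> G"
            "\<forall>\<gamma>\<in>F \<union> G. \<gamma> < v x \<longleftrightarrow> \<gamma> < v y"
      then show "x \<in> X \<union> Y \<longleftrightarrow> y \<in> X \<union> Y" using F[rule_format, of x y] G[rule_format, of x y] by simp
    qed (use \<open>finite F\<close> \<open>finite G\<close> in simp)
  qed
  from this[OF C_minimal_set[OF assms]] show ?thesis by (simp only: mem_Collect_eq)
qed

text \<open>As \<open>dist\<close> shows, the distance from an integral \<open>x\<close> to a centre
  \<open>c\<close> is constant outside the residue class of \<open>c\<close>. For non-integral
  \<open>c\<close> the element \<open>res c\<close> is arbitrary, but excluding one more class does
  no harm.\<close>

lemma residue_classes:
  assumes "pdef (\<lambda>e. P (e 0))"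
  shows "\<exists>F. finite F \<and>
    (\<forall>x y. x \<in> \<O> \<longrightarrow> y \<in> \<O> \<longrightarrow> res x \<notin> F \<longrightarrow> res y \<notin> F \<longrightarrow> (P x \<longleftrightarrow> P y))"
proof -
  have dist: "v (x - c) = (if c \<in> \<O> then 0 else v c) \<and> x \<noteq> c"
    if "x \<in> \<O>" "res x \<noteq> res c" for x c
  proof (cases "c \<in> \<O>")
    case True
    then have "vunit (x - c)" using that by (simp add: vunit_iff res_diff integral_diff)
    then show ?thesis using True by (auto simp: vunit_def)
  next
    case False
    then have c: "c \<noteq> 0" "v c < 0" by (auto simp: valuation_ring_def)
    show ?thesis
    proof (cases "x = 0")
      case False
      then have "v c < v x" using that c by (auto simp: valuation_ring_def)
      then show ?thesis using v_diff_eq_min[of x c] c False \<open>c \<notin> \<O>\<close> by auto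
    qed (use c False in auto)
  qed
  have "\<exists>F. finite F \<and> (\<forall>x y. x \<in> \<O> \<longrightarrow> y \<in> \<O> \<longrightarrow> res x \<notin> F \<longrightarrow> res y \<notin> F \<longrightarrow> (x \<in> X \<longleftrightarrow> y \<in> X))"
    if "X \<in> boolean_combinations UNIV (balls M \<union> points M)" for X
    using that
  proof induction
    case empty
    then show ?case by auto
  next
    case (base X)
    consider "X \<in> balls M" | c where "X = {c}" using base points_cases by blast
    then show ?case
    proof cases
      case 1
      then show ?thesis
      proof (cases rule: ball_cases)
        case (1 c d)
        then show ?thesis using dist[of _ c] by (intro exI[of _ "{res c}"]) simp
      next
        case (2 c d)
        then show ?thesis using dist[of _ c] by (intro exI[of _ "{res c}"]) simp
      qed
    next
      case 2
      then show ?thesis by (intro exI[of _ "{res c}"]) auto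
    qed
  next
    case (compl X)
    then show ?case by auto
  next
    case (union X Y)
    then obtain F G where "finite F" "finite G"
      "\<forall>x y. x \<in> \<O> \<longrightarrow> y \<in> \<O> \<longrightarrow> res x \<notin> F \<longrightarrow> res y \<notin> F \<longrightarrow> (x \<in> X \<longleftrightarrow> y \<in> X)"
      "\<forall>x y. x \<in> \<O> \<longrightarrow> y \<in> \<O> \<longrightarrow> res x \<notin> G \<longrightarrow> res y \<notin> G \<longrightarrow> (x \<in> Y \<longleftrightarrow> y \<in> Y)"
      by (elim exE conjE)
    then show ?case by (intro exI[of _ "F \<union> G"]) blast
  qed
  from this[OF C_minimal_set[OF assms]] show ?thesis by (simp only: mem_Collect_eq)
qed

text \<open>Balls have no boundary in the valuation topology, and a singleton has only its own
  point. Hence an infinite definable set contains a ball, which is how this is used.\<close>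

lemma finite_boundary:
  assumes "pdef (\<lambda>e. P (e 0))"
  shows "\<exists>F. finite F \<and>
    (\<forall>x. x \<notin> F \<longrightarrow> (\<exists>d. d \<noteq> 0 \<and> (\<forall>y. y = x \<or> v d \<le> v (y - x) \<longrightarrow> (P y \<longleftrightarrow> P x))))"
proof -
  have tri: "z = x \<or> v d \<le> v (z - x)" if "y = x \<or> v d \<le> v (y - x)" "z = y \<or> v d \<le> v (z - y)" for x y z d
  proof -
    have "v d \<le> v ((z - y) + (y - x))" if "z \<noteq> y" "y \<noteq> x" "z \<noteq> x" "v d \<le> v (y - x)" "v d \<le> v (z - y)"
      using v_add[of "z - y" "y - x"] that by (auto simp: min_le_iff_disj intro: order_trans)
    then show ?thesis using that by auto
  qed
  have tri': "z = x \<or> v d < v (z - x)" if "y = x \<or> v d < v (y - x)" "z = y \<or> v d < v (z - y)" for x y z d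
  proof -
    have "v d < v ((z - y) + (y - x))" if "z \<noteq> y" "y \<noteq> x" "z \<noteq> x" "v d < v (y - x)" "v d < v (z - y)"
      using v_add[of "z - y" "y - x"] that by (auto simp: min_le_iff_disj intro: less_le_trans)
    then show ?thesis using that by auto
  qed
  have "\<exists>F. finite F \<and> (\<forall>x. x \<notin> F \<longrightarrow>
      (\<exists>d. d \<noteq> 0 \<and> (\<forall>y. y = x \<or> v d \<le> v (y - x) \<longrightarrow> (y \<in> X \<longleftrightarrow> x \<in> X))))"
    if "X \<in> boolean_combinations UNIV (balls M \<union> points M)" for X
    using that
  proof induction
    case empty
    then show ?case by (intro exI[of _ "{}"]) (auto intro: exI[of _ 1])
  next
    case (base X)
    consider "X \<in> balls M" | c where "X = {c}" using base points_cases by blast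
    then show ?case
    proof cases
      case 1
      then show ?thesis
      proof (cases rule: ball_cases)
        case (1 c d)
        have "y \<in> X \<longleftrightarrow> x \<in> X" if "y = x \<or> v d \<le> v (y - x)" for x y
          unfolding 1 using that tri[of x c d y] tri[of y c d x] v_diff_commute[of x y] by metis
        then show ?thesis using 1(1) by blast
      next
        case (2 c d)
        \<comment> \<open>The neighbourhoods sought are closed balls, so an open ball of radius
          \<open>v d\<close> calls for a strictly larger value.\<close>
        obtain \<gamma> where "v d < \<gamma>" by (rule above)
        moreover obtain d' where d': "d' \<noteq> 0" "v d' = \<gamma>" by (rule v_surj)
        ultimately have "y = x \<or> v d < v (y - x)" if "y = x \<or> v d' \<le> v (y - x)" for x y
          using that by auto
        then have "y \<in> X \<longleftrightarrow> x \<in> X" if "y = x \<or> v d' \<le> v (y - x)" for x y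
          unfolding 2 using that tri'[of x c d y] tri'[of y c d x] v_diff_commute[of x y] by metis
        then show ?thesis using d' by blast
      qed
    next
      case 2
      have "\<exists>d. d \<noteq> 0 \<and> (\<forall>y. y = x \<or> v d \<le> v (y - x) \<longrightarrow> (y \<in> X \<longleftrightarrow> x \<in> X))" if "x \<noteq> c" for x
      proof -
        obtain \<gamma> where "v (c - x) < \<gamma>" by (rule above)
        moreover obtain d where "d \<noteq> 0" "v d = \<gamma>" by (rule v_surj)
        ultimately show ?thesis using 2 that by (intro exI[of _ d]) auto
      qed
      then show ?thesis by (intro exI[of _ "{c}"]) simp
    qed
  next
    case (compl X)
    then show ?case by simp
  next
    case (union X Y)
    then obtain F G where "finite F" "finite G" and
      F: "\<forall>x. x \<notin> F \<longrightarrow> (\<exists>d. d \<noteq> 0 \<and> (\<forall>y. y = x \<or> v d \<le> v (y - x) \<longrightarrow> (y \<in> X \<longleftrightarrow> x \<in> X)))" and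
      G: "\<forall>x. x \<notin> G \<longrightarrow> (\<exists>d. d \<noteq> 0 \<and> (\<forall>y. y = x \<or> v d \<le> v (y - x) \<longrightarrow> (y \<in> Y \<longleftrightarrow> x \<in> Y)))"
      by (elim exE conjE)
    show ?case
    proof (intro exI[of _ "F \<union> G"] conjI allI impI)
      fix x assume "x \<notin> F \<union> G"
      then have "x \<notin> F" "x \<notin> G" by simp_all
      from F[rule_format, OF this(1)] obtain c where "c \<noteq> 0"
        and c: "\<forall>y. y = x \<or> v c \<le> v (y - x) \<longrightarrow> (y \<in> X \<longleftrightarrow> x \<in> X)"
        by (elim exE conjE)
      from G[rule_format, OF \<open>x \<notin> G\<close>] obtain d where "d \<noteq> 0"
        and d: "\<forall>y. y = x \<or> v d \<le> v (y - x) \<longrightarrow> (y \<in> Y \<longleftrightarrow> x \<in> Y)"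
        by (elim exE conjE)
      define b where "b = (if v c \<le> v d then d else c)"
      have b: "b \<noteq> 0" "v c \<le> v b" "v d \<le> v b"
        using \<open>c \<noteq> 0\<close> \<open>d \<noteq> 0\<close> by (auto simp: b_def)
      have "y \<in> X \<union> Y \<longleftrightarrow> x \<in> X \<union> Y" if "y = x \<or> v b \<le> v (y - x)" for y
      proof -
        have "y = x \<or> v c \<le> v (y - x)" "y = x \<or> v d \<le> v (y - x)"
          using that b by (auto intro: order_trans)
        then show ?thesis using c[rule_format, of y] d[rule_format, of y] by simp
      qed
      then show "\<exists>d. d \<noteq> 0 \<and> (\<forall>y. y = x \<or> v d \<le> v (y - x) \<longrightarrow> (y \<in> X \<union> Y \<longleftrightarrow> x \<in> X \<union> Y))"
        using b(1) by blast
    qed (use \<open>finite F\<close> \<open>finite G\<close> in simp)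
  qed
  from this[OF C_minimal_set[OF assms]] show ?thesis by (simp only: mem_Collect_eq)
qed

end

section \<open>Definable subgroups\<close>

text \<open>Multiplication by \<open>a\<close> is injective and hence permutes the finite set
  \<open>C\<close>; compare the products over \<open>C\<close>. Closure under inverses follows from
  finiteness.\<close>

lemma finite_mult_closed_power:
  fixes C :: "'k::field set"
  assumes "finite C" "0 \<notin> C" "\<And>a b. a \<in> C \<Longrightarrow> b \<in> C \<Longrightarrow> a * b \<in> C" "a \<in> C"
  shows "a ^ card C = 1"
proof -
  have a: "a \<noteq> 0" using assms by auto
  have inj: "inj_on ((*) a) C" using a by (auto simp: inj_on_def)
  moreover have "(*) a ` C \<subseteq> C" using assms by auto
  ultimately have "(*) a ` C = C" using assms(1) by (simp add: endo_inj_surj)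
  then have "(\<Prod>x\<in>C. x) = (\<Prod>x\<in>C. a * x)"
    using prod.reindex[OF inj, of "\<lambda>x. x"] by simp
  also have "\<dots> = a ^ card C * (\<Prod>x\<in>C. x)" by (simp add: prod.distrib)
  finally show ?thesis using assms by auto
qed

lemma card_power_eq_1:
  assumes "0 < n"
  shows "finite {x :: 'k::field. x ^ n = 1}" "card {x :: 'k. x ^ n = 1} \<le> n"
proof -
  let ?p = "monom 1 n - 1 :: 'k poly"
  have "coeff ?p n = 1" using assms by simp
  then have p: "?p \<noteq> 0" by (metis coeff_0 zero_neq_one)
  have roots: "{x :: 'k. x ^ n = 1} = {x. poly ?p x = 0}" by (simp add: poly_monom)
  show "finite {x :: 'k. x ^ n = 1}" unfolding roots using p by (rule poly_roots_finite)
  have "degree ?p \<le> n" by (intro degree_diff_le degree_monom_le) simp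
  then show "card {x :: 'k. x ^ n = 1} \<le> n"
    unfolding roots using card_poly_roots_bound[OF p] by linarith
qed

text \<open>All elements of \<open>C\<close> are roots of unity of order dividing
  \<open>card C\<close>, and there are at most \<open>card C\<close> of those.\<close>

lemma finite_subgroup_eq_roots:
  fixes C :: "'k::field set"
  assumes "finite C" "0 \<notin> C" "\<And>a b. a \<in> C \<Longrightarrow> b \<in> C \<Longrightarrow> a * b \<in> C" "C \<noteq> {}"
  shows "{x. x ^ card C = 1} = C"
proof -
  have "0 < card C" using assms by (simp add: card_gt_0_iff)
  then show ?thesis
    using card_power_eq_1[of "card C", where 'k = 'k] finite_mult_closed_power[OF assms(1-3)]
    by (intro card_seteq[symmetric]) auto
qed

section \<open>Definable subgroups of the value group, the residue field and the multiplicative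
  group\<close>

context C_minimal_valued_field
begin

text \<open>\<open>D\<close> is constant on the gaps between finitely many critical values. If it
  were bounded, let \<phi> be the least critical bound and \<psi> the critical value below it. Some
  \<open>d\<close> in \<open>D\<close> exceeds \<psi>, and its mirror image \<phi> - d lies in the
  same gap, hence in \<open>D\<close>. Doubling both contradicts the bound. Only doubling is
  assumed, because \<open>induces_sign\<close> applies this to sets that are not given as
  groups.\<close>

lemma unbounded_if_doubling:
  assumes def: "pdef (\<lambda>e. e 0 \<noteq> 0 \<and> D (v (e 0)))"
    and pos: "\<And>\<gamma>. D \<gamma> \<Longrightarrow> 0 < \<gamma>" and double: "\<And>\<gamma>. D \<gamma> \<Longrightarrow> D (\<gamma> + \<gamma>)" and "D \<delta>"
  shows "\<exists>\<alpha>. \<forall>\<gamma>>\<alpha>. D \<gamma>"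
proof (rule ccontr)
  assume no: "\<not> ?thesis"
  obtain F where "finite F" and F: "\<forall>x y. x \<noteq> 0 \<longrightarrow> y \<noteq> 0 \<longrightarrow> v x \<notin> F \<longrightarrow> v y \<notin> F \<longrightarrow>
    (\<forall>\<gamma>\<in>F. \<gamma> < v x \<longleftrightarrow> \<gamma> < v y) \<longrightarrow> (x \<noteq> 0 \<and> D (v x) \<longleftrightarrow> y \<noteq> 0 \<and> D (v y))"
    using shells[OF def] by (elim exE conjE)
  have const: "D \<alpha> \<longleftrightarrow> D \<beta>" if "\<alpha> \<notin> F" "\<beta> \<notin> F" "\<And>\<gamma>. \<gamma> \<in> F \<Longrightarrow> \<gamma> < \<alpha> \<longleftrightarrow> \<gamma> < \<beta>" for \<alpha> \<beta>
  proof -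
    obtain x where "x \<noteq> 0" "v x = \<alpha>" by (rule v_surj)
    moreover obtain y where "y \<noteq> 0" "v y = \<beta>" by (rule v_surj)
    ultimately show ?thesis using F[rule_format, of x y] that by simp
  qed
  \<comment> \<open>The value 0 is added so that a critical value exists below \<phi>, which is
    positive.\<close>
  let ?F = "insert 0 F"
  have fin: "finite ?F" using \<open>finite F\<close> by simp
  have bound: "\<gamma> \<le> Max ?F" if "D \<gamma>" for \<gamma>
  proof (rule ccontr)
    assume "\<not> \<gamma> \<le> Max ?F"
    then have above: "\<beta> \<notin> F \<and> (\<forall>\<alpha>\<in>F. \<alpha> < \<beta>)" if "Max ?F < \<beta>" for \<beta>
      using Max_ge[OF fin] that by (metis insertCI leD le_less_trans)
    have "D \<beta>" if "Max ?F < \<beta>" for \<beta>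
      using const[of \<gamma> \<beta>] above[of \<gamma>] above[of \<beta>] that \<open>D \<gamma>\<close> \<open>\<not> \<gamma> \<le> Max ?F\<close> by auto
    then show False using no by blast
  qed
  define S where "S = {\<phi>\<in>?F. \<forall>\<gamma>. D \<gamma> \<longrightarrow> \<gamma> \<le> \<phi>}"
  have S: "finite S" "S \<noteq> {}"
    using fin bound Max_in[OF fin] unfolding S_def by auto
  define \<phi> where "\<phi> = Min S"
  have \<phi>: "\<gamma> \<le> \<phi>" if "D \<gamma>" for \<gamma>
    using Min_in[OF S] that unfolding \<phi>_def S_def by blast
  have "0 < \<phi>" using pos[OF \<open>D \<delta>\<close>] \<phi>[OF \<open>D \<delta>\<close>] by simp
  let ?G = "{\<psi>\<in>?F. \<psi> < \<phi>}"
  define \<psi> where "\<psi> = Max ?G"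
  have G: "finite ?G" "?G \<noteq> {}" using fin \<open>0 < \<phi>\<close> by auto
  have "\<psi> \<in> ?G" unfolding \<psi>_def by (rule Max_in[OF G])
  then have "\<psi> \<notin> S" using Min_le[OF S(1), of \<psi>] by (auto simp: \<phi>_def)
  then obtain d where d: "D d" "\<psi> < d" using \<open>\<psi> \<in> ?G\<close> unfolding S_def by (auto simp: not_le)
  have gap: "\<beta> \<notin> F \<and> (\<forall>\<alpha>\<in>F. \<alpha> < \<beta> \<longleftrightarrow> \<alpha> \<le> \<psi>)" if "\<psi> < \<beta>" "\<beta> < \<phi>" for \<beta>
  proof -
    have "\<alpha> \<le> \<psi>" if "\<alpha> \<in> F" "\<alpha> < \<phi>" for \<alpha>
      unfolding \<psi>_def using that G(1) by (intro Max_ge) auto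
    then show ?thesis using that by (metis less_le_trans less_trans not_le order.strict_implies_order)
  qed
  \<comment> \<open>Doubling twice is needed: d + d \<le> \<phi> puts the mirror image at or above
    \<open>d\<close>, and the strict contradiction with \<phi> \<le> d + d comes from the fourfold
    sum.\<close>
  have d2: "d + d \<le> \<phi>" and d4: "(d + d) + (d + d) \<le> \<phi>" using \<phi> double d(1) by blast+
  have "0 < d" using pos d by blast
  have "d < \<phi>" using d2 \<open>0 < d\<close> by (metis add_strict_increasing less_le_trans order_refl add.commute)
  have e: "d \<le> \<phi> - d" "\<phi> - d < \<phi>" using d2 \<open>0 < d\<close> by (simp_all add: le_diff_eq)
  then have "\<psi> < \<phi> - d" using d by simp
  then have "D (\<phi> - d)"
    using const[of d "\<phi> - d"] gap[of d] gap[of "\<phi> - d"] d \<open>d < \<phi>\<close> e by blast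
  then have "(\<phi> - d) + (\<phi> - d) \<le> \<phi>" using \<phi> double by blast
  then have "\<phi> \<le> d + d" by (simp add: algebra_simps)
  also have "d + d < (d + d) + (d + d)" using \<open>0 < d\<close> by (simp add: add_pos_pos)
  also note d4
  finally show False by simp
qed

text \<open>The positive part is closed under doubling, so it contains all sufficiently large
  values; every \<delta> is a difference of two of them.\<close>

lemma value_subgroup_trivial:
  assumes def: "pdef (\<lambda>e. e 0 \<noteq> 0 \<and> D (v (e 0)))"
    and add: "\<And>\<alpha> \<beta>. D \<alpha> \<Longrightarrow> D \<beta> \<Longrightarrow> D (\<alpha> + \<beta>)" and minus: "\<And>\<alpha>. D \<alpha> \<Longrightarrow> D (- \<alpha>)"
    and \<gamma>: "D \<gamma>" "\<gamma> \<noteq> 0"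
  shows "D \<delta>"
proof -
  let ?D = "\<lambda>\<gamma>. 0 < \<gamma> \<and> D \<gamma>"
  have "pdef (\<lambda>e. (e 0 \<noteq> 0 \<and> D (v (e 0))) \<and> \<not> vle (e 0) 1)"
    by (intro pdef_conj def pdef_intros)
  then have "pdef (\<lambda>e. e 0 \<noteq> 0 \<and> ?D (v (e 0)))"
    by (rule pdef_cong) (auto simp: vle_def)
  moreover have "\<exists>\<gamma>. ?D \<gamma>"
    using \<gamma> minus[of \<gamma>] by (metis linorder_neqE neg_0_less_iff_less)
  ultimately have "\<exists>\<alpha>. \<forall>\<gamma>>\<alpha>. ?D \<gamma>"
    using add by (elim exE) (rule unbounded_if_doubling, auto intro: add_pos_pos)
  then obtain \<alpha> where \<alpha>: "\<And>\<gamma>. \<alpha> < \<gamma> \<Longrightarrow> D \<gamma>" by blast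
  obtain \<beta> where "\<alpha> < \<beta>" "\<alpha> - \<delta> < \<beta>" by (rule above)
  then have "D \<beta>" "D (\<delta> + \<beta>)" using \<alpha> by (simp_all add: diff_less_eq add.commute)
  then have "D ((\<delta> + \<beta>) + - \<beta>)" using add minus by blast
  then show ?thesis by simp
qed

text \<open>By genericity an infinite \<open>D\<close> contains every non-zero residue outside a
  finite set \<open>F\<close>. Any \<open>a\<close> is a product of two such: choose
  \<open>c\<close> with both \<open>c\<close> and \<open>a / c\<close> outside
  \<open>F\<close>.\<close>

lemma residue_subgroup_trivial:
  assumes def: "pdef (\<lambda>e. vunit (e 0) \<and> D (res (e 0)))"
    and D0: "\<And>a. D a \<Longrightarrow> a \<noteq> 0" and mult: "\<And>a b. D a \<Longrightarrow> D b \<Longrightarrow> D (a * b)"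
    and inf: "infinite {a. D a}" and "a \<noteq> 0"
  shows "D a"
proof -
  obtain F where "finite F" and F: "\<forall>x y. x \<in> \<O> \<longrightarrow> y \<in> \<O> \<longrightarrow> res x \<notin> F \<longrightarrow> res y \<notin> F \<longrightarrow>
    (vunit x \<and> D (res x) \<longleftrightarrow> vunit y \<and> D (res y))"
    using residue_classes[OF def] by (elim exE conjE)
  have "infinite ({a. D a} - F)" using inf \<open>finite F\<close> by (rule Diff_infinite_finite[rotated])
  then have "{a. D a} - F \<noteq> {}" by (rule infinite_imp_nonempty)
  then obtain b where "D b" "b \<notin> F" by blast
  obtain y where y: "vunit y" "res y = b" using D0[OF \<open>D b\<close>] by (rule res_vunit_surj)
  have D: "D c" if "c \<notin> F" "c \<noteq> 0" for c
  proof -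
    obtain x where "vunit x" "res x = c" using \<open>c \<noteq> 0\<close> by (rule res_vunit_surj)
    then show ?thesis
      using F[rule_format, of x y] y that \<open>D b\<close> \<open>b \<notin> F\<close> by (simp add: vunit_integral)
  qed
  have "finite (insert 0 F \<union> (\<lambda>c. a / c) ` F)" using \<open>finite F\<close> by simp
  then have "infinite (UNIV - (insert 0 F \<union> (\<lambda>c. a / c) ` F))"
    using infinite_RF by (intro Diff_infinite_finite)
  then have "UNIV - (insert 0 F \<union> (\<lambda>c. a / c) ` F) \<noteq> {}" by (rule infinite_imp_nonempty)
  then obtain c where c: "c \<noteq> 0" "c \<notin> F" "c \<notin> (\<lambda>c. a / c) ` F" by blast
  have "a / c \<notin> F"
  proof
    assume "a / c \<in> F"
    then have "a / (a / c) \<in> (\<lambda>c. a / c) ` F" by (rule imageI)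
    then show False using c \<open>a \<noteq> 0\<close> by simp
  qed
  then have "D (a / c * c)" using D c \<open>a \<noteq> 0\<close> by (intro mult D) auto
  then show ?thesis using c by simp
qed

definition mult_subgroup :: "('a \<Rightarrow> bool) \<Rightarrow> bool" where
  "mult_subgroup H \<longleftrightarrow> pdef (\<lambda>e. H (e 0)) \<and> \<not> H 0 \<and> H 1 \<and>
     (\<forall>x y. H x \<longrightarrow> H y \<longrightarrow> H (x * y)) \<and> (\<forall>x. H x \<longrightarrow> H (inverse x))"

lemma mult_subgroup_pdef: "mult_subgroup H \<Longrightarrow> pdef (\<lambda>e. H (e 0))"
  unfolding mult_subgroup_def by (elim conjE)

lemma mult_subgroupD:
  assumes "mult_subgroup H"
  shows "\<not> H 0" "H 1" "H x \<Longrightarrow> H y \<Longrightarrow> H (x * y)" "H x \<Longrightarrow> H (inverse x)"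
  using assms unfolding mult_subgroup_def by simp_all

lemma mult_subgroup_nz: "mult_subgroup H \<Longrightarrow> H x \<Longrightarrow> x \<noteq> 0"
  using mult_subgroupD(1)[of H] by (cases "x = 0") simp_all

lemma mult_subgroup_units: "mult_subgroup vunit" "mult_subgroup (\<lambda>x. x \<noteq> 0)"
  unfolding mult_subgroup_def
  by (auto intro!: pdef_intros simp: vunit_mult vunit_inverse) (auto simp: vunit_def)

text \<open>A generic residue class met by \<open>H\<close> shows that \<open>H\<close> contains all
  generic residue classes entirely. Every unit is a product of two units from generic classes; in
  particular the 1-units lie in \<open>H\<close>.\<close>

lemma units_subset_if_infinite:
  assumes H: "mult_subgroup H" and inf: "infinite (res ` {x. vunit x \<and> H x})" and "vunit u"
  shows "H u"
proof -
  let ?D = "\<lambda>a. a \<noteq> 0 \<and> (\<forall>x. vunit x \<longrightarrow> res x = a \<longrightarrow> H x)"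
  obtain F where "finite F" and F: "\<forall>x y. x \<in> \<O> \<longrightarrow> y \<in> \<O> \<longrightarrow> res x \<notin> F \<longrightarrow> res y \<notin> F \<longrightarrow> (H x \<longleftrightarrow> H y)"
    using residue_classes[OF mult_subgroup_pdef[OF H]] by (elim exE conjE)
  have "infinite (res ` {x. vunit x \<and> H x} - F)"
    using inf \<open>finite F\<close> by (rule Diff_infinite_finite[rotated])
  then have "res ` {x. vunit x \<and> H x} - F \<noteq> {}" by (rule infinite_imp_nonempty)
  then obtain y where y: "vunit y" "H y" "res y \<notin> F" by blast
  have in_H: "H x" if "vunit x" "res x \<notin> F" for x
    using F[rule_format, of x y] y that by (simp add: vunit_integral)
  have "finite (insert 0 F \<union> (\<lambda>c. res u / c) ` F)" using \<open>finite F\<close> by simp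
  then have "infinite (UNIV - (insert 0 F \<union> (\<lambda>c. res u / c) ` F))"
    using infinite_RF by (intro Diff_infinite_finite)
  then have "UNIV - (insert 0 F \<union> (\<lambda>c. res u / c) ` F) \<noteq> {}" by (rule infinite_imp_nonempty)
  then obtain c where c: "c \<noteq> 0" "c \<notin> F" "c \<notin> (\<lambda>c. res u / c) ` F" by blast
  obtain x where x: "vunit x" "res x = c" using c(1) by (rule res_vunit_surj)
  have "res u \<noteq> 0" using \<open>vunit u\<close> by (simp add: vunit_iff)
  have "res u / c \<notin> F"
  proof
    assume "res u / c \<in> F"
    then have "res u / (res u / c) \<in> (\<lambda>c. res u / c) ` F" by (rule imageI)
    then show False using c \<open>res u \<noteq> 0\<close> by simp
  qed
  then have "H (u / x)" "H x"
    using x c \<open>vunit u\<close> by (auto intro!: in_H simp: vunit_divide res_vunit_divide)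
  then have "H (u / x * x)" using H unfolding mult_subgroup_def by blast
  then show ?thesis using vunit_nz[OF x(1)] by simp
qed

text \<open>Containing the units, \<open>H\<close> is the preimage of a definable subgroup of
  \<Gamma>, which is non-zero because of \<open>y\<close>.\<close>

lemma subgroup_above_units:
  assumes H: "mult_subgroup H" and units: "\<And>x. vunit x \<Longrightarrow> H x"
    and y: "H y" "\<not> vunit y" and "x \<noteq> 0"
  shows "H x"
proof -
  note H' = mult_subgroupD(1,3,4)[OF H] and def = mult_subgroup_pdef[OF H]
    and nz = mult_subgroup_nz[OF H]
  let ?D = "\<lambda>\<gamma>. \<exists>x. H x \<and> v x = \<gamma>"
  have D: "?D (v x) \<longleftrightarrow> H x" if "x \<noteq> 0" for x
  proof
    assume "?D (v x)"
    then obtain z where z: "H z" "v z = v x" by blast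
    then have "vunit (x / z)" using that nz by (simp add: vunit_def v_divide)
    then have "H (x / z * z)" using units z H'(2) by blast
    then show "H x" using nz[OF z(1)] by simp
  qed blast
  have "pdef (\<lambda>e. e 0 \<noteq> 0 \<and> ?D (v (e 0)))"
    using def by (rule pdef_cong) (use D nz in blast)
  moreover have "?D (\<alpha> + \<beta>)" if ab: "?D \<alpha>" "?D \<beta>" for \<alpha> \<beta>
  proof -
    obtain a b where "H a" "v a = \<alpha>" "H b" "v b = \<beta>" using ab by blast
    then show ?thesis using H'(2) nz v_mult by (intro exI[of _ "a * b"]) simp
  qed
  moreover have "?D (- \<alpha>)" if "?D \<alpha>" for \<alpha>
    using that H'(3) nz v_inverse by blast
  moreover have "?D (v y)" "v y \<noteq> 0" using y nz by (auto simp: vunit_def)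
  ultimately have "?D (v x)" by (rule value_subgroup_trivial)
  then show ?thesis using D \<open>x \<noteq> 0\<close> by blast
qed

text \<open>If \<open>H\<close> contained a non-unit, the product of \<open>H\<close> with the units
  would be everything, so \<open>H\<close> would meet every shell. But a generic shell lies inside
  \<open>H\<close> or outside it, so \<open>H\<close> would contain some \<open>z\<close> together
  with \<open>u * z\<close>, and hence \<open>u\<close>.\<close>

lemma subgroup_within_units:
  assumes H: "mult_subgroup H" and u: "vunit u" "\<not> H u" and "H y"
  shows "vunit y"
proof (rule ccontr)
  assume "\<not> vunit y"
  note H' = mult_subgroupD[OF H] and def = mult_subgroup_pdef[OF H] and nz = mult_subgroup_nz[OF H]
  let ?H = "\<lambda>x. \<exists>z. H z \<and> vunit (x / z)"
  have "mult_subgroup ?H"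
    unfolding mult_subgroup_def
  proof (intro conjI allI impI)
    show "pdef (\<lambda>e. ?H (e 0))"
      by (intro pdef_ex pdef_conj def pdef_intros)
    show "\<not> ?H 0" by (simp add: vunit_def)
    show "?H 1" using H' by (intro exI[of _ 1]) simp
  next
    fix x y assume "?H x" "?H y"
    then obtain a b where "H a" "vunit (x / a)" "H b" "vunit (y / b)" by blast
    then show "?H (x * y)"
      using H' vunit_mult[of "x / a" "y / b"] by (intro exI[of _ "a * b"]) simp
  next
    fix x assume "?H x"
    then obtain a where "H a" "vunit (x / a)" by blast
    then show "?H (inverse x)"
      using H' vunit_inverse[of "x / a"] by (intro exI[of _ "inverse a"]) (simp add: divide_inverse mult.commute)
  qed
  moreover have "?H x" if "vunit x" for x using H'(2) that by (intro exI[of _ 1]) simp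
  moreover have "?H y" using \<open>H y\<close> nz by (intro exI[of _ y]) simp
  ultimately have all: "?H x" if "x \<noteq> 0" for x
    using \<open>\<not> vunit y\<close> that by (rule subgroup_above_units)
  obtain F where "finite F" and F: "\<forall>x y. x \<noteq> 0 \<longrightarrow> y \<noteq> 0 \<longrightarrow> v x \<notin> F \<longrightarrow> v y \<notin> F \<longrightarrow>
    (\<forall>\<gamma>\<in>F. \<gamma> < v x \<longleftrightarrow> \<gamma> < v y) \<longrightarrow> (H x \<longleftrightarrow> H y)"
    using shells[OF def] by (elim exE conjE)
  obtain \<gamma> where "\<gamma> \<notin> F" using \<open>finite F\<close> infinite_VG by (metis ex_new_if_finite)
  obtain x where x: "x \<noteq> 0" "v x = \<gamma>" by (rule v_surj)
  obtain z where z: "H z" "vunit (x / z)" using all[OF x(1)] by blast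
  then have "v z = \<gamma>" using x nz by (simp add: vunit_def v_divide)
  moreover have "v (u * z) = v z" "u * z \<noteq> 0" using u nz[OF z(1)] by (simp_all add: vunit_def v_mult)
  ultimately have "H (u * z)" using F[rule_format, of "u * z" z] z(1) nz \<open>\<gamma> \<notin> F\<close> by simp
  then have "H (u * z * inverse z)" using H' z by blast
  then have "H u" using nz[OF z(1)] by (simp add: mult.assoc)
  then show False using u(2) by simp
qed

text \<open>Setting \<open>F 0 = 0\<close> makes \<open>F\<close> a total definable function and
  multiplicativity unconditional.\<close>

definition definable_endo :: "('a \<Rightarrow> 'a) \<Rightarrow> bool" where
  "definable_endo F \<longleftrightarrow> tdef (\<lambda>e. F (e 0)) \<and> F 0 = 0 \<and> (\<forall>x. x \<noteq> 0 \<longrightarrow> F x \<noteq> 0) \<and>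
     (\<forall>x y. F (x * y) = F x * F y)"

lemma definable_endo_tdef: "definable_endo F \<Longrightarrow> tdef (\<lambda>e. F (e 0))"
  unfolding definable_endo_def by (elim conjE)

lemma tdef_endo: "definable_endo F \<Longrightarrow> tdef t \<Longrightarrow> tdef (\<lambda>e. F (t e))"
  by (rule tdef_fun1[OF definable_endo_tdef])

lemma endo_mult: "definable_endo F \<Longrightarrow> F (x * y) = F x * F y"
  unfolding definable_endo_def by blast

lemma endo_nz: "definable_endo F \<Longrightarrow> F x = 0 \<longleftrightarrow> x = 0"
  unfolding definable_endo_def by blast

lemma endo_0: "definable_endo F \<Longrightarrow> F 0 = 0"
  unfolding definable_endo_def by blast

lemma endo_1: "definable_endo F \<Longrightarrow> F 1 = 1"
  using endo_mult[of F 1 1] endo_nz[of F 1] by simp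

lemma endo_inverse: "definable_endo F \<Longrightarrow> F (inverse x) = inverse (F x)"
  using endo_mult[of F x "inverse x"] endo_1[of F] endo_nz[of F 0]
  by (cases "x = 0") (simp_all add: inverse_unique)

lemma endo_divide: "definable_endo F \<Longrightarrow> F (x / y) = F x / F y"
  by (simp add: divide_inverse endo_mult endo_inverse)

lemma endo_power: "definable_endo F \<Longrightarrow> F (x ^ n) = F x ^ n"
  by (induction n) (simp_all add: endo_1 endo_mult)

lemma definable_endo_divide:
  "definable_endo F \<Longrightarrow> definable_endo G \<Longrightarrow> definable_endo (\<lambda>x. F x / G x)"
  unfolding definable_endo_def by (elim conjE, intro conjI tdef_divide) simp_all

lemma mult_subgroup_vimage:
  assumes F: "definable_endo F" and H: "mult_subgroup H"
  shows "mult_subgroup (\<lambda>x. H (F x))"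
proof -
  have "pdef (\<lambda>e. H (F (e 0)))"
    by (rule pdef_term1[OF mult_subgroup_pdef[OF H] tdef_endo[OF F tdef_var]])
  then show ?thesis
    unfolding mult_subgroup_def endo_mult[OF F] endo_inverse[OF F] endo_1[OF F] endo_0[OF F]
    using mult_subgroupD[OF H] by blast
qed

lemma mult_subgroup_one_unit: "mult_subgroup one_unit"
  unfolding mult_subgroup_def
proof (intro conjI allI impI)
  show "pdef (\<lambda>e. one_unit (e 0))" by (intro pdef_intros)
  show "\<not> one_unit 0" by (simp add: one_unit_iff vunit_def)
  show "one_unit 1" by (simp add: one_unit_def)
qed (simp_all add: one_unit_iff vunit_mult vunit_inverse res_vunit_mult res_vunit_inverse)

lemma mult_subgroup_1: "mult_subgroup (\<lambda>x. x = 1)"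
  unfolding mult_subgroup_def
proof (intro conjI allI impI)
  show "pdef (\<lambda>e. e 0 = 1)" by (intro pdef_intros)
qed simp_all

end

section \<open>Definable endomorphisms of the multiplicative group\<close>

text \<open>Take a root of 1 + X + ... + X^(n-1). It is not 1, where this polynomial has the value
  \<open>of_nat n\<close>.\<close>

lemma nontrivial_root_of_unity:
  assumes "of_nat n \<noteq> (0 :: 'a::alg_closed_field)" "1 < n"
  obtains \<zeta> where "\<zeta> \<noteq> 1" "\<zeta> ^ n = (1 :: 'a::alg_closed_field)"
proof -
  let ?p = "\<Sum>i<n. monom 1 i :: 'a poly"
  have "coeff ?p (n - 1) \<noteq> 0" using assms by (simp add: coeff_sum)
  then have "n - 1 \<le> degree ?p" by (rule le_degree)
  then have "0 < degree ?p" using assms by simp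
  then obtain \<zeta> where "poly ?p \<zeta> = 0" using alg_closed_imp_poly_has_root by blast
  then have sum: "(\<Sum>i<n. \<zeta> ^ i) = 0" by (simp add: poly_sum poly_monom)
  then have "\<zeta> \<noteq> 1" using assms by auto
  moreover have "\<zeta> ^ n = 1" using power_diff_1_eq[of \<zeta> n] sum by simp
  ultimately show ?thesis using that by blast
qed

section \<open>Behaviour of an endomorphism on units, values and residues\<close>

context C_minimal_valued_field
begin

lemma root_exists:
  assumes "0 < n" obtains y :: 'a where "y ^ n = x"
  using nth_root_exists[OF assms] by blast

lemma vunit_root:
  assumes "0 < n" "vunit x" obtains y where "vunit y" "y ^ n = x"
proof -
  obtain y where y: "y ^ n = x" using root_exists[OF assms(1)] by blast
  then have "y \<noteq> 0" using assms vunit_nz[of x] by (cases "y = 0") auto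
  then have "vunit y" using y assms v_power_eq_0[of y n] by (simp add: vunit_def)
  then show ?thesis using y that by blast
qed

text \<open>The residues of the values of \<open>F\<close> on \<open>W\<close> form a group. If it
  is finite, divisibility of \<open>W\<close> makes every element a power that is 1; if it is
  infinite, \<open>residue_subgroup_trivial\<close> makes it everything. It is needed for
  \<open>W\<close> the units and for \<open>W\<close> all non-zero elements.\<close>

lemma residue_endo_trivial_or_surj:
  assumes W: "mult_subgroup W" and div: "\<And>n x. 0 < n \<Longrightarrow> W x \<Longrightarrow> \<exists>y. W y \<and> y ^ n = x"
    and F: "definable_endo F" and units: "\<And>x. W x \<Longrightarrow> vunit (F x)"
  shows "(\<forall>x. W x \<longrightarrow> res (F x) = 1) \<or> (\<forall>a. a \<noteq> 0 \<longrightarrow> (\<exists>x. W x \<and> res (F x) = a))"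
proof (cases "finite {a. \<exists>x. W x \<and> res (F x) = a}")
  case True
  let ?C = "{a. \<exists>x. W x \<and> res (F x) = a}"
  have "a * b \<in> ?C" if ab: "a \<in> ?C" "b \<in> ?C" for a b
  proof -
    obtain x y where "W x" "res (F x) = a" "W y" "res (F y) = b" using ab by blast
    then have "W (x * y)" "res (F (x * y)) = a * b"
      using mult_subgroupD(3)[OF W] units by (simp_all add: endo_mult[OF F] res_vunit_mult)
    then show ?thesis by blast
  qed
  moreover have "0 \<notin> ?C" using units by (auto simp: vunit_iff)
  ultimately have pow: "a ^ card ?C = 1" if "a \<in> ?C" for a
    using True that by (intro finite_mult_closed_power)
  have "1 \<in> ?C" using mult_subgroupD(2)[OF W] endo_1[OF F] by (auto intro!: exI[of _ 1])
  then have "0 < card ?C" using True by (auto simp: card_gt_0_iff)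
  have "res (F x) = 1" if "W x" for x
  proof -
    obtain y where "W y" "y ^ card ?C = x" using div[OF \<open>0 < card ?C\<close> \<open>W x\<close>] by blast
    then have "res (F x) = res (F y) ^ card ?C"
      using units[of y] by (auto simp: endo_power[OF F] res_power vunit_integral)
    also have "\<dots> = 1" using \<open>W y\<close> by (intro pow) blast
    finally show ?thesis .
  qed
  then show ?thesis by blast
next
  case False
  let ?D = "\<lambda>a. \<exists>x. W x \<and> res (F x) = a"
  have "?D a" if "a \<noteq> 0" for a
  proof (rule residue_subgroup_trivial[of ?D])
    have "pdef (\<lambda>e. \<exists>x. W x \<and> vunit (e 0) \<and> one_unit (e 0 / F x))"
      by (intro pdef_ex pdef_conj mult_subgroup_pdef[OF W] pdef_vunit pdef_one_unit tdef_divide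
          tdef_endo[OF F] tdef_var)
    then show "pdef (\<lambda>e. vunit (e 0) \<and> ?D (res (e 0)))"
    proof (rule pdef_cong)
      fix e :: "nat \<Rightarrow> 'a"
      have "one_unit (e 0 / F x) \<longleftrightarrow> res (F x) = res (e 0)" if "W x" "vunit (e 0)" for x
      proof -
        have "res (F x) \<noteq> 0" using units[OF that(1)] by (simp add: vunit_iff)
        then show ?thesis
          using that units[OF that(1)] by (auto simp: one_unit_iff vunit_divide res_vunit_divide)
      qed
      then show "vunit (e 0) \<and> ?D (res (e 0))
          \<longleftrightarrow> (\<exists>x. W x \<and> vunit (e 0) \<and> one_unit (e 0 / F x))"
        by blast
    qed
  next
    fix a b assume "?D a" "?D b"
    then obtain x y where "W x" "res (F x) = a" "W y" "res (F y) = b" by blast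
    then have "W (x * y)" "res (F (x * y)) = a * b"
      using mult_subgroupD(3)[OF W] units by (simp_all add: endo_mult[OF F] res_vunit_mult)
    then show "?D (a * b)" by blast
  qed (use units False that in \<open>auto simp: vunit_iff\<close>)
  then show ?thesis by blast
qed

text \<open>Integrality of \<open>F y\<close> holds on all generic residue classes or on none.
  Comparing a generic \<open>y\<close> with \<open>inverse y\<close>, whose residue is generic too,
  forces \<open>v (F y) = 0\<close>. So the preimage of the units meets infinitely many residue
  classes of units.\<close>

lemma endo_vunit:
  assumes F: "definable_endo F" and "vunit x"
  shows "vunit (F x)"
proof -
  let ?P = "\<lambda>x. vle 1 (F x)"
  have "pdef (\<lambda>e. ?P (e 0))" by (intro pdef_vle tdef_endo[OF F] tdef_var tdef_const)
  from residue_classes[of ?P, OF this] obtain R where "finite R" and R: "\<forall>x y. x \<in> \<O> \<longrightarrow> y \<in> \<O> \<longrightarrow> res x \<notin> R \<longrightarrow> res y \<notin> R \<longrightarrow> (?P x \<longleftrightarrow> ?P y)"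
    by (elim exE conjE)
  let ?R = "insert 0 R \<union> inverse ` R"
  have "finite ?R" using \<open>finite R\<close> by simp
  have generic: "vunit (F y)" if "vunit y" "res y \<notin> ?R" for y
  proof -
    have "res (inverse y) \<notin> R"
    proof
      assume "res (inverse y) \<in> R"
      then have "inverse (res (inverse y)) \<in> inverse ` R" by (rule imageI)
      then show False using that by (simp add: res_vunit_inverse)
    qed
    then have "?P y \<longleftrightarrow> ?P (inverse y)"
      using R[rule_format, of y "inverse y"] that by (simp add: vunit_integral vunit_inverse)
    moreover have "F y \<noteq> 0" using vunit_nz[OF that(1)] endo_nz[OF F] by simp
    ultimately show ?thesis
      by (auto simp: vle_def endo_inverse[OF F] v_inverse vunit_def)
  qed
  have "infinite (UNIV - ?R)" using infinite_RF \<open>finite ?R\<close> by (intro Diff_infinite_finite)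
  moreover have "UNIV - ?R \<subseteq> res ` {x. vunit x \<and> vunit (F x)}"
  proof
    fix a assume a: "a \<in> UNIV - ?R"
    then have "a \<noteq> 0" by simp
    then obtain y where "vunit y" "res y = a" by (rule res_vunit_surj)
    then show "a \<in> res ` {x. vunit x \<and> vunit (F x)}" using generic a by auto
  qed
  ultimately have "infinite (res ` {x. vunit x \<and> vunit (F x)})" using finite_subset by blast
  from units_subset_if_infinite[OF mult_subgroup_vimage[OF F mult_subgroup_units(1)] this \<open>vunit x\<close>]
  show ?thesis .
qed

lemma residue_endo_on_units:
  assumes F: "definable_endo F"
  shows "(\<forall>x. vunit x \<longrightarrow> res (F x) = 1) \<or> (\<forall>a. a \<noteq> 0 \<longrightarrow> (\<exists>x. vunit x \<and> res (F x) = a))"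
proof (rule residue_endo_trivial_or_surj[OF mult_subgroup_units(1) _ F endo_vunit[OF F]])
  fix n x assume "0 < (n :: nat)" "vunit x"
  then obtain y where "vunit y" "y ^ n = x" by (rule vunit_root)
  then show "\<exists>y. vunit y \<and> y ^ n = x" by blast
qed

text \<open>The preimage of the units contains the units, so it is exactly the units or
  everything.\<close>

lemma endo_value_dichotomy:
  assumes F: "definable_endo F"
  shows "(\<forall>x. x \<noteq> 0 \<longrightarrow> vunit (F x)) \<or> (\<forall>x. vunit (F x) \<longleftrightarrow> vunit x)"
proof (cases "\<exists>y. vunit (F y) \<and> \<not> vunit y")
  case True
  then obtain y where y: "vunit (F y)" "\<not> vunit y" by blast
  show ?thesis
    using subgroup_above_units[OF mult_subgroup_vimage[OF F mult_subgroup_units(1)] endo_vunit[OF F] y]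
    by blast
next
  case False
  then show ?thesis using endo_vunit[OF F] by blast
qed

text \<open>The values taken by \<open>F\<close> form a definable subgroup of \<Gamma>, and
  \<open>y\<close> makes it non-zero.\<close>

lemma endo_value_surj:
  assumes F: "definable_endo F" and y: "y \<noteq> 0" "\<not> vunit (F y)"
  shows "\<exists>x. x \<noteq> 0 \<and> v (F x) = \<gamma>"
proof (rule value_subgroup_trivial)
  have "pdef (\<lambda>e. \<exists>x. x \<noteq> 0 \<and> vunit (e 0 / F x))"
    by (intro pdef_intros tdef_endo[OF F])
  then show "pdef (\<lambda>e. e 0 \<noteq> 0 \<and> (\<exists>x. x \<noteq> 0 \<and> v (F x) = v (e 0)))"
  proof (rule pdef_cong)
    fix e :: "nat \<Rightarrow> 'a"
    have "vunit (e 0 / F x) \<longleftrightarrow> e 0 \<noteq> 0 \<and> v (F x) = v (e 0)" if "x \<noteq> 0" for x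
      using that endo_nz[OF F, of x] by (cases "e 0 = 0") (auto simp: vunit_def v_divide)
    then show "e 0 \<noteq> 0 \<and> (\<exists>x. x \<noteq> 0 \<and> v (F x) = v (e 0)) \<longleftrightarrow> (\<exists>x. x \<noteq> 0 \<and> vunit (e 0 / F x))"
      by blast
  qed
next
  fix \<alpha> \<beta> assume "\<exists>x. x \<noteq> 0 \<and> v (F x) = \<alpha>" "\<exists>x. x \<noteq> 0 \<and> v (F x) = \<beta>"
  then obtain a b where "a \<noteq> 0" "v (F a) = \<alpha>" "b \<noteq> 0" "v (F b) = \<beta>" by blast
  then show "\<exists>x. x \<noteq> 0 \<and> v (F x) = \<alpha> + \<beta>"
    using endo_nz[OF F] by (intro exI[of _ "a * b"]) (simp add: endo_mult[OF F] v_mult)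
next
  fix \<alpha> assume "\<exists>x. x \<noteq> 0 \<and> v (F x) = \<alpha>"
  then obtain a where "a \<noteq> 0" "v (F a) = \<alpha>" by blast
  then show "\<exists>x. x \<noteq> 0 \<and> v (F x) = - \<alpha>"
    using endo_nz[OF F] by (intro exI[of _ "inverse a"]) (simp add: endo_inverse[OF F] v_inverse)
next
  show "v (F y) \<noteq> 0" "\<exists>x. x \<noteq> 0 \<and> v (F x) = v (F y)"
    using y endo_nz[OF F, of y] by (auto simp: vunit_def)
qed

text \<open>Otherwise \<open>F\<close> would induce a definable section of \<open>v\<close> modulo \<open>1\<close>-units, whose image meets every
  shell without containing it.\<close>

lemma value_trivial_if_residue_trivial:
  assumes F: "definable_endo F" and triv: "\<And>x. vunit x \<Longrightarrow> res (F x) = 1" and "x \<noteq> 0"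
  shows "vunit (F x)"
proof (rule ccontr)
  assume no: "\<not> vunit (F x)"
  then have ker: "vunit (F z) \<longleftrightarrow> vunit z" for z
    using endo_value_dichotomy[OF F] \<open>x \<noteq> 0\<close> by blast
  let ?X = "\<lambda>y. \<exists>z. z \<noteq> 0 \<and> one_unit (y / F z)"
  have "pdef (\<lambda>e. ?X (e 0))" by (intro pdef_intros tdef_endo[OF F])
  from shells[of ?X, OF this] obtain S where "finite S" and S: "\<forall>x y. x \<noteq> 0 \<longrightarrow> y \<noteq> 0 \<longrightarrow> v x \<notin> S \<longrightarrow> v y \<notin> S \<longrightarrow>
    (\<forall>\<gamma>\<in>S. \<gamma> < v x \<longleftrightarrow> \<gamma> < v y) \<longrightarrow> (?X x \<longleftrightarrow> ?X y)"
    by (elim exE conjE)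
  obtain \<gamma> where "\<gamma> \<notin> S" using \<open>finite S\<close> infinite_VG by (metis ex_new_if_finite)
  obtain y where y: "y \<noteq> 0" "v (F y) = \<gamma>" using endo_value_surj[OF F \<open>x \<noteq> 0\<close> no, of \<gamma>] by blast
  have "infinite (UNIV - {0, 1 :: 'k})" using infinite_RF by (intro Diff_infinite_finite) simp_all
  then have "UNIV - {0, 1 :: 'k} \<noteq> {}" by (rule infinite_imp_nonempty)
  \<comment> \<open>Multiplying \<open>F y\<close> by a unit with this residue stays in the generic
    shell, so the result is still \<open>F z\<close> up to a 1-unit. Then \<open>F (y / z)\<close>
    is a unit, so \<open>y / z\<close> is a unit and \<open>F (y / z)\<close> has residue 1, forcing
    \<open>c = 1\<close>.\<close>
  then obtain c :: 'k where "c \<noteq> 0" "c \<noteq> 1" by blast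
  then obtain u where u: "vunit u" "res u = c" using res_vunit_surj by blast
  have nz: "F y \<noteq> 0" "u \<noteq> 0" using y endo_nz[OF F] vunit_nz[OF u(1)] by simp_all
  then have "v (F y * u) = \<gamma>" using u y by (simp add: v_mult vunit_def)
  moreover have "?X (F y)" using y nz by (intro exI[of _ y]) (simp add: one_unit_def)
  ultimately have "?X (F y * u)" using S[rule_format, of "F y" "F y * u"] y nz \<open>\<gamma> \<notin> S\<close> by simp
  then obtain z where z: "z \<noteq> 0" "one_unit (F y * u / F z)" by blast
  have eq: "F y * u / F z = F (y / z) * u" by (simp add: endo_divide[OF F])
  then have "vunit (F (y / z) * u)" using z by (simp add: one_unit_iff)
  then have "vunit (F (y / z) * u / u)" using u by (intro vunit_divide)
  then have "vunit (F (y / z))" using nz by simp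
  then have "res (F (y / z)) = 1" using ker triv by blast
  then have "res (F (y / z) * u) = c" using \<open>vunit (F (y / z))\<close> u by (simp add: res_vunit_mult)
  then show False using z eq \<open>c \<noteq> 1\<close> by (simp add: one_unit_iff)
qed

text \<open>If \<open>w \<noteq> 1\<close>, the sum of the powers of \<open>w\<close> below
  \<open>n\<close> vanishes, although its residue is \<open>of_nat n\<close>.\<close>

lemma one_unit_torsion:
  assumes "one_unit w" "w ^ n = 1" "of_nat n \<noteq> (0 :: 'k)"
  shows "w = 1"
proof (rule ccontr)
  assume "w \<noteq> 1"
  have w: "w \<in> \<O>" "res w = 1" using assms(1) by (simp_all add: one_unit_iff vunit_integral)
  have sum: "(\<Sum>i<n. w ^ i) = 0" using power_diff_1_eq[of w n] assms(2) \<open>w \<noteq> 1\<close> by simp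
  have "(\<Sum>i<m. w ^ i) \<in> \<O> \<and> res (\<Sum>i<m. w ^ i) = of_nat m" for m
    using w by (induction m) (simp_all add: integral_add integral_power res_add res_power)
  from this[of n] show False using sum assms(3) by simp
qed

lemma of_nat_residue_nz: "of_nat n \<noteq> (0 :: 'k) \<Longrightarrow> of_nat n \<noteq> (0 :: 'a)"
proof
  have "of_nat m \<in> \<O> \<and> res (of_nat m) = of_nat m" for m
    by (induction m) (simp_all add: integral_add res_add)
  from this[of n] show "of_nat n \<noteq> (0 :: 'k) \<Longrightarrow> of_nat n = (0 :: 'a) \<Longrightarrow> False" by simp
qed

text \<open>Let \<open>?K\<close> be the preimage of the 1-units. If it missed a unit, it would
  consist of units, and \<open>res\<close> after \<open>F\<close> would be onto already on the
  units; then a non-unit would share its image with a unit, and their quotient would be a non-unit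
  in \<open>?K\<close>. If it contained the units without being everything, it would equal them,
  making \<Gamma> isomorphic to the multiplicative group of k; but \<Gamma> is torsion-free and the
  latter has torsion.\<close>

lemma residue_trivial_if_value_trivial:
  assumes F: "definable_endo F" and units: "\<And>x. x \<noteq> 0 \<Longrightarrow> vunit (F x)" and "x \<noteq> 0"
  shows "one_unit (F x)"
proof -
  let ?K = "\<lambda>x. one_unit (F x)"
  have K: "mult_subgroup ?K" by (rule mult_subgroup_vimage[OF F mult_subgroup_one_unit])
  have K_iff: "?K x \<longleftrightarrow> res (F x) = 1" if "x \<noteq> 0" for x using units[OF that] by (simp add: one_unit_iff)
  have divide: "?K (x / y)" if "res (F x) = res (F y)" "x \<noteq> 0" "y \<noteq> 0" for x y
    using that units[of x] units[of y]
    by (simp add: endo_divide[OF F] one_unit_iff vunit_divide res_vunit_divide) (simp add: vunit_iff)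
  have K_units: "?K u" if "vunit u" for u
  proof (rule ccontr)
    assume "\<not> ?K u"
    then have KU: "vunit y" if "?K y" for y using subgroup_within_units[OF K \<open>vunit u\<close>] that by blast
    have "\<not> (\<forall>x. vunit x \<longrightarrow> res (F x) = 1)"
      using \<open>\<not> ?K u\<close> K_iff \<open>vunit u\<close> vunit_nz by blast
    moreover note residue_endo_on_units[OF F]
    ultimately have surj: "\<exists>x. vunit x \<and> res (F x) = a" if "a \<noteq> 0" for a using that by blast
    obtain t where t: "t \<noteq> 0" "0 < v t" by (rule nontrivial)
    have "res (F t) \<noteq> 0" using units[OF t(1)] by (simp add: vunit_iff)
    then obtain w where w: "vunit w" "res (F w) = res (F t)" using surj by blast
    then have "vunit (t / w)" using divide[of t w] t vunit_nz by (intro KU) simp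
    then have "vunit (t / w * w)" using w by (intro vunit_mult)
    then show False using vunit_nz[OF w(1)] t by (simp add: vunit_def)
  qed
  show ?thesis
  proof (rule ccontr)
    assume no: "\<not> ?K x"
    have KU: "vunit y" if "?K y" for y
      using subgroup_above_units[OF K K_units that] no \<open>x \<noteq> 0\<close> by blast
    have "(\<forall>x. x \<noteq> 0 \<longrightarrow> res (F x) = 1) \<or> (\<forall>a. a \<noteq> 0 \<longrightarrow> (\<exists>x. x \<noteq> 0 \<and> res (F x) = a))"
    proof (rule residue_endo_trivial_or_surj[OF mult_subgroup_units(2) _ F units])
      fix n x assume "0 < (n :: nat)" "x \<noteq> (0 :: 'a)"
      then show "\<exists>y. y \<noteq> 0 \<and> y ^ n = x" using root_exists[of n x] by (metis power_eq_0_iff)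
    qed
    then have surj: "\<exists>x. x \<noteq> 0 \<and> res (F x) = a" if "a \<noteq> 0" for a using that no K_iff \<open>x \<noteq> 0\<close> by blast
    \<comment> \<open>A small order that is non-zero in k, so that a non-trivial root of unity of
      this order has non-trivial residue.\<close>
    define n where "n = (if of_nat 2 = (0 :: 'k) then 3 else 2 :: nat)"
    have n: "of_nat n \<noteq> (0 :: 'k)" "1 < n"
    proof -
      have "(3 :: 'k) - 2 = 1" by simp
      then have "(3 :: 'k) \<noteq> 0" if "(2 :: 'k) = 0" using that by fastforce
      then show "of_nat n \<noteq> (0 :: 'k)" "1 < n" by (auto simp: n_def)
    qed
    obtain \<zeta> :: 'a where \<zeta>: "\<zeta> \<noteq> 1" "\<zeta> ^ n = 1"
      using nontrivial_root_of_unity[OF of_nat_residue_nz[OF n(1)] n(2)] .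
    have "\<zeta> \<noteq> 0" using \<zeta> n by (cases "\<zeta> = 0") (auto simp: power_0_left)
    then have "vunit \<zeta>" using v_power_eq_0[of \<zeta> n] \<zeta> n by (simp add: vunit_def)
    then have "res \<zeta> \<noteq> 0" by (simp add: vunit_iff)
    then obtain y where y: "y \<noteq> 0" "res (F y) = res \<zeta>" using surj by blast
    have "res (F (y ^ n)) = res (\<zeta> ^ n)"
      using y units[OF y(1)] \<open>vunit \<zeta>\<close> by (simp add: endo_power[OF F] res_power vunit_integral)
    then have "?K (y ^ n)" using \<zeta> K_iff[of "y ^ n"] y by simp
    then have "vunit y" using KU[of "y ^ n"] v_power_eq_0[of y n] y n by (simp add: vunit_def)
    then have "res \<zeta> = 1" using K_units[of y] y by (simp add: one_unit_iff)
    then have "\<zeta> = 1" using \<open>vunit \<zeta>\<close> \<zeta> n by (intro one_unit_torsion[of \<zeta> n]) (simp_all add: one_unit_iff)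
    then show False using \<zeta> by simp
  qed
qed

text \<open>Torsion of order prime to the residue characteristic lies in the kernel and meets infinitely
  many residue classes.\<close>

lemma endo_trivial_on_units:
  assumes F: "definable_endo F" and one_units: "\<And>x. x \<noteq> 0 \<Longrightarrow> one_unit (F x)" and "vunit u"
  shows "F u = 1"
proof -
  let ?H = "\<lambda>x. F x = 1"
  let ?C = "res ` {x. vunit x \<and> ?H x}"
  have H: "mult_subgroup ?H" by (rule mult_subgroup_vimage[OF F mult_subgroup_1])
  have "infinite ?C"
  proof
    assume fin: "finite ?C"
    have closed: "a * b \<in> ?C" if ab: "a \<in> ?C" "b \<in> ?C" for a b
    proof -
      obtain x y where "vunit x" "F x = 1" "a = res x" "vunit y" "F y = 1" "b = res y"
        using ab by blast
      then show ?thesis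
        by (intro image_eqI[of _ _ "x * y"]) (simp_all add: res_vunit_mult vunit_mult endo_mult[OF F])
    qed
    have "0 \<notin> ?C" by (auto simp: vunit_iff)
    with fin have pow: "a ^ card ?C = 1" if "a \<in> ?C" for a
      using closed that by (rule finite_mult_closed_power)
    have "1 \<in> ?C" by (intro image_eqI[of _ _ 1]) (simp_all add: endo_1[OF F])
    then have c: "0 < card ?C" using fin by (auto simp: card_gt_0_iff)
    define N where "N = char_exponent TYPE('k)"
    have N: "N = 1 \<and> CHAR('k) = 0 \<or> N = CHAR('k) \<and> 0 < N" by (simp add: N_def char_exponent_def)
    \<comment> \<open>This is congruent to 1 modulo the residue characteristic, so roots of unity of
      order \<open>l\<close> exist and survive reduction. It is also congruent to 1 modulo
      \<open>card ?C\<close>: if \<zeta> is killed by \<open>F\<close>, its residue satisfies both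
      \<open>a ^ card ?C = 1\<close> and \<open>a ^ l = 1\<close>, hence is 1.\<close>
    define l where "l = card ?C * N + 1"
    have "1 < l" using c N by (auto simp: l_def)
    have l: "of_nat l \<noteq> (0 :: 'k)"
    proof -
      have "CHAR('k) = 0 \<Longrightarrow> ?thesis" using \<open>1 < l\<close> by (simp add: of_nat_eq_0_iff_char_dvd)
      moreover have "N = CHAR('k) \<Longrightarrow> ?thesis" by (simp add: l_def)
      ultimately show ?thesis using N by argo
    qed
    obtain \<zeta> :: 'a where \<zeta>: "\<zeta> \<noteq> 1" "\<zeta> ^ l = 1"
      using nontrivial_root_of_unity[OF of_nat_residue_nz[OF l] \<open>1 < l\<close>] .
    have "\<zeta> \<noteq> 0" using \<zeta> \<open>1 < l\<close> by (cases "\<zeta> = 0") (auto simp: power_0_left)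
    then have "vunit \<zeta>" using v_power_eq_0[of \<zeta> l] \<zeta> \<open>1 < l\<close> by (simp add: vunit_def)
    have "F \<zeta> ^ l = 1" using \<zeta> by (simp add: endo_1[OF F] flip: endo_power[OF F])
    then have "F \<zeta> = 1" by (rule one_unit_torsion[OF one_units[OF \<open>\<zeta> \<noteq> 0\<close>] _ l])
    then have "res \<zeta> ^ card ?C = 1" using \<open>vunit \<zeta>\<close> by (intro pow image_eqI[of _ _ \<zeta>]) simp_all
    then have "res \<zeta> ^ l = res \<zeta>" by (simp add: l_def power_mult)
    then have "res \<zeta> = 1" using \<zeta> \<open>vunit \<zeta>\<close> by (simp add: vunit_integral flip: res_power)
    then have "\<zeta> = 1" using \<open>vunit \<zeta>\<close> \<zeta> l by (intro one_unit_torsion[of \<zeta> l]) (simp_all add: one_unit_iff)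
    then show False using \<zeta> by simp
  qed
  then show ?thesis using units_subset_if_infinite[OF H] \<open>vunit u\<close> by blast
qed

text \<open>Closure under products comes from \<open>x * y - 1 = x * (y - 1) + (x - 1)\<close>. The
  condition \<open>one_unit\<close> keeps the ball inside the 1-units even when
  \<open>v \<epsilon> \<le> 0\<close>.\<close>

lemma one_unit_ball_subgroup:
  assumes "\<epsilon> \<noteq> 0"
  shows "mult_subgroup (\<lambda>x. one_unit x \<and> (x = 1 \<or> v \<epsilon> \<le> v (x - 1)))"
proof -
  let ?B = "\<lambda>x. one_unit x \<and> (x = 1 \<or> v \<epsilon> \<le> v (x - 1))"
  have "pdef (\<lambda>e. one_unit (e 0) \<and> vle \<epsilon> (e 0 - 1))" by (intro pdef_intros)
  then have "pdef (\<lambda>e. ?B (e 0))" by (rule pdef_cong) (use assms in \<open>auto simp: vle_def\<close>)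
  moreover have "?B (x * y)" if x: "?B x" and y: "?B y" for x y
  proof -
    have "one_unit (x * y)" using x y mult_subgroupD(3)[OF mult_subgroup_one_unit] by blast
    moreover have "v \<epsilon> \<le> v (x * y - 1)" if "x \<noteq> 1" "y \<noteq> 1" "x * y \<noteq> 1"
    proof -
      have vx: "x \<noteq> 0" "v x = 0" using x by (simp_all add: one_unit_iff vunit_def)
      have eq: "x * y - 1 = x * (y - 1) + (x - 1)" by (simp add: algebra_simps)
      have "v (x * (y - 1)) = v (y - 1)" using that vx by (simp add: v_mult)
      then have "v \<epsilon> \<le> min (v (x * (y - 1))) (v (x - 1))" using x y that by simp
      also have "\<dots> \<le> v (x * y - 1)" using v_add[of "x * (y - 1)" "x - 1"] that vx unfolding eq[symmetric] by simp
      finally show ?thesis .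
    qed
    ultimately show ?thesis using x y by (cases "x = 1"; cases "y = 1") auto
  qed
  moreover have "?B (inverse x)" if x: "?B x" for x
  proof -
    have "one_unit (inverse x)" using x mult_subgroupD(4)[OF mult_subgroup_one_unit] by blast
    moreover have "v (inverse x - 1) = v (x - 1)" if "x \<noteq> 1"
    proof -
      have vx: "x \<noteq> 0" "v x = 0" using x by (simp_all add: one_unit_iff vunit_def)
      then have "inverse x - 1 = (1 - x) / x" by (simp add: field_simps)
      then show ?thesis using vx that by (simp add: v_divide v_diff_commute)
    qed
    ultimately show ?thesis using x by (cases "x = 1") auto
  qed
  moreover have "\<not> ?B 0" "?B 1" using mult_subgroupD(1,2)[OF mult_subgroup_one_unit] by simp_all
  ultimately show ?thesis unfolding mult_subgroup_def by blast
qed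

theorem endo_trivial_if_value_trivial:
  assumes F: "definable_endo F" and units: "\<And>x. x \<noteq> 0 \<Longrightarrow> vunit (F x)" and "x \<noteq> 0"
  shows "F x = 1"
proof (rule ccontr)
  assume "F x \<noteq> 1"
  note one_units = residue_trivial_if_value_trivial[OF F units]
  have H: "mult_subgroup (\<lambda>x. F x = 1)" by (rule mult_subgroup_vimage[OF F mult_subgroup_1])
  note triv = endo_trivial_on_units[OF F one_units]
  have ker: "vunit y" if "F y = 1" for y
    using subgroup_above_units[OF H triv that] \<open>F x \<noteq> 1\<close> \<open>x \<noteq> 0\<close> by blast
  let ?Y = "\<lambda>y. \<exists>z. z \<noteq> 0 \<and> y = F z"
  \<comment> \<open>A finite image has finite exponent, and \<open>x\<close> is a power with that
    exponent, so \<open>F x\<close> would be 1.\<close>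
  have "infinite {y. ?Y y}"
  proof
    assume fin: "finite {y. ?Y y}"
    have "0 \<notin> {y. ?Y y}" using endo_nz[OF F] by auto
    moreover have "a * b \<in> {y. ?Y y}" if ab: "a \<in> {y. ?Y y}" "b \<in> {y. ?Y y}" for a b
    proof -
      obtain y z where "y \<noteq> 0" "a = F y" "z \<noteq> 0" "b = F z" using ab by blast
      then show ?thesis by (auto intro!: exI[of _ "y * z"] simp: endo_mult[OF F])
    qed
    ultimately have pow: "a ^ card {y. ?Y y} = 1" if "a \<in> {y. ?Y y}" for a
      using fin that by (intro finite_mult_closed_power)
    have "F x \<in> {y. ?Y y}" using \<open>x \<noteq> 0\<close> by blast
    then have "0 < card {y. ?Y y}" using fin by (auto simp: card_gt_0_iff)
    then obtain y where y: "y ^ card {y. ?Y y} = x" using root_exists by blast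
    then have "y \<noteq> 0" using \<open>x \<noteq> 0\<close> \<open>0 < card {y. ?Y y}\<close> by (auto simp: power_0_left)
    then have "F y ^ card {y. ?Y y} = 1" by (intro pow) blast
    then show False using y \<open>F x \<noteq> 1\<close> endo_power[OF F] by metis
  qed
  have "pdef (\<lambda>e. ?Y (e 0))" by (intro pdef_intros tdef_endo[OF F])
  from finite_boundary[of ?Y, OF this] obtain B where "finite B" and
    B: "\<forall>x. x \<notin> B \<longrightarrow> (\<exists>d. d \<noteq> 0 \<and> (\<forall>y. y = x \<or> v d \<le> v (y - x) \<longrightarrow> (?Y y \<longleftrightarrow> ?Y x)))"
    by (elim exE conjE)
  have "infinite ({y. ?Y y} - B)" using \<open>infinite {y. ?Y y}\<close> \<open>finite B\<close> by (intro Diff_infinite_finite)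
  then have "{y. ?Y y} - B \<noteq> {}" by (rule infinite_imp_nonempty)
  then obtain z where z: "z \<noteq> 0" "F z \<notin> B" by blast
  from B[rule_format, OF z(2)] obtain d where "d \<noteq> 0" and
    d: "\<forall>y. y = F z \<or> v d \<le> v (y - F z) \<longrightarrow> (?Y y \<longleftrightarrow> ?Y (F z))" by (elim exE conjE)
  \<comment> \<open>The first bound keeps \<open>F z * (1 + \<epsilon>)\<close> inside the ball
    around \<open>F z\<close> contained in the image; the second excludes \<open>F x\<close> from
    the ball of radius \<open>v \<epsilon>\<close> around 1.\<close>
  obtain \<delta> where "v d < \<delta>" "v (F x - 1) < \<delta>" by (rule above)
  moreover obtain \<epsilon> where "\<epsilon> \<noteq> 0" "v \<epsilon> = \<delta>" by (rule v_surj)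
  ultimately have \<epsilon>: "\<epsilon> \<noteq> 0" "v d < v \<epsilon>" "v (F x - 1) < v \<epsilon>" by simp_all
  let ?H = "\<lambda>x. one_unit (F x) \<and> (F x = 1 \<or> v \<epsilon> \<le> v (F x - 1))"
  have "mult_subgroup ?H"
    by (rule mult_subgroup_vimage[OF F one_unit_ball_subgroup[OF \<epsilon>(1)]])
  moreover have "?H y" if "vunit y" for y using triv[of y] that by (simp add: one_unit_def)
  moreover have "\<exists>y. ?H y \<and> \<not> vunit y"
  proof -
    have vz: "F z \<noteq> 0" "v (F z) = 0" using units[OF z(1)] by (simp_all add: vunit_def)
    have "v (F z * (1 + \<epsilon>) - F z) = v \<epsilon>" using vz \<epsilon>(1) by (simp add: algebra_simps v_mult)
    then have "?Y (F z * (1 + \<epsilon>)) \<longleftrightarrow> ?Y (F z)" using d[rule_format, of "F z * (1 + \<epsilon>)"] less_imp_le[OF \<epsilon>(2)] by simp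
    then have "?Y (F z * (1 + \<epsilon>))" using z(1) by blast
    then obtain w where w: "w \<noteq> 0" "F z * (1 + \<epsilon>) = F w" by blast
    then have Fw: "F (w / z) = 1 + \<epsilon>" using vz by (simp add: endo_divide[OF F] field_simps)
    \<comment> \<open>Units are sent to 1, whereas \<open>w / z\<close> is sent to
      \<open>1 + \<epsilon>\<close>.\<close>
    have "\<not> vunit (w / z)" using triv[of "w / z"] Fw \<epsilon>(1) by auto
    moreover have "?H (w / z)" using Fw one_units[of "w / z"] w z by simp
    ultimately show ?thesis by blast
  qed
  ultimately have "?H x" using subgroup_above_units[of ?H] \<open>x \<noteq> 0\<close> by blast
  then show False using \<epsilon>(3) \<open>F x \<noteq> 1\<close> by auto
qed

end

section \<open>The induced endomorphism of the value group\<close>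

lemma inj_power_char_exponent: "inj (\<lambda>x :: 'a::field. x ^ (char_exponent TYPE('a) ^ k))"
proof (rule injI)
  fix x y :: 'a
  assume eq: "x ^ (char_exponent TYPE('a) ^ k) = y ^ (char_exponent TYPE('a) ^ k)"
  show "x = y"
  proof (cases "CHAR('a) = 0")
    case True
    then show ?thesis using eq by (simp add: char_exponent_def)
  next
    case False
    then have "prime CHAR('a)" by (intro prime_CHAR_semidom) simp
    from freshmans_dream'[OF this refl, of "x - y" y k]
    have "(x - y) ^ (CHAR('a) ^ k) = 0" using eq False by (simp add: char_exponent_def)
    then show ?thesis by simp
  qed
qed

lemma char_exponent_decompose:
  assumes "0 < n"
  shows "\<exists>k r. n = char_exponent TYPE('a::field) ^ k * r \<and> of_nat r \<noteq> (0 :: 'a)"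
proof (cases "CHAR('a) = 0")
  case True
  then show ?thesis using assms
    by (intro exI[of _ 0] exI[of _ n]) (simp add: of_nat_eq_0_iff_char_dvd)
next
  case False
  then have "prime CHAR('a)" by (intro prime_CHAR_semidom) simp
  then obtain r where "n = CHAR('a) ^ multiplicity CHAR('a) n * r" "\<not> CHAR('a) dvd r"
    using multiplicity_decompose'[of n "CHAR('a)"] assms by (metis not_prime_unit neq0_conv)
  then show ?thesis
    using False
    by (intro exI[of _ "multiplicity CHAR('a) n"] exI[of _ r])
      (simp add: char_exponent_def of_nat_eq_0_iff_char_dvd)
qed

section \<open>The map induced on the value group\<close>

context C_minimal_valued_field
begin

lemma v_power: "x \<noteq> 0 \<Longrightarrow> v (x ^ n) = (((+) (v x)) ^^ n) 0"
  by (induction n) (simp_all add: v_mult)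

lemma v_powi: "x \<noteq> 0 \<Longrightarrow> v (x powi n) = int_scale n (v x)"
  by (simp add: int_scale_def power_int_def power_inverse v_inverse v_power)

lemma vunit_powi: "vunit x \<Longrightarrow> vunit (x powi n)"
  by (simp add: power_int_def vunit_power vunit_inverse)

lemma vunit_if_powi: "vunit (x powi n) \<Longrightarrow> n \<noteq> 0 \<Longrightarrow> vunit x"
proof -
  assume x: "vunit (x powi n)" "n \<noteq> 0"
  then have x0: "x \<noteq> 0" by (auto simp: vunit_def)
  show "vunit x"
  proof (cases "0 \<le> n")
    case True
    then have "vunit (x ^ nat n)" "0 < nat n" using x by (simp_all add: power_int_def)
    then show ?thesis using v_power_eq_0[of x "nat n"] x0 by (simp add: vunit_def)
  next
    case False
    then have "vunit (inverse x ^ nat (- n))" "0 < nat (- n)" using x by (simp_all add: power_int_def)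
    then have "v (inverse x) = 0" using v_power_eq_0[of "inverse x" "nat (- n)"] x0 by (simp add: vunit_def)
    then show ?thesis using x0 by (simp add: vunit_def v_inverse)
  qed
qed

lemma vunit_divide_iff: "x \<noteq> 0 \<Longrightarrow> y \<noteq> 0 \<Longrightarrow> vunit (x / y) \<longleftrightarrow> v x = v y"
  by (simp add: vunit_def v_divide)

lemma endo_same_value:
  assumes F: "definable_endo F" and "x \<noteq> 0" "y \<noteq> 0" "v x = v y"
  shows "v (F x) = v (F y)"
proof -
  have "vunit (F x / F y)"
    using assms endo_vunit[OF F, of "x / y"] by (simp add: vunit_divide_iff endo_divide[OF F])
  then show ?thesis using assms endo_nz[OF F] by (simp add: vunit_divide_iff)
qed

text \<open>Pairs a map of \<Gamma> with an endomorphism lifting it, so that definability and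
  algebra of \<open>g\<close> can be handled on the home sort.\<close>

definition induces :: "('a \<Rightarrow> 'a) \<Rightarrow> ('g \<Rightarrow> 'g) \<Rightarrow> bool" where
  "induces F g \<longleftrightarrow> definable_endo F \<and> (\<forall>x. x \<noteq> 0 \<longrightarrow> v (F x) = g (v x))"

lemma induces_endo: "induces F g \<Longrightarrow> definable_endo F"
  and induces_v: "induces F g \<Longrightarrow> x \<noteq> 0 \<Longrightarrow> v (F x) = g (v x)"
  by (simp_all add: induces_def)

lemma induces_nz: "induces F g \<Longrightarrow> x \<noteq> 0 \<Longrightarrow> F x \<noteq> 0"
  using endo_nz[OF induces_endo] by blast

lemma ex_induces:
  assumes F: "definable_endo F"
  shows "\<exists>g. induces F g"
proof -
  have "v (F x) = v (F (SOME y. y \<noteq> 0 \<and> v y = v x))" if "x \<noteq> 0" for x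
    using someI[of "\<lambda>y. y \<noteq> 0 \<and> v y = v x" x] that
    by (intro endo_same_value[OF F]) simp_all
  then show ?thesis
    unfolding induces_def using F
    by (intro exI[of _ "\<lambda>\<gamma>. v (F (SOME y. y \<noteq> 0 \<and> v y = \<gamma>))"]) simp
qed

lemma induces_add:
  assumes "induces F g"
  shows "g (\<alpha> + \<beta>) = g \<alpha> + g \<beta>"
proof -
  obtain a where a: "a \<noteq> 0" "v a = \<alpha>" by (rule v_surj)
  obtain b where b: "b \<noteq> 0" "v b = \<beta>" by (rule v_surj)
  have "g (v (a * b)) = v (F a * F b)"
    using a b by (simp add: endo_mult[OF induces_endo[OF assms]] flip: induces_v[OF assms])
  also have "\<dots> = v (F a) + v (F b)" using a b induces_nz[OF assms] by (intro v_mult) simp_all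
  finally show ?thesis using a b by (simp add: v_mult induces_v[OF assms])
qed

lemma induces_0: "induces F g \<Longrightarrow> g 0 = 0"
  using induces_add[of F g 0 0] by simp

lemma induces_definable:
  assumes "induces F g"
  shows "definable_VG_endo (vf_lang E) M v g"
proof -
  note F = induces_endo[OF assms]
  let ?Q = "\<lambda>e. e 0 \<noteq> 0 \<and> e 1 \<noteq> 0 \<and> vunit (F (e 0) / e 1)"
  have "pdef ?Q" by (intro pdef_intros tdef_endo[OF F])
  from pdef_definable[OF this, of 2 0]
  have "definable (vf_lang E) M 2 {xs. length xs = 2 \<and> ?Q (\<lambda>i. if i < 2 then xs ! i else 0)}" .
  also have "{xs. length xs = 2 \<and> ?Q (\<lambda>i. if i < 2 then xs ! i else 0)}
      = {xs. 0 \<notin> set xs \<and> map v xs \<in> graph_on UNIV g}"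
  proof (rule set_eqI)
    fix xs :: "'a list"
    show "xs \<in> {xs. length xs = 2 \<and> ?Q (\<lambda>i. if i < 2 then xs ! i else 0)}
      \<longleftrightarrow> xs \<in> {xs. 0 \<notin> set xs \<and> map v xs \<in> graph_on UNIV g}"
    proof (cases "length xs = 2")
      case True
      then obtain x y where xs: "xs = [x, y]" by (auto simp: length_Suc_conv numeral_2_eq_2)
      show ?thesis
        using induces_nz[OF assms, of x] induces_v[OF assms, of x]
        by (auto simp: xs graph_on_def vunit_divide_iff)
    next
      case False
      then show ?thesis by (auto simp: graph_on_def dest: arg_cong[where f = length])
    qed
  qed
  finally show ?thesis
    unfolding definable_VG_endo_def definable_VG_def using induces_add[OF assms] by blast
qed

lemma is_rat_mult_iff:
  assumes "induces F g"
  shows "is_rat_mult q g \<longleftrightarrow>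
    (\<forall>x. x \<noteq> 0 \<longrightarrow> v (F x powi snd (quotient_of q)) = v (x powi fst (quotient_of q)))"
proof -
  have "v (F x powi snd (quotient_of q)) = int_scale (snd (quotient_of q)) (g (v x))"
    "v (x powi fst (quotient_of q)) = int_scale (fst (quotient_of q)) (v x)" if "x \<noteq> 0" for x
    using that induces_nz[OF assms] by (simp_all add: v_powi induces_v[OF assms])
  then show ?thesis unfolding is_rat_mult_def by (metis v_surj)
qed

text \<open>\<open>is_rat_mult\<close> uses lowest terms, whereas relations arise with arbitrary
  exponents. The common factor is cancelled because \<Gamma> is torsion-free, here in the form
  \<open>vunit_if_powi\<close>.\<close>

lemma rat_mult_if_powi:
  assumes g: "induces F g" and "b \<noteq> 0"
    and eq: "\<And>x. x \<noteq> 0 \<Longrightarrow> v (F x powi b) = v (x powi a)"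
  shows "\<exists>q. is_rat_mult q g"
proof -
  define q :: rat where "q = of_int a / of_int b"
  obtain a' b' where q': "quotient_of q = (a', b')" by fastforce
  then have "b' > 0" "q = of_int a' / of_int b'"
    using quotient_of_denom_pos quotient_of_div by blast+
  then have "(of_int (a * b') :: rat) = of_int (a' * b)"
    using \<open>b \<noteq> 0\<close> by (simp add: q_def field_simps)
  then have ab: "a * b' = a' * b" by (simp only: of_int_eq_iff)
  have "v (F x powi b') = v (x powi a')" if x: "x \<noteq> 0" for x
  proof -
    have Fx: "F x \<noteq> 0" using induces_nz[OF g x] .
    have "vunit ((F x powi b / x powi a) powi b')"
      using eq[OF x] x Fx by (intro vunit_powi) (simp add: vunit_divide_iff)
    also have "(F x powi b / x powi a) powi b' = (F x powi b' / x powi a') powi b"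
      by (simp add: power_int_divide_distrib ab mult.commute flip: power_int_mult)
    finally have "vunit (F x powi b' / x powi a')" using \<open>b \<noteq> 0\<close> by (rule vunit_if_powi)
    then show ?thesis using x Fx by (simp add: vunit_divide_iff)
  qed
  then have "is_rat_mult q g" using is_rat_mult_iff[OF g] q' by simp
  then show ?thesis by blast
qed

lemma rat_mult_if_value_trivial:
  assumes g: "induces F g" and triv: "\<And>x. x \<noteq> 0 \<Longrightarrow> vunit (F x)"
  shows "\<exists>q. is_rat_mult q g"
  using triv by (intro rat_mult_if_powi[OF g, of 1 0]) (simp_all add: vunit_def)

lemma induces_bij:
  assumes g: "induces F g" and y: "y \<noteq> 0" "\<not> vunit (F y)"
  shows "bij g"
proof (rule bijI)
  show "inj g"
  proof (rule injI)
    fix \<alpha> \<beta> assume eq: "g \<alpha> = g \<beta>"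
    obtain a where a: "a \<noteq> 0" "v a = \<alpha>" by (rule v_surj)
    obtain b where b: "b \<noteq> 0" "v b = \<beta>" by (rule v_surj)
    have "vunit (F (a / b))"
      using a b eq induces_nz[OF g]
      by (simp add: endo_divide[OF induces_endo[OF g]] vunit_divide_iff induces_v[OF g])
    then have "vunit (a / b)" using endo_value_dichotomy[OF induces_endo[OF g]] y by blast
    then show "\<alpha> = \<beta>" using a b by (simp add: vunit_divide_iff)
  qed
  show "surj g"
    unfolding surj_def
  proof
    fix \<gamma>
    obtain x where "x \<noteq> 0" "v (F x) = \<gamma>" using endo_value_surj[OF induces_endo[OF g] y] by blast
    then show "\<exists>\<alpha>. \<gamma> = g \<alpha>" using induces_v[OF g] by blast
  qed
qed

text \<open>The positive \<gamma> with \<open>0 < g \<gamma>\<close> and those with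
  \<open>g \<gamma> < 0\<close> are both closed under doubling. If both kinds existed, both
  conditions would hold for all large \<gamma>.\<close>

lemma induces_sign:
  assumes g: "induces F g" and y: "y \<noteq> 0" "\<not> vunit (F y)"
  shows "(\<forall>\<gamma>>0. 0 < g \<gamma>) \<or> (\<forall>\<gamma>>0. g \<gamma> < 0)"
proof (rule ccontr)
  assume no: "\<not> ?thesis"
  have "g \<gamma> \<noteq> 0" if "0 < \<gamma>" for \<gamma>
    using that induces_bij[OF g y] induces_0[OF g] by (metis bij_is_inj inj_eq less_irrefl)
  then obtain \<alpha> \<beta> where \<alpha>: "0 < \<alpha>" "g \<alpha> < 0" and \<beta>: "0 < \<beta>" "0 < g \<beta>"
    using no by (metis linorder_neqE)
  note F = induces_endo[OF g]
  have "pdef (\<lambda>e. e 0 \<noteq> 0 \<and> \<not> vle (e 0) 1 \<and> \<not> vle (F (e 0)) 1)"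
    by (intro pdef_intros tdef_endo[OF F])
  then have pos: "pdef (\<lambda>e. e 0 \<noteq> 0 \<and> (0 < v (e 0) \<and> 0 < g (v (e 0))))"
    by (rule pdef_cong) (use induces_nz[OF g] induces_v[OF g] in \<open>auto simp: vle_def not_le\<close>)
  have "pdef (\<lambda>e. e 0 \<noteq> 0 \<and> \<not> vle (e 0) 1 \<and> \<not> vle 1 (F (e 0)))"
    by (intro pdef_intros tdef_endo[OF F])
  then have neg: "pdef (\<lambda>e. e 0 \<noteq> 0 \<and> (0 < v (e 0) \<and> g (v (e 0)) < 0))"
    by (rule pdef_cong) (use induces_nz[OF g] induces_v[OF g] in \<open>auto simp: vle_def not_le\<close>)
  have "\<exists>\<alpha>. \<forall>\<gamma>>\<alpha>. 0 < \<gamma> \<and> 0 < g \<gamma>"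
    using pos \<beta> by (rule_tac unbounded_if_doubling[where \<delta> = \<beta>])
      (simp_all add: add_pos_pos induces_add[OF g])
  moreover have "\<exists>\<alpha>. \<forall>\<gamma>>\<alpha>. 0 < \<gamma> \<and> g \<gamma> < 0"
    using neg \<alpha> by (rule_tac unbounded_if_doubling[where \<delta> = \<alpha>])
      (simp_all add: add_pos_pos add_neg_neg induces_add[OF g])
  ultimately obtain \<gamma>\<^sub>1 \<gamma>\<^sub>2 where gt: "\<forall>\<gamma>>\<gamma>\<^sub>1. 0 < g \<gamma>" "\<forall>\<gamma>>\<gamma>\<^sub>2. g \<gamma> < 0" by blast
  obtain \<gamma> where "\<gamma>\<^sub>1 < \<gamma>" "\<gamma>\<^sub>2 < \<gamma>" by (rule above)
  then show False using gt by (metis less_asym)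
qed

lemma definable_endo_inverse:
  "definable_endo F \<Longrightarrow> definable_endo (\<lambda>x. inverse (F x))"
  unfolding definable_endo_def by (elim conjE, intro conjI tdef_inverse) simp_all

text \<open>The hypothesis concerns order-preserving automorphisms only, so a decreasing
  \<open>g\<close> is replaced by its negative, induced by the inverse of \<open>F\<close>.\<close>

lemma rat_mult_if_VG_no_exotic:
  assumes g: "induces F g" and VG: "VG_no_exotic_automorphisms (vf_lang E) M v"
  shows "\<exists>q. is_rat_mult q g"
proof (cases "\<forall>x. x \<noteq> 0 \<longrightarrow> vunit (F x)")
  case True
  then show ?thesis using rat_mult_if_value_trivial[OF g] by blast
next
  case False
  then obtain y where y: "y \<noteq> 0" "\<not> vunit (F y)" by blast
  have positive: "\<exists>q>0. is_rat_mult q h"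
    if h: "induces G h" "\<forall>\<gamma>>0. 0 < h \<gamma>" "bij h" for G h
  proof -
    have "strict_mono h"
    proof (rule strict_monoI)
      fix \<alpha> \<beta> :: 'g assume "\<alpha> < \<beta>"
      then have "0 < h (\<beta> - \<alpha>)" using h(2) by simp
      then show "h \<alpha> < h \<beta>" using induces_add[OF h(1), of \<alpha> "\<beta> - \<alpha>"] by simp
    qed
    then show ?thesis
      using VG h(3) induces_definable[OF h(1)] unfolding VG_no_exotic_automorphisms_def by blast
  qed
  note bij = induces_bij[OF g y]
  from induces_sign[OF g y] show ?thesis
  proof
    assume "\<forall>\<gamma>>0. 0 < g \<gamma>"
    then show ?thesis using positive[OF g _ bij] by blast
  next
    assume neg: "\<forall>\<gamma>>0. g \<gamma> < 0"
    let ?F = "\<lambda>x. inverse (F x)" and ?g = "\<lambda>\<gamma>. - g \<gamma>"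
    have g': "induces ?F ?g"
      using definable_endo_inverse[OF induces_endo[OF g]] induces_nz[OF g] induces_v[OF g]
      by (simp add: induces_def v_inverse)
    have "bij ?g" using bij_comp[OF bij bij_uminus] by (simp add: comp_def)
    then obtain q where "is_rat_mult q ?g" using positive[OF g'] neg by auto
    moreover obtain a b where q: "quotient_of q = (a, b)" by fastforce
    ultimately have eq: "v (inverse (F x) powi b) = v (x powi a)" if "x \<noteq> 0" for x
      using is_rat_mult_iff[OF g'] that by simp
    have "v (F x powi b) = v (x powi (- a))" if "x \<noteq> 0" for x
      using eq[OF that] induces_nz[OF g that] that
      by (simp add: power_int_inverse power_int_minus v_inverse) (metis minus_minus)
    then show ?thesis using quotient_of_denom_pos[OF q] by (intro rat_mult_if_powi[OF g, of b "- a"]) simp_all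
  qed
qed

text \<open>The graph is parametrised by units \<open>z\<close> through the pairs of
  \<open>res z ^ n\<close> and \<open>res (F z) ^ N\<close>. It covers every non-zero argument
  because units have \<open>n\<close>-th roots; equality of residues is expressed by quotients that
  are 1-units.\<close>

lemma definable_RF_graph:
  assumes F: "definable_endo F" and "0 < n" "0 < N" and h: "\<And>x. vunit x \<Longrightarrow> h (res x ^ n) = res (F x) ^ N"
  shows "definable_RF (vf_lang E) M v res 2 (graph_on (UNIV - {0}) h)"
proof -
  let ?Q = "\<lambda>e. \<exists>z. vunit z \<and> one_unit (e 0 / z ^ n) \<and> one_unit (e 1 / F z ^ N)"
  have "pdef ?Q" by (intro pdef_intros tdef_endo[OF F])
  from pdef_definable[OF this, of 2 0]
  have "definable (vf_lang E) M 2 {xs. length xs = 2 \<and> ?Q (\<lambda>i. if i < 2 then xs ! i else 0)}" .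
  also have "{xs. length xs = 2 \<and> ?Q (\<lambda>i. if i < 2 then xs ! i else 0)}
      = {xs. set xs \<subseteq> \<O> \<and> map res xs \<in> graph_on (UNIV - {0}) h}"
  proof (rule set_eqI)
    fix xs :: "'a list"
    show "xs \<in> {xs. length xs = 2 \<and> ?Q (\<lambda>i. if i < 2 then xs ! i else 0)}
      \<longleftrightarrow> xs \<in> {xs. set xs \<subseteq> \<O> \<and> map res xs \<in> graph_on (UNIV - {0}) h}"
    proof (cases "length xs = 2")
      case True
      then obtain x y where xs: "xs = [x, y]" by (auto simp: length_Suc_conv numeral_2_eq_2)
      have one_unit_divide: "one_unit (a / b) \<longleftrightarrow> a \<in> \<O> \<and> res a = res b" if "vunit b" for a b
      proof
        assume ab: "one_unit (a / b)"
        then have "vunit (a / b * b)" "res (a / b * b) = res b"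
          using that by (simp_all only: vunit_mult one_unit_iff res_vunit_mult mult_1_left)
        then show "a \<in> \<O> \<and> res a = res b" using vunit_nz[OF that] by (simp add: vunit_integral)
      next
        assume "a \<in> \<O> \<and> res a = res b"
        then show "one_unit (a / b)"
          using vunit_divide[of a b] res_vunit_divide[of a b] that
          by (simp add: one_unit_iff vunit_iff[of a] vunit_iff[of b])
      qed
      have "?Q (\<lambda>i. if i < 2 then xs ! i else 0) \<longleftrightarrow>
          x \<in> \<O> \<and> y \<in> \<O> \<and> (\<exists>z. vunit z \<and> res x = res z ^ n \<and> res y = res (F z) ^ N)"
        using endo_vunit[OF F] unfolding xs
        by (auto simp: one_unit_divide vunit_power res_power vunit_integral)
      also have "\<dots> \<longleftrightarrow> x \<in> \<O> \<and> y \<in> \<O> \<and> res x \<noteq> 0 \<and> res y = h (res x)"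
      proof -
        have "(\<exists>z. vunit z \<and> a = res z ^ n \<and> b = res (F z) ^ N) \<longleftrightarrow> a \<noteq> 0 \<and> b = h a" for a b
        proof
          assume "a \<noteq> 0 \<and> b = h a"
          then obtain w where w: "vunit w" "res w = a" using res_vunit_surj by blast
          obtain z where "vunit z" "z ^ n = w" using vunit_root[OF \<open>0 < n\<close> w(1)] .
          then show "\<exists>z. vunit z \<and> a = res z ^ n \<and> b = res (F z) ^ N"
            using w h \<open>a \<noteq> 0 \<and> b = h a\<close> by (metis res_power vunit_integral)
        qed (use h vunit_iff in auto)
        then show ?thesis by blast
      qed
      finally show ?thesis unfolding xs by (auto simp: graph_on_def)
    next
      case False
      then show ?thesis by (auto simp: graph_on_def dest: arg_cong[where f = length])
    qed
  qed
  finally show ?thesis unfolding definable_RF_def .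
qed


text \<open>Modulo its kernel, the residue endomorphism is an automorphism after taking powers on both
  sides: these powers kill the finite groups \<open>C\<close> (residues of the kernel) and \<open>A\<close> (the image of the
  \<open>1\<close>-units).\<close>

lemma residue_automorphism:
  assumes F: "definable_endo F" and nontriv: "\<not> (\<forall>x. vunit x \<longrightarrow> res (F x) = 1)"
  shows "\<exists>h n N. 0 < n \<and> 0 < N \<and> (\<forall>x. vunit x \<longrightarrow> h (res x ^ n) = res (F x) ^ N) \<and>
    bij_betw h (UNIV - {0}) (UNIV - {0}) \<and> (\<forall>a b. a \<noteq> 0 \<longrightarrow> b \<noteq> 0 \<longrightarrow> h (a * b) = h a * h b)"
proof -
  have surj: "\<exists>x. vunit x \<and> res (F x) = a" if "a \<noteq> 0" for a
    using residue_endo_on_units[OF F] nontriv that by blast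
  note FU = endo_vunit[OF F]
  have res_F_mult: "res (F (x * y)) = res (F x) * res (F y)" if "vunit x" "vunit y" for x y
    using that FU by (simp add: endo_mult[OF F] res_vunit_mult)
  have res_F_divide: "res (F (x / y)) = res (F x) / res (F y)" if "vunit x" "vunit y" for x y
    using that FU by (simp add: endo_divide[OF F] res_vunit_divide)
  have res_nz: "res x \<noteq> 0" if "vunit x" for x using that by (simp add: vunit_iff)
  define C where "C = res ` {x. vunit x \<and> one_unit (F x)}"
  define A where "A = (\<lambda>x. res (F x)) ` {x. one_unit x}"
  have C_mem: "res x \<in> C" if "vunit x" "res (F x) = 1" for x
    unfolding C_def using that FU by (intro imageI) (simp add: one_unit_iff)
  have "finite C"
  proof (rule ccontr)
    assume "infinite C"
    then have "one_unit (F x)" if "vunit x" for x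
      using units_subset_if_infinite[OF mult_subgroup_vimage[OF F mult_subgroup_one_unit] _ that]
      unfolding C_def by blast
    then show False using nontriv by (simp add: one_unit_iff)
  qed
  have C_closed: "a * b \<in> C" if ab: "a \<in> C" "b \<in> C" for a b
  proof -
    obtain x y where "vunit x" "one_unit (F x)" "a = res x" "vunit y" "one_unit (F y)" "b = res y"
      using ab unfolding C_def by blast
    then show ?thesis using C_mem[of "x * y"]
      by (simp add: res_F_mult res_vunit_mult vunit_mult one_unit_iff)
  qed
  have C1: "1 \<in> C" using C_mem[of 1] by (simp add: endo_1[OF F])
  have C0: "0 \<notin> C" unfolding C_def using res_nz by auto
  \<comment> \<open>Then \<open>C\<close> is exactly the kernel of the \<open>n\<close>-th power map
    on k; likewise for \<open>A\<close> and \<open>N\<close> below.\<close>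
  define n where "n = card C"
  have n: "0 < n" using \<open>finite C\<close> C1 by (auto simp: n_def card_gt_0_iff)
  have C: "a ^ n = 1 \<longleftrightarrow> a \<in> C" for a
    using finite_subgroup_eq_roots[OF \<open>finite C\<close> C0 C_closed] C1 unfolding n_def by blast
  have A0: "0 \<notin> A" unfolding A_def using res_nz[OF FU] by (auto simp: one_unit_iff)
  have A_closed: "a * b \<in> A" if ab: "a \<in> A" "b \<in> A" for a b
  proof -
    obtain x y where "one_unit x" "a = res (F x)" "one_unit y" "b = res (F y)"
      using ab unfolding A_def by blast
    then show ?thesis unfolding A_def
      using mult_subgroupD(3)[OF mult_subgroup_one_unit]
      by (intro image_eqI[of _ _ "x * y"]) (simp_all add: res_F_mult one_unit_iff)
  qed
  have A1: "1 \<in> A" unfolding A_def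
    by (intro image_eqI[of _ _ 1]) (simp_all add: endo_1[OF F] one_unit_def)
  \<comment> \<open>If \<open>A\<close> were infinite it would be everything. Each unit could then
    be divided by a 1-unit with the same residue under \<open>F\<close>; this keeps its own residue
    and moves it into the kernel, so \<open>C\<close> would be everything too.\<close>
  have "finite A"
  proof (rule ccontr)
    assume inf: "infinite A"
    have all: "a \<in> A" if "a \<noteq> 0" for a
    proof (rule residue_subgroup_trivial[where D = "\<lambda>a. a \<in> A"])
      have "pdef (\<lambda>e. vunit (e 0) \<and> (\<exists>x. one_unit x \<and> one_unit (e 0 / F x)))"
        by (intro pdef_intros tdef_endo[OF F])
      then show "pdef (\<lambda>e. vunit (e 0) \<and> res (e 0) \<in> A)"
      proof (rule pdef_cong)
        fix e :: "nat \<Rightarrow> 'a"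
        have "one_unit (e 0 / F x) \<longleftrightarrow> res (e 0) = res (F x)" if "vunit (e 0)" "one_unit x" for x
          using that FU[of x] res_nz[OF FU[of x]]
          by (auto simp: one_unit_iff vunit_divide res_vunit_divide)
        then show "vunit (e 0) \<and> res (e 0) \<in> A \<longleftrightarrow>
            vunit (e 0) \<and> (\<exists>x. one_unit x \<and> one_unit (e 0 / F x))"
          unfolding A_def by auto
      qed
    qed (use A0 A_closed inf that in auto)
    have "b \<in> C" if "b \<noteq> 0" for b
    proof -
      obtain x where x: "vunit x" "res x = b" using res_vunit_surj[OF \<open>b \<noteq> 0\<close>] .
      have "res (F x) \<in> A" using all res_nz[OF FU[OF x(1)]] by blast
      then obtain u where u: "one_unit u" "res (F x) = res (F u)" unfolding A_def by blast
      then have "vunit u" "res u = 1" by (simp_all add: one_unit_iff)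
      then have "res (x / u) \<in> C"
        using x u res_nz[OF FU] by (intro C_mem) (simp_all add: vunit_divide res_F_divide)
      then show ?thesis using x \<open>vunit u\<close> \<open>res u = 1\<close> by (simp add: res_vunit_divide)
    qed
    then have "UNIV \<subseteq> insert 0 C" by blast
    then show False using \<open>finite C\<close> infinite_RF by (meson finite.insertI finite_subset)
  qed
  define N where "N = card A"
  have N: "0 < N" using \<open>finite A\<close> A1 by (auto simp: N_def card_gt_0_iff)
  have A: "a ^ N = 1 \<longleftrightarrow> a \<in> A" for a
    using finite_subgroup_eq_roots[OF \<open>finite A\<close> A0 A_closed] A1 unfolding N_def by blast
  have ker: "res (F x) ^ N = 1 \<longleftrightarrow> res x ^ n = 1" if x: "vunit x" for x
  proof
    assume "res (F x) ^ N = 1"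
    then obtain u where u: "one_unit u" "res (F x) = res (F u)" using A unfolding A_def by blast
    then have "vunit u" "res u = 1" by (simp_all add: one_unit_iff)
    then have "res (x / u) \<in> C"
      using x u res_nz[OF FU] by (intro C_mem) (simp_all add: vunit_divide res_F_divide)
    then show "res x ^ n = 1" using x \<open>vunit u\<close> \<open>res u = 1\<close> C by (simp add: res_vunit_divide)
  next
    assume "res x ^ n = 1"
    then obtain y where y: "vunit y" "one_unit (F y)" "res x = res y"
      using C unfolding C_def by blast
    then have "one_unit (x / y)" using x res_nz by (simp add: one_unit_iff vunit_divide res_vunit_divide)
    then have "res (F (x / y)) \<in> A" unfolding A_def by blast
    then show "res (F x) ^ N = 1" using x y A by (simp add: res_F_divide one_unit_iff)
  qed
  have key: "res x ^ n = res y ^ n \<longleftrightarrow> res (F x) ^ N = res (F y) ^ N" if "vunit x" "vunit y" for x y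
    using ker[of "x / y"] that res_nz FU
    by (simp add: vunit_divide res_F_divide res_vunit_divide power_divide)
  have root: "\<exists>x. vunit x \<and> res x ^ n = a" if a: "a \<noteq> 0" for a
  proof -
    obtain w where w: "vunit w" "res w = a" using a by (rule res_vunit_surj)
    obtain x where "vunit x" "x ^ n = w" using vunit_root[OF n w(1)] .
    then show ?thesis using w by (intro exI[of _ x]) (auto simp: res_power vunit_integral)
  qed
  \<comment> \<open>By \<open>key\<close>, any other unit whose residue has \<open>n\<close>-th
    power \<open>a\<close> gives the same result; the converse direction of \<open>key\<close>
    yields injectivity.\<close>
  define h where "h a = res (F (SOME x. vunit x \<and> res x ^ n = a)) ^ N" for a
  have h: "h (res x ^ n) = res (F x) ^ N" if "vunit x" for x
  proof -
    have "vunit (SOME y. vunit y \<and> res y ^ n = res x ^ n) \<and>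
        res (SOME y. vunit y \<and> res y ^ n = res x ^ n) ^ n = res x ^ n"
      using that by (intro someI[of "\<lambda>y. vunit y \<and> res y ^ n = res x ^ n"]) simp
    then show ?thesis unfolding h_def using key that by blast
  qed
  have "bij_betw h (UNIV - {0}) (UNIV - {0})"
  proof (rule bij_betw_imageI)
    show "inj_on h (UNIV - {0})"
    proof (rule inj_onI)
      fix a b assume "a \<in> UNIV - {0}" "b \<in> UNIV - {0}" and eq: "h a = h b"
      then obtain x y where "vunit x" "res x ^ n = a" "vunit y" "res y ^ n = b" using root by blast
      then show "a = b" using eq h key by metis
    qed
    show "h ` (UNIV - {0}) = UNIV - {0}"
    proof (intro equalityI subsetI)
      fix b assume "b \<in> h ` (UNIV - {0})"
      then obtain a where a: "a \<noteq> 0" "b = h a" by blast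
      obtain x where "vunit x" "res x ^ n = a" using root[OF a(1)] by blast
      then show "b \<in> UNIV - {0}" using a h res_nz[OF FU[of x]] by auto
    next
      fix b assume "b \<in> UNIV - {0 :: 'k}"
      then obtain w where w: "vunit w" "res w = b" using res_vunit_surj by blast
      obtain c where c: "vunit c" "c ^ N = w" using vunit_root[OF N w(1)] .
      obtain x where x: "vunit x" "res (F x) = res c" using surj res_nz[OF c(1)] by blast
      have "b = res (F x) ^ N" using x w c by (auto simp: res_power vunit_integral)
      then show "b \<in> h ` (UNIV - {0})"
        using h[OF x(1)] res_nz[OF x(1)] by (intro image_eqI[of _ _ "res x ^ n"]) simp_all
    qed
  qed
  moreover have "h (a * b) = h a * h b" if ab: "a \<noteq> 0" "b \<noteq> 0" for a b
  proof -
    obtain x y where xy: "vunit x" "res x ^ n = a" "vunit y" "res y ^ n = b" using ab root by blast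
    then have "a * b = res (x * y) ^ n" by (auto simp: res_vunit_mult power_mult_distrib)
    then have "h (a * b) = res (F (x * y)) ^ N" using h xy by (simp add: vunit_mult)
    also have "\<dots> = h a * h b" using h xy by (auto simp: res_F_mult power_mult_distrib)
    finally show ?thesis .
  qed
  ultimately show ?thesis using n N h by blast
qed

text \<open>A relation between the identity and \<open>h\<close> lifts to a quotient of monomials in
  \<open>x\<close> and \<open>F x\<close> that is residually trivial on units. By
  \<open>value_trivial_if_residue_trivial\<close> its values are units, which is a linear relation
  between \<open>v x\<close> and \<open>v (F x)\<close>.\<close>

lemma rat_mult_if_RF_no_exotic:
  assumes g: "induces F g" and RF: "RF_no_exotic_automorphisms (vf_lang E) M v res"
  shows "\<exists>q. is_rat_mult q g"
proof (cases "\<forall>x. vunit x \<longrightarrow> res (F x) = 1")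
  case True
  then show ?thesis
    using value_trivial_if_residue_trivial[OF induces_endo[OF g]] rat_mult_if_value_trivial[OF g] by blast
next
  case False
  note F = induces_endo[OF g]
  obtain h n N where nN: "0 < n" "0 < N" and h: "\<And>x. vunit x \<Longrightarrow> h (res x ^ n) = res (F x) ^ N"
    and bij: "bij_betw h (UNIV - {0}) (UNIV - {0})"
    and hom: "\<And>a b. a \<noteq> 0 \<Longrightarrow> b \<noteq> 0 \<Longrightarrow> h (a * b) = h a * h b"
    using residue_automorphism[OF F False] by blast
  have "definable ring_lang ring_struct 2 (graph_on (UNIV - {0}) h)"
    using RF bij hom definable_RF_graph[OF F nN h] unfolding RF_no_exotic_automorphisms_def by blast
  moreover have "h a \<noteq> 0" if "a \<noteq> 0" for a using bij_betwE[OF bij] that by auto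
  ultimately have "\<exists>i j i' j'. (i, j) \<noteq> (i', j') \<and> (\<forall>a. a \<noteq> 0 \<longrightarrow> a ^ i * h a ^ j = a ^ i' * h a ^ j')"
    using hom by (intro ring_definable_mult_hom[OF residue_alg_closed]) blast+
  then obtain i j i' j' where ne: "(i, j) \<noteq> (i', j')"
    and rel: "\<And>a. a \<noteq> 0 \<Longrightarrow> a ^ i * h a ^ j = a ^ i' * h a ^ j'" by blast
  \<comment> \<open>The extra factor \<open>x\<close> ensures value 0 at 0 even when both exponents
    vanish; it cancels in the quotient.\<close>
  let ?G = "\<lambda>i j x. x * (x ^ (n * i) * F x ^ (N * j))"
  have G: "definable_endo (?G i j)" for i j
    unfolding definable_endo_def
    by (intro conjI tdef_mult tdef_power tdef_endo[OF F] tdef_var)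
      (simp_all add: endo_nz[OF F] endo_mult[OF F] power_mult_distrib mult_ac)
  let ?G' = "\<lambda>x. ?G i j x / ?G i' j' x"
  have G': "definable_endo ?G'" by (rule definable_endo_divide[OF G G])
  have res_G: "res (?G i j x) = res x * ((res x ^ n) ^ i * (res (F x) ^ N) ^ j)" if "vunit x" for i j x
    using that endo_vunit[OF F that]
    by (simp add: res_mult res_power vunit_integral integral_mult integral_power flip: power_mult)
  have G_unit: "vunit (?G i j x)" if "vunit x" for i j x
    using that endo_vunit[OF F that] by (intro vunit_mult vunit_power)
  have "res (?G' x) = 1" if x: "vunit x" for x
  proof -
    have "res x \<noteq> 0" using x by (simp add: vunit_iff)
    then have "res (?G i j x) = res (?G i' j' x)"
      using rel[of "res x ^ n"] h[OF x] unfolding res_G[OF x] by simp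
    moreover have "res (?G i' j' x) \<noteq> 0" using G_unit[OF x, of i' j'] unfolding vunit_iff by (rule conjunct2)
    then have "res (?G i' j' x) / res (?G i' j' x) = 1" by (rule divide_self)
    ultimately show ?thesis by (simp only: res_vunit_divide[OF G_unit[OF x] G_unit[OF x]])
  qed
  from value_trivial_if_residue_trivial[OF G' this]
  have unit: "vunit (?G' x)" if "x \<noteq> 0" for x using that by blast
  define a where "a = int (n * i) - int (n * i')"
  define b where "b = int (N * j') - int (N * j)"
  have eq: "v (F x powi b) = v (x powi a)" if x: "x \<noteq> 0" for x
  proof -
    have Fx: "F x \<noteq> 0" using induces_nz[OF g x] .
    have "x powi a / F x powi b = ?G' x"
      unfolding a_def b_def power_int_diff[OF disjI1[OF x]] power_int_diff[OF disjI1[OF Fx]] power_int_of_nat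
      using x Fx by (simp add: field_simps)
    then have "vunit (x powi a / F x powi b)" using unit[OF x] by simp
    then show ?thesis using x Fx by (simp add: vunit_divide_iff)
  qed
  \<comment> \<open>Otherwise the relation would say that a fixed non-zero power of every non-zero
    \<open>x\<close> is a unit, contradicting non-triviality of the valuation.\<close>
  have "b \<noteq> 0"
  proof
    assume "b = 0"
    then have "j = j'" using nN by (simp add: b_def)
    then have "a \<noteq> 0" using ne nN by (simp add: a_def)
    obtain x where x: "x \<noteq> 0" "0 < v x" by (rule nontrivial)
    have "vunit (x powi a)" using eq[OF x(1)] x \<open>b = 0\<close> by (simp add: vunit_def)
    then have "vunit x" using \<open>a \<noteq> 0\<close> by (rule vunit_if_powi)
    then show False using x by (simp add: vunit_def)
  qed
  then show ?thesis using eq by (rule rat_mult_if_powi[OF g])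
qed

text \<open>Triviality of \<open>?G\<close> gives \<open>F x ^ B = x powi a\<close>. Let
  \<open>r\<close> be the part of \<open>B\<close> prime to p. An \<open>r\<close>-th root of unity
  \<zeta> satisfies \<open>\<zeta> powi b = 1\<close>, and
  \<open>\<zeta> powi a = F (\<zeta> ^ B) = 1\<close>; as \<open>a\<close> and \<open>b\<close> are
  coprime, \<zeta> = 1, so \<open>r = 1\<close>. Extracting the remaining p-power root is
  unambiguous because Frobenius is injective.\<close>

lemma frac_power_if_rat_mult:
  assumes g: "induces F g" and q: "is_rat_mult q g"
  shows "\<exists>n m :: int. q = of_int n / of_nat (char_exponent TYPE('a)) powi m \<and>
    (\<forall>x. x \<noteq> 0 \<longrightarrow> F x = frac_power x n m)"
proof -
  note F = induces_endo[OF g]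
  obtain a b where ab: "quotient_of q = (a, b)" by fastforce
  then have "0 < b" and cop: "coprime a b" and q_eq: "q = of_int a / of_int b"
    using quotient_of_denom_pos quotient_of_coprime quotient_of_div by blast+
  define B where "B = nat b"
  have B: "b = int B" "0 < B" using \<open>0 < b\<close> by (simp_all add: B_def)
  let ?G = "\<lambda>x. F x ^ B / x powi a"
  \<comment> \<open>Definability is available for natural exponents, so the integer power is split
    into a quotient in which one exponent is 0.\<close>
  have powi_def: "x powi a = x ^ nat a / x ^ nat (- a)" for x :: 'a
    by (simp add: power_int_def divide_inverse power_inverse)
  have "definable_endo ?G"
    unfolding definable_endo_def
  proof (intro conjI)
    show "tdef (\<lambda>e. F (e 0) ^ B / e 0 powi a)"
      unfolding powi_def by (intro pdef_intros tdef_endo[OF F])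
  qed (use B in \<open>simp_all add: endo_nz[OF F] endo_0[OF F] endo_mult[OF F] power_mult_distrib
        power_int_mult_distrib power_0_left\<close>)
  moreover have "vunit (?G x)" if "x \<noteq> 0" for x
  proof -
    have "v (F x ^ B) = v (x powi a)"
      using q that unfolding is_rat_mult_iff[OF g] ab by (simp add: B power_int_of_nat)
    then show ?thesis using that induces_nz[OF g that] by (simp add: vunit_divide_iff)
  qed
  ultimately have "?G x = 1" if "x \<noteq> 0" for x
    using that by (rule endo_trivial_if_value_trivial)
  then have eq: "F x ^ B = x powi a" if "x \<noteq> 0" for x
    using that by (simp add: divide_eq_1_iff)
  obtain k r where kr: "B = char_exponent TYPE('a) ^ k * r" "of_nat r \<noteq> (0 :: 'a)"
    using char_exponent_decompose[OF \<open>0 < B\<close>] by blast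
  have "r = 1"
  proof (rule ccontr)
    assume "r \<noteq> 1"
    moreover have "r \<noteq> 0" using kr(2) by (cases "r = 0") simp_all
    ultimately obtain \<zeta> :: 'a where \<zeta>: "\<zeta> \<noteq> 1" "\<zeta> ^ r = 1"
      using nontrivial_root_of_unity[OF kr(2)] by (metis One_nat_def nat_neq_iff less_one)
    have "\<zeta> \<noteq> 0" using \<zeta> \<open>r \<noteq> 0\<close> by (cases "\<zeta> = 0") (simp_all add: power_0_left)
    have \<zeta>B: "\<zeta> ^ B = 1" using \<zeta> by (simp add: kr(1) power_mult mult.commute[of _ r])
    have "\<zeta> powi a = F (\<zeta> ^ B)" using eq[OF \<open>\<zeta> \<noteq> 0\<close>] by (simp add: endo_power[OF F])
    then have \<zeta>a: "\<zeta> powi a = 1" using \<zeta>B by (simp add: endo_1[OF F])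
    have \<zeta>b: "\<zeta> powi b = 1" using \<zeta>B by (simp add: B power_int_of_nat)
    obtain s t where st: "s * a + t * b = 1"
      using bezout_int[of a b] cop by (auto simp: coprime_iff_gcd_eq_1)
    have "\<zeta> = \<zeta> powi (a * s + b * t)" using st by (simp add: mult.commute)
    also have "\<dots> = (\<zeta> powi a) powi s * (\<zeta> powi b) powi t"
      using \<open>\<zeta> \<noteq> 0\<close> by (simp add: power_int_add power_int_mult)
    also have "\<dots> = 1" using \<zeta>a \<zeta>b by simp
    finally show False using \<zeta> by simp
  qed
  then have Bk: "B = char_exponent TYPE('a) ^ k" using kr by simp
  have "F x = frac_power x a (int k)" if "x \<noteq> 0" for x
  proof -
    have frob: "frobenius_power (int k) = (\<lambda>y :: 'a. y ^ B)"
      by (simp add: frobenius_power_def Bk)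
    have "inj (\<lambda>y :: 'a. y ^ B)" unfolding Bk by (rule inj_power_char_exponent)
    then have "inv (\<lambda>y :: 'a. y ^ B) (F x ^ B) = F x" by (rule inv_f_f)
    then show ?thesis unfolding frac_power_def frob eq[OF that] by (rule sym)
  qed
  moreover have "q = of_int a / of_nat (char_exponent TYPE('a)) powi int k"
    unfolding q_eq B(1) Bk by (simp add: power_int_of_nat)
  ultimately show ?thesis by blast
qed

end

theorem theorem7p5:
  fixes E :: "('f, 'r) lang"
    and T :: "('f vf_fun, 'r vf_rel) fm set"
    and M :: "('f, 'r, 'a::alg_closed_field) vf_struct"
    and v :: "'a \<Rightarrow> 'g::linordered_ab_group_add"
    and res :: "'a \<Rightarrow> 'k::field"
    and f :: "'a \<Rightarrow> 'a"
  defines "L \<equiv> vf_lang E"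
    and "t \<equiv> fn M TConst []"
  assumes "complete_theory L T"
    and "C_minimal_theory TYPE('a) L T"
    and "monster_model L T M"
    and "expands_ACVF M v"
    and "residue_map v res"
    and "t \<noteq> 0" and "v t > 0"
    and "definably_complete L M"
    and "definable_mult_endo L M f"
  shows "\<exists>g. definable_VG_endo L M v g \<and> (\<forall>x. x \<noteq> 0 \<longrightarrow> v (f x) = g (v x)) \<and>
    (RF_no_exotic_automorphisms L M v res \<or> VG_no_exotic_automorphisms L M v \<longrightarrow>
       (\<exists>q. is_rat_mult q g)) \<and>
    (\<forall>q. is_rat_mult q g \<longrightarrow>
       (\<exists>n m :: int. q = of_int n / of_nat (char_exponent TYPE('a)) powi m \<and>
          (\<forall>x. x \<noteq> 0 \<longrightarrow> f x = frac_power x n m)))"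
proof -
  have "C_minimal L M"
    using assms(4,5) unfolding C_minimal_theory_def monster_model_def by blast
  then interpret C_minimal_valued_field E M v res
    using assms(6,7) unfolding L_def by unfold_locales
  have f: "\<And>x. x \<noteq> 0 \<Longrightarrow> f x \<noteq> 0" "\<And>x y. x \<noteq> 0 \<Longrightarrow> y \<noteq> 0 \<Longrightarrow> f (x * y) = f x * f y"
    and graph: "definable (vf_lang E) M 2 (graph_on (UNIV - {0}) f)"
    using assms(11) unfolding definable_mult_endo_def L_def by blast+
  \<comment> \<open>\<open>f\<close> is arbitrary at 0, so it is replaced by a total multiplicative
    map.\<close>
  define F where "F x = (if x = 0 then 0 else f x)" for x
  \<comment> \<open>The map \<open>1 - i\<close> exchanges the positions 0 and 1:
    \<open>tdef\<close> expects the value first, while \<open>graph_on\<close> lists the argument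
    first.\<close>
  have "pdef (\<lambda>e. e 0 = 0 \<and> e 1 = 0 \<or> map (\<lambda>i. e (1 - i)) [0..<2] \<in> graph_on (UNIV - {0}) f)"
    using pdef_subst[OF definable_pdef[OF graph], of "\<lambda>i. 1 - i"]
    by (intro pdef_disj pdef_intros)
  then have "pdef (\<lambda>e. e 0 = F (e (Suc 0)))"
    by (rule pdef_cong) (auto simp: F_def graph_on_def upt_rec)
  then have F: "definable_endo F"
    unfolding definable_endo_def tdef_def using f by (simp add: F_def)
  then obtain g where g: "induces F g" using ex_induces by blast
  have F_f: "F x = f x" if "x \<noteq> 0" for x using that by (simp add: F_def)
  show ?thesis
  proof (intro exI[of _ g] conjI impI allI)
    show "definable_VG_endo L M v g" unfolding L_def by (rule induces_definable[OF g])
    show "v (f x) = g (v x)" if "x \<noteq> 0" for x using induces_v[OF g that] F_f[OF that] by simp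
    show "\<exists>q. is_rat_mult q g"
      if "RF_no_exotic_automorphisms L M v res \<or> VG_no_exotic_automorphisms L M v"
      using that rat_mult_if_RF_no_exotic[OF g] rat_mult_if_VG_no_exotic[OF g] unfolding L_def by blast
    show "\<exists>n m :: int. q = of_int n / of_nat (char_exponent TYPE('a)) powi m \<and>
        (\<forall>x. x \<noteq> 0 \<longrightarrow> f x = frac_power x n m)" if "is_rat_mult q g" for q
      using frac_power_if_rat_mult[OF g that] F_f by simp
  qed
qed

end
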